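(* Let $n$ be an even integer, let $m=m(n)$ be an arbitrary integer-valued function of $n$, and let $M\sim M(n,m)$. Then with high probability (as $n\to\infty$ through even integers) $\chi'(M)=\Delta(M)$.
   Context: $M(n,m)$ is the probability space of loopless multigraphs on the vertex set $[n]=\{1,\dots,n\}$ with $m$ edges, in which $m$ elements of $\binom{[n]}{2}$ are chosen independently and uniformly at random with repetitions (each chosen pair contributes one edge, so multiplicities are counted). For a multigraph $G$: $\chi'(G)$ is the chromatic index, i.e. the minimum $k$ such that the edges of $G$ can be coloured with $k$ colours so that any two distinct edges sharing a vertex (in particular, parallel edges) receive different colours; $\Delta(G)$ is the maximum degree, counted with multiplicities. An event holds with high probability if its probability tends to $1$ as $n\to\infty$. *)

theory Defs
  imports "HOL-Probability.Probability" "HOL-Library.Ramsey"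
begin

type_synonym 'a mgraph = "'a set multiset"

text \<open>
  A loopless multigraph is given by its multiset of two-element edges. The vertex set is not
  part of this data; it is a separate argument wherever it matters. Parallel edges are told
  apart by a copy number: an edge is a pair \<open>(e, i)\<close> with \<open>i\<close> below the multiplicity of \<open>e\<close>.
\<close>

definition mg_edges :: "'a mgraph \<Rightarrow> ('a set \<times> nat) set" where
  "mg_edges G = {(e, i). i < count G e}"

definition proper_edge_colouring :: "'a mgraph \<Rightarrow> nat \<Rightarrow> ('a set \<times> nat \<Rightarrow> nat) \<Rightarrow> bool" where
  "proper_edge_colouring G k c \<longleftrightarrow>
     (\<forall>x \<in> mg_edges G. c x < k) \<and>
     (\<forall>x \<in> mg_edges G. \<forall>y \<in> mg_edges G. x \<noteq> y \<and> fst x \<inter> fst y \<noteq> {} \<longrightarrow> c x \<noteq> c y)"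

definition chromatic_index :: "'a mgraph \<Rightarrow> nat" where
  "chromatic_index G = (LEAST k. \<exists>c. proper_edge_colouring G k c)"

definition mg_degree :: "'a mgraph \<Rightarrow> 'a \<Rightarrow> nat" where
  "mg_degree G v = size {#e \<in># G. v \<in> e#}"

definition max_degree :: "'a set \<Rightarrow> 'a mgraph \<Rightarrow> nat" where
  "max_degree V G = Max (mg_degree G ` V)"

text \<open>
  For \<open>n < 2\<close> there are no pairs to choose from and the distribution is unspecified;
  this is harmless for limits as \<open>n\<close> tends to infinity.
\<close>

definition random_multigraph :: "nat \<Rightarrow> nat \<Rightarrow> nat mgraph pmf" where
  "random_multigraph n m = map_pmf mset (replicate_pmf m (pmf_of_set (nsets {1..n} 2)))"

end

theory Submission imports Defs "HOL-Real_Asymp.Real_Asymp" begin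

text \<open>
  Only vertices whose degree is close to the maximum degree \<open>\<Delta>\<close> can obstruct an edge colouring with
  \<open>\<Delta>\<close> colours, and in a random multigraph on an even number of vertices these vertices are
  typically too few and too far apart to do so.

  The deterministic half is an extension principle. Suppose that \<open>x\<close> has degree at most \<open>k\<close> and every
  neighbour \<open>z\<close> of \<open>x\<close> satisfies \<open>d(z) + \<mu>(x,z) \<le> k\<close>, except that one neighbour may exceed the bound by
  one. Then every colouring of the rest with \<open>k\<close> colours can be modified and extended to the edges at
  \<open>x\<close> (\<open>extend_colouring_to_star\<close>, the argument of Ehrenfeucht, Faber and Kierstead, carried over to
  multigraphs). Peeling off such vertices one by one yields two sufficient conditions for the
  chromatic index to be \<open>\<Delta>\<close>. The first one is that every nonempty vertex set spans fewer edges than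
  it has elements (\<open>class_one_if_sparse\<close>). The second one is that all multiplicities are at most \<open>s\<close>
  and no two adjacent vertices both have degree above \<open>\<Delta> - s\<close>: a vertex of such large degree, or any
  vertex if there is none left, can be peeled off. Here the parity of \<open>n\<close> helps: the complete graph
  has a factorisation into perfect matchings, so \<open>T\<close> copies of it, with \<open>T\<close> below all multiplicities,
  can be coloured separately, at a cost of \<open>T (n - 1)\<close> colours, which is exactly what they contribute
  to every degree. Therefore \<open>s\<close> only has to bound the spread of the multiplicities, and adjacency only
  counts beyond multiplicity \<open>T\<close> (\<open>class_one_if_top_isolated\<close>).

  For the probabilistic half put \<open>d = 2m/n\<close>, the mean degree, and \<open>\<lambda> = d/(n - 1)\<close>, the mean
  multiplicity. Degrees vary on the scale \<open>\<surd>d\<close>, multiplicities only on the scale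
  \<open>\<surd>(\<lambda> ln n) + ln n\<close>, which is smaller by a power of \<open>n\<close> once \<open>d \<ge> n powr 0.6\<close>. In that range the
  vertex of maximum degree typically leads all others by more than the spread of the multiplicities.
  For \<open>d \<le> n powr 0.6\<close> and \<open>m \<ge> n powr 0.99\<close> the multiplicities are typically at most 5, and the few
  vertices near the top are pairwise nonadjacent. For \<open>m \<le> n powr 0.99\<close> the first condition holds
  with high probability, by a union bound over vertex sets.

  To control the top of the degree sequence without knowing the distribution of the maximum, let \<open>t\<close>
  be the quantile with tail probability about \<open>n powr -0.9\<close> of a single degree. Distinct degrees are
  negatively correlated, so by the second moment method \<open>\<Delta> \<ge> t\<close> with high probability
  (\<open>max_degree_reaches_quantile\<close>). When the threshold is lowered by the relevant amount, the tail of a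
  degree grows by at most a small power of \<open>n\<close> (\<open>tail_shift\<close>), so roughly \<open>n powr 0.2\<close> pairs of vertices have both degrees near
  or above \<open>t\<close>. A given such pair is adjacent with probability about \<open>d/n\<close>, and two such degrees agree
  up to \<open>s\<close> with probability of order \<open>s ln n / \<surd>d\<close> (\<open>close_degrees_bound\<close>). All bounds depend on \<open>n\<close>
  alone, which is why \<open>m\<close> may be an arbitrary function of \<open>n\<close>.
\<close>

section \<open>Orbits of two involutions\<close>

lemma funpow_even_orbit_point:
  fixes \<tau> :: "'a \<Rightarrow> 'a"
  assumes period: "(\<tau> ^^ L) z = z" "L > 0"
    and least: "\<And>l. 0 < l \<Longrightarrow> l < L \<Longrightarrow> (\<tau> ^^ l) z \<noteq> z"
    and square: "(\<tau> ^^ (2 * k)) z = z"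
  shows "(\<tau> ^^ k) z \<in> {z, (\<tau> ^^ (L div 2)) z}"
proof -
  define j where "j = k mod L"
  have j: "j < L" "(\<tau> ^^ k) z = (\<tau> ^^ j) z"
    using period by (simp_all add: j_def funpow_mod_eq)
  have "(\<tau> ^^ ((2 * k) mod L)) z = z"
    using square period(1) by (simp add: funpow_mod_eq)
  then have "(2 * k) mod L = 0"
    using least[of "(2 * k) mod L"] period(2) mod_less_divisor[of L "2 * k"] by blast
  then have "(2 * j) mod L = 0"
    by (simp add: j_def mod_mult_right_eq)
  then obtain q where q: "2 * j = L * q" by (metis dvd_def mod_eq_0_iff_dvd)
  have "L * q < L * 2" using q j(1) by linarith
  then have "q < 2" by simp
  then have "q = 0 \<or> q = 1" by auto
  then have "j = 0 \<or> j = L div 2" using q by auto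
  then show ?thesis using j(2) by auto
qed

text \<open>
  The Kempe chains of two colours are the orbits of the two involutions \<open>f\<close> and \<open>g\<close> that exchange
  the ends of the edges of these colours. A chain has at most two ends, so a chain contains at
  most two vertices that miss the colour of \<open>g\<close>. An odd set of such vertices therefore cannot be
  paired up by the chains, and some chain \<open>Q\<close> contains exactly one of them. Starting from a fixed
  point \<open>z\<close> of \<open>g\<close>, the chain is the orbit of \<open>z\<close> under \<open>\<tau> = g \<circ> f\<close> alone, because \<open>\<tau> g \<tau> = g\<close>.
\<close>

lemma odd_fixed_points_separated:
  fixes f g :: "'a \<Rightarrow> 'a"
  assumes fin: "finite V" and fV: "f ` V \<subseteq> V" and gV: "g ` V \<subseteq> V"
    and ff: "\<And>v. f (f v) = v" and gg: "\<And>v. g (g v) = v"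
    and XV: "X \<subseteq> V" and odd: "odd (card X)" and fixd: "\<And>v. v \<in> X \<Longrightarrow> g v = v"
  shows "\<exists>z Q. z \<in> X \<and> Q \<inter> X = {z} \<and> f ` Q \<subseteq> Q \<and> g ` Q \<subseteq> Q"
proof -
  define \<tau> where "\<tau> = g \<circ> f"
  define orb where "orb z = range (\<lambda>k. (\<tau> ^^ k) z)" for z
  have inj: "inj \<tau>" unfolding \<tau>_def
    by (metis comp_apply ff gg injI)
  have injk: "inj (\<tau> ^^ k)" for k using inj by (rule inj_fn)
  have in_V: "(\<tau> ^^ k) z \<in> V" if "z \<in> V" for k z
    using that fV gV by (induction k) (auto simp: \<tau>_def)
  have ex_period: "\<exists>L>0. (\<tau> ^^ L) z = z" if "z \<in> V" for z
  proof -
    have "\<not> inj (\<lambda>k. (\<tau> ^^ k) z)"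
    proof
      assume "inj (\<lambda>k. (\<tau> ^^ k) z)"
      then have "infinite (range (\<lambda>k. (\<tau> ^^ k) z))" by (rule range_inj_infinite)
      moreover have "range (\<lambda>k. (\<tau> ^^ k) z) \<subseteq> V" using in_V[OF that] by auto
      ultimately show False using fin finite_subset by blast
    qed
    then obtain a' b' where "a' \<noteq> b'" "(\<tau> ^^ a') z = (\<tau> ^^ b') z"
      unfolding inj_def by blast
    then obtain a b where ab: "a < b" "(\<tau> ^^ a) z = (\<tau> ^^ b) z"
      by (cases a' b' rule: linorder_cases) auto
    have "(\<tau> ^^ b) z = (\<tau> ^^ (a + (b - a))) z" using ab(1) by simp
    also have "\<dots> = (\<tau> ^^ a) ((\<tau> ^^ (b - a)) z)" by (simp only: funpow_add comp_apply)
    finally have "(\<tau> ^^ (b - a)) z = z"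
      using ab(2) injD[OF injk] by metis
    then show ?thesis using ab(1) by (metis zero_less_diff)
  qed
  have return: "\<exists>j. (\<tau> ^^ j) ((\<tau> ^^ k) z) = z \<and> (\<tau> ^^ k) ((\<tau> ^^ j) z) = z" if "z \<in> V" for k z
  proof -
    obtain L where L: "L > 0" "(\<tau> ^^ L) z = z" using ex_period[OF \<open>z \<in> V\<close>] by blast
    have Lk: "(\<tau> ^^ (L * k)) z = z"
      using L(2) funpow_mod_eq[of L \<tau> z "L * k"] by simp
    have e: "L * k = (L - 1) * k + k" "L * k = k + (L - 1) * k" using L(1) by (cases L; auto)+
    have "(\<tau> ^^ ((L - 1) * k + k)) z = z" "(\<tau> ^^ (k + (L - 1) * k)) z = z"
      by (rule Lk[unfolded e(1)], rule Lk[unfolded e(2)])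
    then have "(\<tau> ^^ ((L - 1) * k)) ((\<tau> ^^ k) z) = z" "(\<tau> ^^ k) ((\<tau> ^^ ((L - 1) * k)) z) = z"
      by (simp_all only: funpow_add comp_apply)
    then show ?thesis by blast
  qed
  have conj: "(\<tau> ^^ k) (g ((\<tau> ^^ k) v)) = g v" for k v
  proof (induction k arbitrary: v)
    case (Suc k)
    have "(\<tau> ^^ Suc k) (g ((\<tau> ^^ Suc k) v)) = \<tau> ((\<tau> ^^ k) (g ((\<tau> ^^ k) (\<tau> v))))"
      by (simp add: funpow_swap1)
    also have "\<dots> = \<tau> (g (\<tau> v))" using Suc.IH by simp
    also have "\<dots> = g v" by (simp add: \<tau>_def ff gg)
    finally show ?case .
  qed simp
  have self: "z \<in> orb z" for z unfolding orb_def by (metis funpow_0 rangeI)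
  have g_orb: "g ` orb z \<subseteq> orb z" if z: "z \<in> X" for z
  proof
    fix w assume "w \<in> g ` orb z"
    then obtain k where k: "w = g ((\<tau> ^^ k) z)" by (auto simp: orb_def)
    obtain j where j: "(\<tau> ^^ k) ((\<tau> ^^ j) z) = z" using return z XV by blast
    have "(\<tau> ^^ k) w = z" using conj[of k z] fixd[OF z] k by simp
    then have "w = (\<tau> ^^ j) z" using j injD[OF injk] by metis
    then show "w \<in> orb z" by (auto simp: orb_def)
  qed
  have f_orb: "f ` orb z \<subseteq> orb z" if z: "z \<in> X" for z
  proof
    fix w assume "w \<in> f ` orb z"
    then obtain k where k: "w = f ((\<tau> ^^ k) z)" by (auto simp: orb_def)
    have "f v = g (\<tau> v)" for v by (simp add: \<tau>_def gg)
    then have "w = g ((\<tau> ^^ Suc k) z)" using k by simp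
    moreover have "(\<tau> ^^ Suc k) z \<in> orb z" unfolding orb_def by blast
    ultimately show "w \<in> orb z" using g_orb[OF z] by blast
  qed
  have orb_eq: "orb w = orb z" if z: "z \<in> X" and w: "w \<in> orb z" for z w
  proof -
    obtain k where k: "w = (\<tau> ^^ k) z" using w by (auto simp: orb_def)
    obtain j where j: "(\<tau> ^^ j) w = z" using return z XV k by blast
    have *: "orb ((\<tau> ^^ i) v) \<subseteq> orb v" for i v
    proof
      fix u assume "u \<in> orb ((\<tau> ^^ i) v)"
      then obtain l where "u = (\<tau> ^^ l) ((\<tau> ^^ i) v)" by (auto simp: orb_def)
      then have "u = (\<tau> ^^ (l + i)) v" by (simp add: funpow_add)
      then show "u \<in> orb v" by (auto simp: orb_def)
    qed
    show ?thesis using *[of k z] *[of j w] k j by auto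
  qed
  \<comment> \<open>If \<open>\<tau>^k z\<close> is fixed by \<open>g\<close> too, then \<open>\<tau>^(2k) z = z\<close>, so \<open>k\<close> is 0 or half the period.\<close>
  have card2: "card (orb z \<inter> X) \<le> 2" if z: "z \<in> X" for z
  proof -
    define L where "L = (LEAST L. L > 0 \<and> (\<tau> ^^ L) z = z)"
    have L: "L > 0 \<and> (\<tau> ^^ L) z = z"
      unfolding L_def by (rule LeastI_ex) (rule ex_period[OF subsetD[OF XV z]])
    have least: "(\<tau> ^^ l) z \<noteq> z" if "0 < l" "l < L" for l
      using that not_less_Least unfolding L_def by blast
    have "orb z \<inter> X \<subseteq> {z, (\<tau> ^^ (L div 2)) z}"
    proof
      fix w assume w: "w \<in> orb z \<inter> X"
      then obtain k where k: "w = (\<tau> ^^ k) z" by (auto simp: orb_def)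
      have "(\<tau> ^^ k) w = z" using conj[of k z] fixd[OF z] fixd[of w] w k by simp
      then have "(\<tau> ^^ (2 * k)) z = z" using k by (simp add: mult_2 funpow_add)
      then show "w \<in> {z, (\<tau> ^^ (L div 2)) z}"
        using funpow_even_orbit_point[of L \<tau> z k] L least k by blast
    qed
    then have "card (orb z \<inter> X) \<le> card {z, (\<tau> ^^ (L div 2)) z}" by (intro card_mono) auto
    also have "\<dots> \<le> 2" by (simp add: card_insert_if)
    finally show ?thesis .
  qed
  have finX: "finite X" using XV fin finite_subset by blast
  have "\<exists>z\<in>X. card (orb z \<inter> X) \<noteq> 2"
  proof (rule ccontr)
    assume "\<not> ?thesis"
    then have all2: "card (orb z \<inter> X) = 2" if "z \<in> X" for z using that by blast
    let ?P = "(\<lambda>z. orb z \<inter> X) ` X"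
    have U: "\<Union>?P = X" using self by auto
    have "2 * card ?P = card (\<Union>?P)"
    proof (rule card_partition)
      show "finite ?P" using finX by simp
      show "finite (\<Union>?P)" using U finX by simp
      show "card c = 2" if "c \<in> ?P" for c using that all2 by auto
      show "c1 \<inter> c2 = {}" if "c1 \<in> ?P" "c2 \<in> ?P" "c1 \<noteq> c2" for c1 c2
        using that orb_eq by blast
    qed
    then show False using U odd by (metis dvd_triv_left)
  qed
  then obtain z where z: "z \<in> X" "card (orb z \<inter> X) \<noteq> 2" by blast
  have "card (orb z \<inter> X) \<noteq> 0" using self z(1) finX by auto
  then have "card (orb z \<inter> X) = 1" using card2[OF z(1)] z(2) by linarith
  then obtain y where "orb z \<inter> X = {y}" by (auto simp: card_1_singleton_iff)
  then have "orb z \<inter> X = {z}" using self z(1) by (metis IntI singletonD)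
  then show ?thesis using z(1) f_orb[OF z(1)] g_orb[OF z(1)] by blast
qed

section \<open>Extending an edge colouring to a new vertex\<close>

text \<open>
  A colouring of the edges of a multigraph is encoded by one involution for each colour \<open>i \<in> C\<close>: it
  exchanges the two ends of every edge of colour \<open>i\<close> and fixes the vertices that miss \<open>i\<close>. Being a
  proper colouring is then automatic, and the multiplicity of \<open>{u, v}\<close> is the number of colours
  that map \<open>u\<close> to \<open>v\<close>.
\<close>

definition involutions :: "'a set \<Rightarrow> nat set \<Rightarrow> (nat \<Rightarrow> 'a \<Rightarrow> 'a) \<Rightarrow> bool" where
  "involutions V C \<pi> \<longleftrightarrow> (\<forall>i\<in>C. \<forall>v. \<pi> i (\<pi> i v) = v \<and> (v \<notin> V \<longrightarrow> \<pi> i v = v))"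

lemma involutions_image:
  assumes "involutions V C \<pi>" "i \<in> C"
  shows "\<pi> i ` V \<subseteq> V"
  using assms unfolding involutions_def by (metis image_subsetI)

lemma involutions_subset:
  "involutions V C \<pi> \<Longrightarrow> D \<subseteq> C \<Longrightarrow> involutions V D \<pi>"
  unfolding involutions_def by blast

text \<open>
  Kempe exchange: the colours \<open>i\<close> and \<open>j\<close> trade places on the vertex set \<open>Q\<close>, which in all uses is a
  union of chains of these two colours.
\<close>

definition swap_on :: "'a set \<Rightarrow> nat \<Rightarrow> nat \<Rightarrow> (nat \<Rightarrow> 'a \<Rightarrow> 'a) \<Rightarrow> nat \<Rightarrow> 'a \<Rightarrow> 'a" where
  "swap_on Q i j \<pi> l v = \<pi> (if v \<in> Q then Transposition.transpose i j l else l) v"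

lemma involutions_swap_on:
  assumes inv: "involutions V C \<pi>" and C: "i \<in> C" "j \<in> C"
    and Q: "\<pi> i ` Q \<subseteq> Q" "\<pi> j ` Q \<subseteq> Q"
  shows "involutions V C (swap_on Q i j \<pi>)"
proof -
  have mem: "\<pi> l v \<in> Q \<longleftrightarrow> v \<in> Q" if "l = i \<or> l = j" for l v
    using that Q inv C unfolding involutions_def by (metis image_subset_iff)
  show ?thesis
    using inv C mem unfolding involutions_def swap_on_def Transposition.transpose_def
    by (auto split: if_splits)
qed

lemma card_swap_on:
  assumes C: "i \<in> C" "j \<in> C"
  shows "card {l\<in>C. swap_on Q i j \<pi> l u = v} = card {l\<in>C. \<pi> l u = v}"
proof (cases "u \<in> Q")
  case True
  have mem: "Transposition.transpose i j l \<in> C \<longleftrightarrow> l \<in> C" for l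
    using C by (auto simp: Transposition.transpose_def)
  have "bij_betw (Transposition.transpose i j) {l\<in>C. swap_on Q i j \<pi> l u = v} {l\<in>C. \<pi> l u = v}"
    using True by (intro bij_betwI[where g = "Transposition.transpose i j"]) (simp_all add: swap_on_def mem)
  then show ?thesis by (rule bij_betw_same_card)
qed (simp add: swap_on_def)

text \<open>
  Let every vertex \<open>z\<close> offer a set \<open>S z\<close> of colours missing at it. If the total number of offers is
  odd and less than twice the number of colours, then after at most one Kempe exchange some colour
  is offered exactly once. Indeed some colour is offered at most once; if it is not offered at all,
  parity provides a colour \<open>j\<close> offered an odd number of times, and exchanging along a chain that
  contains just one vertex offering \<open>j\<close> makes that vertex the only one to offer \<open>i\<close>.
\<close>

lemma isolate_colour:
  assumes fin: "finite V" "finite C" and inv: "involutions V C \<pi>"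
    and S: "\<And>z. z \<in> V \<Longrightarrow> S z \<subseteq> {i\<in>C. \<pi> i z = z}"
    and odd: "odd (\<Sum>z\<in>V. card (S z))" and less: "(\<Sum>z\<in>V. card (S z)) < 2 * card C"
  shows "\<exists>i\<in>C. \<exists>z\<in>V. \<exists>\<pi>' S'. involutions V C \<pi>' \<and>
           (\<forall>u v. card {l\<in>C. \<pi>' l u = v} = card {l\<in>C. \<pi> l u = v}) \<and>
           (\<forall>v. (\<forall>l\<in>C. \<pi> l v = v) \<longrightarrow> (\<forall>l\<in>C. \<pi>' l v = v)) \<and>
           (\<forall>v\<in>V. S' v \<subseteq> {i\<in>C. \<pi>' i v = v} \<and> card (S' v) = card (S v)) \<and>
           {v\<in>V. i \<in> S' v} = {z}"
proof -
  define X where "X i = {v\<in>V. i \<in> S v}" for i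
  have finX: "finite (X i)" for i using fin by (simp add: X_def)
  have finS: "finite (S z)" if "z \<in> V" for z
    using S[OF that] fin(2) by (auto intro: finite_subset)
  have sum: "(\<Sum>i\<in>C. card (X i)) = (\<Sum>z\<in>V. card (S z))"
  proof -
    have "(\<Sum>i\<in>C. card (X i)) = (\<Sum>i\<in>C. \<Sum>z\<in>V. of_bool (i \<in> S z))"
      using fin by (intro sum.cong) (auto simp: X_def of_bool_def sum.If_cases Int_def)
    also have "\<dots> = (\<Sum>z\<in>V. \<Sum>i\<in>C. of_bool (i \<in> S z))" by (rule sum.swap)
    also have "\<dots> = (\<Sum>z\<in>V. card (S z))"
    proof (intro sum.cong refl)
      fix z assume z: "z \<in> V"
      then have "C \<inter> {i. i \<in> S z} = S z" using S by blast
      then show "(\<Sum>i\<in>C. of_bool (i \<in> S z)) = card (S z)"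
        using fin by (simp add: of_bool_def sum.If_cases)
    qed
    finally show ?thesis .
  qed
  show ?thesis
  proof (cases "\<exists>i\<in>C. card (X i) = 1")
    case True
    then obtain i z where "i \<in> C" "X i = {z}" by (auto simp: card_1_singleton_iff)
    moreover from this have "z \<in> V" by (auto simp: X_def)
    ultimately show ?thesis using inv S unfolding X_def
      by (intro bexI[of _ i] bexI[of _ z] exI[of _ \<pi>] exI[of _ S]) auto
  next
    case False
    have "\<exists>i\<in>C. card (X i) < 2"
    proof (rule ccontr)
      assume "\<not> ?thesis"
      then have "(\<Sum>i\<in>C. 2) \<le> (\<Sum>i\<in>C. card (X i))" by (intro sum_mono) auto
      then show False using less sum by simp
    qed
    then obtain i where i: "i \<in> C" "X i = {}"
      using False finX by (metis One_nat_def card_0_eq less_2_cases)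
    have "\<exists>j\<in>C. odd (card (X j))"
      using odd sum by (metis dvd_sum)
    then obtain j where j: "j \<in> C" "odd (card (X j))" by blast
    have ij: "i \<noteq> j" using i j by auto
    have "\<exists>z Q. z \<in> X j \<and> Q \<inter> X j = {z} \<and> \<pi> i ` Q \<subseteq> Q \<and> \<pi> j ` Q \<subseteq> Q"
    proof (rule odd_fixed_points_separated)
      show "finite V" by fact
      show "\<pi> i ` V \<subseteq> V" using inv i(1) by (rule involutions_image)
      show "\<pi> j ` V \<subseteq> V" using inv j(1) by (rule involutions_image)
      show "\<pi> i (\<pi> i v) = v" "\<pi> j (\<pi> j v) = v" for v using inv i j by (auto simp: involutions_def)
      show "X j \<subseteq> V" by (auto simp: X_def)
      show "odd (card (X j))" by fact
      show "\<pi> j v = v" if "v \<in> X j" for v using that S by (auto simp: X_def)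
    qed
    then obtain z Q where z: "z \<in> X j" and Q: "Q \<inter> X j = {z}" "\<pi> i ` Q \<subseteq> Q" "\<pi> j ` Q \<subseteq> Q"
      by blast
    have zV: "z \<in> V" "j \<in> S z" "z \<in> Q" "i \<notin> S z" using z i Q by (auto simp: X_def)
    define \<pi>' where "\<pi>' = swap_on Q i j \<pi>"
    define S' where "S' = S(z := insert i (S z - {j}))"
    show ?thesis
    proof (intro bexI exI conjI)
      show "involutions V C \<pi>'" unfolding \<pi>'_def
        using inv i(1) j(1) Q(2,3) by (rule involutions_swap_on)
      show "\<forall>u v. card {l\<in>C. \<pi>' l u = v} = card {l\<in>C. \<pi> l u = v}"
        unfolding \<pi>'_def using i(1) j(1) by (simp add: card_swap_on)
      show "\<forall>v. (\<forall>l\<in>C. \<pi> l v = v) \<longrightarrow> (\<forall>l\<in>C. \<pi>' l v = v)"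
        using i(1) j(1) by (auto simp: \<pi>'_def swap_on_def Transposition.transpose_def)
      show "\<forall>v\<in>V. S' v \<subseteq> {i\<in>C. \<pi>' i v = v} \<and> card (S' v) = card (S v)"
      proof
        fix v assume v: "v \<in> V"
        show "S' v \<subseteq> {i\<in>C. \<pi>' i v = v} \<and> card (S' v) = card (S v)"
        proof (cases "v = z")
          case True
          have "card (insert i (S z - {j})) = card (S z)"
            using zV(2,4) finS[OF zV(1)] by (simp add: card_Suc_Diff1 del: card_Diff_insert card_Diff_singleton)
          moreover have "l \<in> C \<and> \<pi>' l z = z" if "l \<in> insert i (S z - {j})" for l
          proof (cases "l = i")
            case True
            then show ?thesis using S[OF zV(1)] zV(2,3) i(1) by (auto simp: \<pi>'_def swap_on_def)
          next
            case False
            then have "Transposition.transpose i j l = l" using that by (auto simp: Transposition.transpose_def)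
            then show ?thesis using S[OF zV(1)] that False by (auto simp: \<pi>'_def swap_on_def)
          qed
          then have "insert i (S z - {j}) \<subseteq> {i\<in>C. \<pi>' i z = z}" by blast
          ultimately show ?thesis using True by (simp add: S'_def)
        next
          case False
          have "i \<notin> S v" using v i by (auto simp: X_def)
          moreover have "j \<notin> S v" if "v \<in> Q" using False v that Q(1) by (auto simp: X_def)
          ultimately have "(if v \<in> Q then Transposition.transpose i j l else l) = l" if "l \<in> S v" for l
            using that by (auto simp: Transposition.transpose_def)
          then have "S v \<subseteq> {i\<in>C. \<pi>' i v = v}"
            using S[OF v] by (auto simp: \<pi>'_def swap_on_def)
          then show ?thesis using False by (simp add: S'_def)
        qed
      qed
      show "{v\<in>V. i \<in> S' v} = {z}"
        using i zV by (auto simp: S'_def X_def)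
    qed (use i zV in auto)
  qed
qed

text \<open>
  Here \<open>x\<close> is an uncoloured vertex that is to receive \<open>b z\<close> edges to each \<open>z\<close>. If every \<open>z\<close> offers
  \<open>2 * b z\<close> missing colours, one of them only \<open>2 * b z - 1\<close>, the number of offers is odd and less than
  twice the number of colours. Hence some colour can be made to be offered by a single
  vertex \<open>z\<close>. Giving it to one of the edges \<open>{x, z}\<close> and retiring it costs \<open>z\<close> one offer and nobody
  else anything, while \<open>b z\<close> drops by one, so the hypotheses survive with one colour less. The
  exceptional vertex \<open>z0\<close> is what later allows forests to be peeled.
\<close>

lemma extend_colouring_to_star:
  assumes "finite V" "finite C" "involutions V C \<pi>" "x \<in> V"
    and "\<And>i. i \<in> C \<Longrightarrow> \<pi> i x = x"
    and "b x = 0" "(\<Sum>z\<in>V. b z) \<le> card C"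
    and "\<And>z. z \<in> V \<Longrightarrow> b z > 0 \<Longrightarrow> 2 * b z \<le> card {i\<in>C. \<pi> i z = z} + of_bool (z = z0)"
  shows "\<exists>\<pi>'. involutions V C \<pi>' \<and> (\<forall>u\<in>V. \<forall>v\<in>V. u \<noteq> v \<longrightarrow>
           card {i\<in>C. \<pi>' i u = v} = card {i\<in>C. \<pi> i u = v}
             + (if u = x then b v else if v = x then b u else 0))"
  using assms
proof (induction "\<Sum>z\<in>V. b z" arbitrary: C \<pi> b z0)
  case 0
  then have "\<And>z. z \<in> V \<Longrightarrow> b z = 0" by simp
  then show ?case using 0 by (intro exI[of _ \<pi>]) auto
next
  case (Suc B)
  note fin = \<open>finite V\<close> \<open>finite C\<close>
  obtain z1 where z1: "z1 \<in> V" "b z1 > 0" "b z0 > 0 \<and> z0 \<in> V \<longrightarrow> z1 = z0"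
  proof (cases "b z0 > 0 \<and> z0 \<in> V")
    case True
    then show ?thesis using that by blast
  next
    case False
    have "\<exists>z\<in>V. b z > 0" using Suc.hyps(2)
      by (metis Zero_not_Suc gr0I sum.neutral)
    then show ?thesis using that False by blast
  qed
  have req: "2 * b z \<le> card {i\<in>C. \<pi> i z = z} + of_bool (z = z1)" if "z \<in> V" "b z > 0" for z
    using Suc.prems(8)[OF that] z1 that by (cases "z = z0") auto
  have "\<exists>T \<subseteq> {i\<in>C. \<pi> i z = z}. card T = 2 * b z - of_bool (z = z1)" if "z \<in> V" for z
    using req[OF that] by (intro ex_card) (cases "b z > 0"; auto)
  then obtain S where S: "\<And>z. z \<in> V \<Longrightarrow> S z \<subseteq> {i\<in>C. \<pi> i z = z}"
      "\<And>z. z \<in> V \<Longrightarrow> card (S z) = 2 * b z - of_bool (z = z1)" by metis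
  have "(\<Sum>z\<in>V. card (S z)) + 1 = (\<Sum>z\<in>V. card (S z)) + (\<Sum>z\<in>V. of_bool (z = z1))"
    using z1 fin by (simp add: of_bool_def)
  also have "\<dots> = (\<Sum>z\<in>V. 2 * b z)"
    unfolding sum.distrib[symmetric] using S(2) z1(2) by (intro sum.cong) auto
  also have "\<dots> = 2 * Suc B" using Suc.hyps(2) by (simp add: sum_distrib_left)
  finally have sumS: "(\<Sum>z\<in>V. card (S z)) = 2 * B + 1" by simp
  have le: "Suc B \<le> card C" using Suc.hyps(2) Suc.prems(7) by simp
  have "odd (\<Sum>z\<in>V. card (S z))" "(\<Sum>z\<in>V. card (S z)) < 2 * card C"
    using sumS le by simp_all
  from isolate_colour[OF fin Suc.prems(3) S(1) this]
  obtain i z \<pi>1 S1 where i: "i \<in> C" and z: "z \<in> V" and inv1: "involutions V C \<pi>1"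
    and cnt1: "\<And>u v. card {l\<in>C. \<pi>1 l u = v} = card {l\<in>C. \<pi> l u = v}"
    and fix1: "\<And>v. (\<forall>l\<in>C. \<pi> l v = v) \<Longrightarrow> (\<forall>l\<in>C. \<pi>1 l v = v)"
    and S1: "\<And>v. v \<in> V \<Longrightarrow> S1 v \<subseteq> {i\<in>C. \<pi>1 i v = v}" "\<And>v. v \<in> V \<Longrightarrow> card (S1 v) = card (S v)"
    and only: "{v\<in>V. i \<in> S1 v} = {z}"
    by (smt (verit, best))
  have iz: "i \<in> S1 z" using only by blast
  have finS1: "finite (S1 v)" if "v \<in> V" for v
    using S1(1)[OF that] fin(2) by (auto intro: finite_subset)
  have bz: "b z > 0"
  proof (rule ccontr)
    assume "\<not> b z > 0"
    then have "card (S1 z) = 0" using S1(2) S(2) z by simp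
    then show False using iz finS1 z by auto
  qed
  have x1: "\<pi>1 l x = x" if "l \<in> C" for l using fix1 Suc.prems(5) that by blast
  have xz: "x \<noteq> z" using bz Suc.prems(6) by auto
  \<comment> \<open>The colour \<open>i\<close> is spent on one edge between \<open>x\<close> and \<open>z\<close>; the rest is left to the induction hypothesis.\<close>
  define b' where "b' = b(z := b z - 1)"
  define C' where "C' = C - {i}"
  have sumb': "(\<Sum>v\<in>V. b' v) = B"
  proof -
    have "(\<Sum>v\<in>V. b v) = b z + (\<Sum>v\<in>V-{z}. b v)" "(\<Sum>v\<in>V. b' v) = b' z + (\<Sum>v\<in>V-{z}. b' v)"
      using z fin by (simp_all add: sum.remove)
    moreover have "(\<Sum>v\<in>V-{z}. b' v) = (\<Sum>v\<in>V-{z}. b v)" by (intro sum.cong) (auto simp: b'_def)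
    ultimately show ?thesis using Suc.hyps(2) bz by (simp add: b'_def)
  qed
  have "\<exists>\<pi>'. involutions V C' \<pi>' \<and> (\<forall>u\<in>V. \<forall>v\<in>V. u \<noteq> v \<longrightarrow>
           card {l\<in>C'. \<pi>' l u = v} = card {l\<in>C'. \<pi>1 l u = v}
             + (if u = x then b' v else if v = x then b' u else 0))"
  proof (rule Suc.hyps(1)[of b' C' \<pi>1 z1])
    show "B = (\<Sum>v\<in>V. b' v)" using sumb' by simp
    show "finite V" "finite C'" "x \<in> V" using fin Suc.prems by (simp_all add: C'_def)
    show "involutions V C' \<pi>1" using inv1 by (rule involutions_subset) (auto simp: C'_def)
    show "\<pi>1 l x = x" if "l \<in> C'" for l using x1 that by (simp add: C'_def)
    show "b' x = 0" using xz Suc.prems(6) by (simp add: b'_def)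
    show "(\<Sum>v\<in>V. b' v) \<le> card C'" using sumb' le i fin by (simp add: C'_def)
    show "2 * b' v \<le> card {l\<in>C'. \<pi>1 l v = v} + of_bool (v = z1)" if v: "v \<in> V" "b' v > 0" for v
    proof -
      have "S1 v - {i} \<subseteq> {l\<in>C'. \<pi>1 l v = v}" using S1(1)[OF v(1)] by (auto simp: C'_def)
      then have *: "card (S1 v - {i}) \<le> card {l\<in>C'. \<pi>1 l v = v}"
        using fin by (intro card_mono) (auto simp: C'_def)
      have c: "card (S1 v) = 2 * b v - of_bool (v = z1)" using S1(2) S(2) v by simp
      show ?thesis
      proof (cases "v = z")
        case True
        then have "card (S1 v - {i}) = 2 * b v - of_bool (v = z1) - 1" using iz c by simp
        then show ?thesis using * True by (simp add: b'_def)
      next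
        case False
        then have "i \<notin> S1 v" using only v by blast
        then show ?thesis using * c False by (simp add: b'_def)
      qed
    qed
  qed
  then obtain \<pi>2 where inv2: "involutions V C' \<pi>2"
    and cnt2: "\<And>u v. u \<in> V \<Longrightarrow> v \<in> V \<Longrightarrow> u \<noteq> v \<Longrightarrow>
           card {l\<in>C'. \<pi>2 l u = v} = card {l\<in>C'. \<pi>1 l u = v}
             + (if u = x then b' v else if v = x then b' u else 0)" by blast
  have iz1: "\<pi>1 i z = z" using iz S1(1)[OF z] by blast
  define \<pi>3 where "\<pi>3 = \<pi>2(i := (\<pi>1 i)(x := z, z := x))"
  have inv3: "involutions V C \<pi>3"
  proof -
    have "\<pi>3 i (\<pi>3 i v) = v" for v
    proof -
      have "\<pi>1 i (\<pi>1 i v) = v" using inv1 i by (simp add: involutions_def)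
      then show ?thesis using x1[OF i] iz1 by (auto simp: \<pi>3_def)
    qed
    moreover have "\<pi>3 i v = v" if "v \<notin> V" for v
      using that inv1 i z Suc.prems(4) by (auto simp: \<pi>3_def involutions_def)
    ultimately show ?thesis using inv2 by (auto simp: involutions_def \<pi>3_def C'_def)
  qed
  have split: "card {l\<in>C. P l} = card {l\<in>C'. P l} + of_bool (P i)" for P
  proof -
    have "{l\<in>C. P l} = {l\<in>C'. P l} \<union> (if P i then {i} else {})" using i by (auto simp: C'_def)
    then show ?thesis using fin by (auto simp: C'_def)
  qed
  have "card {l\<in>C. \<pi>3 l u = v} = card {l\<in>C. \<pi> l u = v}
             + (if u = x then b v else if v = x then b u else 0)"
    if uv: "u \<in> V" "v \<in> V" "u \<noteq> v" for u v
  proof -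
    have "{l\<in>C'. \<pi>3 l u = v} = {l\<in>C'. \<pi>2 l u = v}" by (auto simp: \<pi>3_def C'_def)
    then have "card {l\<in>C. \<pi>3 l u = v} = card {l\<in>C'. \<pi>1 l u = v}
             + (if u = x then b' v else if v = x then b' u else 0) + of_bool (\<pi>3 i u = v)"
      using split[of "\<lambda>l. \<pi>3 l u = v"] cnt2[OF uv] by simp
    moreover have "(if u = x then b' v else if v = x then b' u else 0) + of_bool (\<pi>3 i u = v)
        = (if u = x then b v else if v = x then b u else 0) + of_bool (\<pi>1 i u = v)"
      using uv xz bz x1[OF i] iz1
      by (auto simp: \<pi>3_def b'_def)
    ultimately show ?thesis
      using split[of "\<lambda>l. \<pi>1 l u = v"] cnt1[of u v] by simp
  qed
  then show ?case using inv3 by blast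
qed

section \<open>Peeling off vertices and factorising complete graphs\<close>

definition colourable :: "'a set \<Rightarrow> nat \<Rightarrow> ('a \<Rightarrow> 'a \<Rightarrow> nat) \<Rightarrow> bool" where
  "colourable V k \<mu> \<longleftrightarrow> (\<exists>\<pi>. involutions V {..<k} \<pi> \<and>
     (\<forall>u\<in>V. \<forall>v\<in>V. u \<noteq> v \<longrightarrow> card {i\<in>{..<k}. \<pi> i u = v} = \<mu> u v))"

lemma colourable_cong:
  assumes "colourable V k \<mu>" "\<And>u v. u \<in> V \<Longrightarrow> v \<in> V \<Longrightarrow> u \<noteq> v \<Longrightarrow> \<mu> u v = \<nu> u v"
  shows "colourable V k \<nu>"
  using assms unfolding colourable_def by metis

text \<open>
  Every induced subgraph contains a vertex to which the extension lemma applies. A vertex \<open>z\<close> of the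
  subgraph on \<open>S - {x}\<close> misses \<open>k\<close> minus its degree there, so the requirement of \<open>2 * \<mu> x z\<close> missing
  colours becomes the stated inequality for the degree of \<open>z\<close> within \<open>S\<close>.
\<close>

lemma colourable_by_peeling:
  fixes \<mu> :: "'a \<Rightarrow> 'a \<Rightarrow> nat"
  assumes fin: "finite V" and sym: "\<And>u v. \<mu> u v = \<mu> v u"
    and peel: "\<And>S. S \<subseteq> V \<Longrightarrow> S \<noteq> {} \<Longrightarrow> \<exists>x\<in>S. \<exists>z0. (\<Sum>z\<in>S-{x}. \<mu> x z) \<le> k \<and>
       (\<forall>z\<in>S-{x}. \<mu> x z > 0 \<longrightarrow> (\<Sum>v\<in>S-{z}. \<mu> z v) + \<mu> x z \<le> k + of_bool (z = z0))"
  shows "colourable V k \<mu>"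
proof -
  have "colourable S k \<mu>" if "S \<subseteq> V" for S
    using that
  proof (induction "card S" arbitrary: S)
    case 0
    then have "S = {}" using fin finite_subset by fastforce
    then show ?case unfolding colourable_def involutions_def by (intro exI[of _ "\<lambda>_ v. v"]) auto
  next
    case (Suc N)
    have finS: "finite S" using Suc.prems fin finite_subset by blast
    have "S \<noteq> {}" using Suc.hyps(2) by auto
    then obtain x z0 where x: "x \<in> S" and dx: "(\<Sum>z\<in>S-{x}. \<mu> x z) \<le> k"
      and nbr: "\<And>z. z \<in> S - {x} \<Longrightarrow> \<mu> x z > 0 \<Longrightarrow>
            (\<Sum>v\<in>S-{z}. \<mu> z v) + \<mu> x z \<le> k + of_bool (z = z0)"
      using peel[OF Suc.prems] by blast
    define S' where "S' = S - {x}"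
    have "colourable S' k \<mu>"
      using Suc x finS by (intro Suc.hyps(1)) (auto simp: S'_def)
    then obtain \<pi> where inv: "involutions S' {..<k} \<pi>"
      and cnt: "\<And>u v. u \<in> S' \<Longrightarrow> v \<in> S' \<Longrightarrow> u \<noteq> v \<Longrightarrow> card {i\<in>{..<k}. \<pi> i u = v} = \<mu> u v"
      unfolding colourable_def by blast
    have fixx: "\<pi> i x = x" if "i \<in> {..<k}" for i
      using inv that by (auto simp: involutions_def S'_def)
    define b where "b z = (if z = x then 0 else \<mu> x z)" for z
    have missing: "card {i\<in>{..<k}. \<pi> i z = z} + (\<Sum>v\<in>S'-{z}. \<mu> z v) = k" if z: "z \<in> S'" for z
    proof -
      have im: "\<pi> i z \<in> S'" if "i \<in> {..<k}" for i
        using involutions_image[OF inv that] z by blast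
      have "k = card (\<Union>v\<in>S'. {i\<in>{..<k}. \<pi> i z = v})"
      proof -
        have "(\<Union>v\<in>S'. {i\<in>{..<k}. \<pi> i z = v}) = {..<k}" using im by auto
        then show ?thesis by simp
      qed
      also have "\<dots> = (\<Sum>v\<in>S'. card {i\<in>{..<k}. \<pi> i z = v})"
        using finS by (intro card_UN_disjoint) (auto simp: S'_def)
      also have "\<dots> = card {i\<in>{..<k}. \<pi> i z = z} + (\<Sum>v\<in>S'-{z}. card {i\<in>{..<k}. \<pi> i z = v})"
        using z finS by (subst sum.remove[of S' z]) (auto simp: S'_def)
      also have "(\<Sum>v\<in>S'-{z}. card {i\<in>{..<k}. \<pi> i z = v}) = (\<Sum>v\<in>S'-{z}. \<mu> z v)"
        using z by (intro sum.cong refl cnt) auto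
      finally show ?thesis by simp
    qed
    have "\<exists>\<pi>'. involutions S {..<k} \<pi>' \<and> (\<forall>u\<in>S. \<forall>v\<in>S. u \<noteq> v \<longrightarrow>
           card {i\<in>{..<k}. \<pi>' i u = v} = card {i\<in>{..<k}. \<pi> i u = v}
             + (if u = x then b v else if v = x then b u else 0))"
    proof (rule extend_colouring_to_star[where ?z0.0 = z0])
      show "finite S" "x \<in> S" by fact+
      show "involutions S {..<k} \<pi>" using inv by (auto simp: involutions_def S'_def)
      show "\<pi> i x = x" if "i \<in> {..<k}" for i using fixx that .
      show "b x = 0" by (simp add: b_def)
      have "(\<Sum>z\<in>S. b z) = (\<Sum>z\<in>S-{x}. \<mu> x z)"
        using x finS by (subst sum.remove[of S x]) (auto simp: b_def intro!: sum.cong)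
      then show "(\<Sum>z\<in>S. b z) \<le> card {..<k}" using dx by simp
      show "2 * b z \<le> card {i\<in>{..<k}. \<pi> i z = z} + of_bool (z = z0)" if z: "z \<in> S" "b z > 0" for z
      proof -
        have zx: "z \<noteq> x" "z \<in> S'" "b z = \<mu> x z" using z by (auto simp: b_def S'_def split: if_splits)
        have "(\<Sum>v\<in>S-{z}. \<mu> z v) = \<mu> z x + (\<Sum>v\<in>S-{z}-{x}. \<mu> z v)"
          using x zx finS by (intro sum.remove) auto
        also have "S-{z}-{x} = S'-{z}" by (auto simp: S'_def)
        finally have "(\<Sum>v\<in>S-{z}. \<mu> z v) = \<mu> x z + (\<Sum>v\<in>S'-{z}. \<mu> z v)" using sym[of z x] by simp
        moreover have "(\<Sum>v\<in>S-{z}. \<mu> z v) + \<mu> x z \<le> k + of_bool (z = z0)"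
          using nbr[of z] z zx by auto
        ultimately show ?thesis using missing[OF zx(2)] zx(3) by linarith
      qed
    qed auto
    then obtain \<pi>' where inv': "involutions S {..<k} \<pi>'"
      and cnt': "\<And>u v. u \<in> S \<Longrightarrow> v \<in> S \<Longrightarrow> u \<noteq> v \<Longrightarrow>
           card {i\<in>{..<k}. \<pi>' i u = v} = card {i\<in>{..<k}. \<pi> i u = v}
             + (if u = x then b v else if v = x then b u else 0)" by blast
    have none: "{i\<in>{..<k}. \<pi> i u = v} = {}" if uv: "u \<noteq> v" "u = x \<or> v = x" for u v
    proof -
      have "\<pi> i u \<noteq> v" if "i \<in> {..<k}" for i
      proof
        assume "\<pi> i u = v"
        moreover have "\<pi> i (\<pi> i u) = u" using inv that by (simp add: involutions_def)
        ultimately show False using uv fixx[OF that] by auto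
      qed
      then show ?thesis by blast
    qed
    have "card {i\<in>{..<k}. \<pi>' i u = v} = \<mu> u v" if uv: "u \<in> S" "v \<in> S" "u \<noteq> v" for u v
    proof (cases "u = x \<or> v = x")
      case True
      then show ?thesis using cnt'[OF uv] none[OF uv(3)] uv(3) sym[of u v] by (auto simp: b_def)
    next
      case False
      then show ?thesis using cnt'[OF uv] cnt[of u v] uv by (auto simp: S'_def)
    qed
    then show ?case using inv' unfolding colourable_def by blast
  qed
  then show ?thesis by blast
qed

lemma colourable_add:
  assumes "colourable V k \<mu>" "colourable V l \<nu>"
  shows "colourable V (k + l) (\<lambda>u v. \<mu> u v + \<nu> u v)"
proof -
  obtain \<pi> where \<pi>: "involutions V {..<k} \<pi>"
      "\<And>u v. u \<in> V \<Longrightarrow> v \<in> V \<Longrightarrow> u \<noteq> v \<Longrightarrow> card {i\<in>{..<k}. \<pi> i u = v} = \<mu> u v"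
    using assms(1) unfolding colourable_def by blast
  obtain \<rho> where \<rho>: "involutions V {..<l} \<rho>"
      "\<And>u v. u \<in> V \<Longrightarrow> v \<in> V \<Longrightarrow> u \<noteq> v \<Longrightarrow> card {i\<in>{..<l}. \<rho> i u = v} = \<nu> u v"
    using assms(2) unfolding colourable_def by blast
  define \<sigma> where "\<sigma> i = (if i < k then \<pi> i else \<rho> (i - k))" for i
  have inv: "involutions V {..<k+l} \<sigma>"
    using \<pi>(1) \<rho>(1) by (auto simp: involutions_def \<sigma>_def)
  have "card {i\<in>{..<k+l}. \<sigma> i u = v} = card {i\<in>{..<k}. \<pi> i u = v} + card {i\<in>{..<l}. \<rho> i u = v}"
    for u v
  proof -
    have "{i\<in>{..<k+l}. \<sigma> i u = v} = {i\<in>{..<k}. \<pi> i u = v} \<union> (\<lambda>i. i + k) ` {i\<in>{..<l}. \<rho> i u = v}"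
    proof (intro set_eqI iffI)
      fix i assume i: "i \<in> {i\<in>{..<k+l}. \<sigma> i u = v}"
      show "i \<in> {i\<in>{..<k}. \<pi> i u = v} \<union> (\<lambda>i. i + k) ` {i\<in>{..<l}. \<rho> i u = v}"
      proof (cases "i < k")
        case False
        then have "i = (i - k) + k" "i - k \<in> {i\<in>{..<l}. \<rho> i u = v}" using i by (auto simp: \<sigma>_def)
        then show ?thesis by blast
      qed (use i in \<open>auto simp: \<sigma>_def\<close>)
    qed (auto simp: \<sigma>_def)
    also have "card \<dots> = card {i\<in>{..<k}. \<pi> i u = v} + card ((\<lambda>i. i + k) ` {i\<in>{..<l}. \<rho> i u = v})"
      by (intro card_Un_disjoint) auto
    also have "card ((\<lambda>i. i + k) ` {i\<in>{..<l}. \<rho> i u = v}) = card {i\<in>{..<l}. \<rho> i u = v}"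
      by (intro card_image) (auto simp: inj_on_def)
    finally show ?thesis .
  qed
  then have "\<forall>u\<in>V. \<forall>v\<in>V. u \<noteq> v \<longrightarrow> card {i\<in>{..<k+l}. \<sigma> i u = v} = \<mu> u v + \<nu> u v"
    using \<pi>(2) \<rho>(2) by simp
  then show ?thesis using inv unfolding colourable_def by blast
qed

text \<open>
  The round-robin tournament: on the residues modulo the odd number \<open>N = n - 1\<close> together with one extra
  point, colour \<open>c\<close> joins \<open>a\<close> and \<open>b\<close> if \<open>a + b = c\<close>, and joins the extra point to the solution of
  \<open>2 * a = c\<close>.
\<close>

lemma colourable_complete:
  assumes "even n" "n > 0"
  shows "colourable {1..n} (n - 1) (\<lambda>_ _. 1)"
proof -
  define N where "N = n - 1"
  obtain h where n: "n = 2 * h" using \<open>even n\<close> by blast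
  have N: "N = 2 * h - 1" "N > 0" "n = Suc N" "2 * h = N + 1" using n assms(2) by (auto simp: N_def)
  \<comment> \<open>The number \<open>N\<close> represents the extra point, and multiplication by \<open>h\<close> is division by 2 modulo \<open>N\<close>.\<close>
  define \<sigma> where "\<sigma> c a = (c + (N - a)) mod N" for c a
  define \<rho> where "\<rho> c a = (if a = N then (c * h) mod N else if a < N then
      (if \<sigma> c a = a then N else \<sigma> c a) else a)" for c a
  have \<sigma>_lt: "\<sigma> c a < N" for c a using N by (simp add: \<sigma>_def)
  have \<sigma>_iff: "\<sigma> c a = b \<longleftrightarrow> c = (a + b) mod N" if "a < N" "b < N" "c < N" for a b c
  proof
    assume "\<sigma> c a = b"
    then have "(a + b) mod N = (a + (c + (N - a))) mod N" by (auto simp: \<sigma>_def mod_add_right_eq)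
    also have "a + (c + (N - a)) = c + N" using that by simp
    finally show "c = (a + b) mod N" using that by simp
  next
    assume "c = (a + b) mod N"
    then have "\<sigma> c a = (a + b + (N - a)) mod N" by (simp add: \<sigma>_def mod_add_left_eq)
    also have "a + b + (N - a) = b + N" using that by simp
    finally show "\<sigma> c a = b" using that by simp
  qed
  have half: "(c * h) mod N = a \<longleftrightarrow> c = (a + a) mod N" if "a < N" "c < N" for a c
  proof
    assume "(c * h) mod N = a"
    then have "(a + a) mod N = (c * h + c * h) mod N" by (auto simp: mod_add_eq)
    also have "c * h + c * h = c + c * N"
      using N(4) by (metis add_mult_distrib2 mult.commute mult_2 mult_2_right add.commute mult.right_neutral)
    finally show "c = (a + a) mod N" using that by simp
  next
    assume "c = (a + a) mod N"
    then have "(c * h) mod N = ((a + a) * h) mod N" by (simp add: mod_mult_left_eq)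
    also have "(a + a) * h = a + a * N"
      using N(4) by (metis add_mult_distrib2 mult.commute mult_2 mult.assoc add.commute mult.right_neutral)
    finally show "(c * h) mod N = a" using that by simp
  qed
  have inv: "\<rho> c (\<rho> c a) = a" if c: "c < N" for c a
  proof (cases "a < N")
    case True
    have "\<sigma> c (\<sigma> c a) = a"
      using \<sigma>_iff[OF True \<sigma>_lt[of c a] c] \<sigma>_iff[OF \<sigma>_lt[of c a] True c] by (metis add.commute)
    moreover have "(c * h) mod N = a" if "\<sigma> c a = a"
      using that \<sigma>_iff[OF True True c] half[OF True c] by simp
    ultimately show ?thesis using True \<sigma>_lt[of c a] by (auto simp: \<rho>_def)
  next
    case False
    show ?thesis
    proof (cases "a = N")
      case True
      define b where "b = (c * h) mod N"
      have b: "b < N" using N by (simp add: b_def)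
      have "\<sigma> c b = b" using half[OF b c] \<sigma>_iff[OF b b c] b_def by simp
      then show ?thesis using True b by (simp add: \<rho>_def b_def[symmetric])
    qed (use False in \<open>auto simp: \<rho>_def\<close>)
  qed
  have bound: "\<rho> c a < n" if "a < n" for c a
  proof -
    have "(c * h) mod N < N" using N(2) by simp
    then have "(c * h) mod N < n" "\<sigma> c a < n" "N < n" using \<sigma>_lt[of c a] N(3) by linarith+
    then show ?thesis using that unfolding \<rho>_def by (simp split: if_split)
  qed
  have single: "\<exists>d<N. \<forall>c<N. \<rho> c a = b \<longleftrightarrow> c = d" if ab: "a < n" "b < n" "a \<noteq> b" for a b
  proof -
    consider "a < N" "b < N" | "a < N" "b = N" | "a = N" "b < N" using ab N by linarith
    then show ?thesis
    proof cases
      case 1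
      have "\<rho> c a = b \<longleftrightarrow> \<sigma> c a = b" for c using 1 ab(3) by (auto simp: \<rho>_def)
      then show ?thesis using \<sigma>_iff[OF 1] mod_less_divisor[OF N(2)] by blast
    next
      case 2
      have "\<rho> c a = b \<longleftrightarrow> \<sigma> c a = a" for c using 2 \<sigma>_lt[of c a] by (auto simp: \<rho>_def)
      then show ?thesis using \<sigma>_iff[OF 2(1) 2(1)] mod_less_divisor[OF N(2)] by blast
    next
      case 3
      have "\<rho> c a = b \<longleftrightarrow> (c * h) mod N = b" for c using 3 by (auto simp: \<rho>_def)
      then show ?thesis using half[OF 3(2)] mod_less_divisor[OF N(2)] by blast
    qed
  qed
  define \<pi> where "\<pi> c v = (if v \<in> {1..n} then Suc (\<rho> c (v - 1)) else v)" for c v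
  have "involutions {1..n} {..<n - 1} \<pi>"
    unfolding involutions_def
  proof (intro ballI allI conjI impI)
    fix c v assume c: "c \<in> {..<n - 1}"
    show "\<pi> c (\<pi> c v) = v"
    proof (cases "v \<in> {1..n}")
      case True
      then have "\<rho> c (v - 1) < n" by (intro bound) auto
      then show ?thesis using True inv[of c "v - 1"] c by (auto simp: \<pi>_def N_def)
    next
      case False
      then have "\<pi> c v = v" unfolding \<pi>_def by (simp only: if_False)
      then show ?thesis by simp
    qed
    show "\<pi> c v = v" if "v \<notin> {1..n}" using that unfolding \<pi>_def by (simp only: if_False)
  qed
  moreover have "card {c\<in>{..<n - 1}. \<pi> c u = v} = 1" if uv: "u \<in> {1..n}" "v \<in> {1..n}" "u \<noteq> v" for u v
  proof -
    have "u - 1 < n" "v - 1 < n" "u - 1 \<noteq> v - 1" using uv by auto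
    from single[OF this] obtain d where d: "d < N" "\<And>c. c < N \<Longrightarrow> \<rho> c (u - 1) = v - 1 \<longleftrightarrow> c = d" by blast
    have "\<pi> c u = v \<longleftrightarrow> \<rho> c (u - 1) = v - 1" for c using uv by (auto simp: \<pi>_def)
    then have "{c\<in>{..<n - 1}. \<pi> c u = v} = {d}" using d by (auto simp: N_def)
    then show ?thesis by simp
  qed
  ultimately show ?thesis unfolding colourable_def by blast
qed

lemma colourable_add_complete:
  assumes "colourable {1..n} k \<mu>" "even n" "n > 0"
  shows "colourable {1..n} (T * (n - 1) + k) (\<lambda>u v. T + \<mu> u v)"
proof (induction T)
  case (Suc T)
  show ?case using colourable_add[OF colourable_complete[OF assms(2,3)] Suc.IH] by (simp add: add.assoc)
qed (use assms in simp)

section \<open>Criteria for the chromatic index to equal the maximum degree\<close>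

text \<open>
  The colours that join the ends of \<open>e\<close> are as many as there are copies of \<open>e\<close>; the copies receive
  them in increasing order.
\<close>

lemma proper_edge_colouring_of_colourable:
  assumes fin: "finite V" and M: "set_mset M \<subseteq> nsets V 2"
    and col: "colourable V k (\<lambda>u v. count M {u, v})"
  shows "\<exists>c. proper_edge_colouring M k c"
proof -
  obtain \<pi> where inv: "involutions V {..<k} \<pi>"
    and cnt: "\<And>u v. u \<in> V \<Longrightarrow> v \<in> V \<Longrightarrow> u \<noteq> v \<Longrightarrow> card {i\<in>{..<k}. \<pi> i u = v} = count M {u, v}"
    using col unfolding colourable_def by blast
  define I where "I e = {i\<in>{..<k}. \<exists>u. \<pi> i u \<noteq> u \<and> e = {u, \<pi> i u}}" for e
  have finI: "finite (I e)" for e by (simp add: I_def)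
  have cardI: "card (I e) = count M e" if e: "e \<in># M" for e
  proof -
    obtain u v where uv: "e = {u, v}" "u \<in> V" "v \<in> V" "u \<noteq> v"
      using e M nsets2_E[of e V] by (metis subsetD)
    have "I e = {i\<in>{..<k}. \<pi> i u = v}"
    proof (intro set_eqI iffI)
      fix i assume i: "i \<in> I e"
      then obtain w where w: "\<pi> i w \<noteq> w" "{u, v} = {w, \<pi> i w}" "i < k" by (auto simp: I_def uv)
      have "\<pi> i (\<pi> i w) = w" using inv w(3) by (simp add: involutions_def)
      then have "\<pi> i u = v" using w(2) by (metis doubleton_eq_iff)
      then show "i \<in> {i\<in>{..<k}. \<pi> i u = v}" using w(3) by simp
    next
      fix i assume "i \<in> {i\<in>{..<k}. \<pi> i u = v}"
      then have "i < k" "\<pi> i u \<noteq> u \<and> e = {u, \<pi> i u}" using uv(1,4) by auto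
      then show "i \<in> I e" unfolding I_def by blast
    qed
    then show ?thesis using cnt[OF uv(2-4)] uv(1) by simp
  qed
  define c where "c x = sorted_list_of_set (I (fst x)) ! snd x" for x
  have mem: "c x \<in> I (fst x)" if x: "x \<in> mg_edges M" for x
  proof -
    have lt: "snd x < count M (fst x)" using x by (auto simp: mg_edges_def)
    then have "fst x \<in># M" by (metis count_eq_zero_iff less_nat_zero_code)
    then have "snd x < length (sorted_list_of_set (I (fst x)))" using cardI lt by simp
    then show ?thesis unfolding c_def using finI by (metis nth_mem set_sorted_list_of_set)
  qed
  have "c x \<noteq> c y"
    if x: "x \<in> mg_edges M" and y: "y \<in> mg_edges M" and ne: "x \<noteq> y" and meet: "fst x \<inter> fst y \<noteq> {}" for x y
  proof
    assume eq: "c x = c y"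
    obtain u where u: "fst x = {u, \<pi> (c x) u}" using mem[OF x] by (auto simp: I_def)
    obtain w where w: "fst y = {w, \<pi> (c x) w}" using mem[OF y] eq by (auto simp: I_def)
    have "c x < k" using mem[OF x] by (auto simp: I_def)
    then have "\<And>v. \<pi> (c x) (\<pi> (c x) v) = v" using inv by (simp add: involutions_def)
    then have same: "fst x = fst y" using meet u w by auto metis+
    have lt: "snd x < count M (fst x)" "snd y < count M (fst x)" using x y same by (auto simp: mg_edges_def)
    then have "fst x \<in># M" by (metis count_eq_zero_iff less_nat_zero_code)
    then have "snd x < length (sorted_list_of_set (I (fst x)))" "snd y < length (sorted_list_of_set (I (fst x)))"
      using cardI lt by simp_all
    then have "snd x = snd y"
      using eq same unfolding c_def by (metis distinct_sorted_list_of_set nth_eq_iff_index_eq)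
    then show False using ne same by (simp add: prod_eq_iff)
  qed
  moreover have "c x < k" if "x \<in> mg_edges M" for x using mem[OF that] by (auto simp: I_def)
  ultimately show ?thesis unfolding proper_edge_colouring_def by blast
qed

lemma mg_degree_le_colours:
  assumes "proper_edge_colouring M k c"
  shows "mg_degree M v \<le> k"
proof -
  let ?E = "Sigma {e \<in> set_mset M. v \<in> e} (\<lambda>e. {..<count M e})"
  have sub: "?E \<subseteq> mg_edges M" by (auto simp: mg_edges_def)
  have "card ?E = (\<Sum>e\<in>{e \<in> set_mset M. v \<in> e}. count M e)" by (subst card_SigmaI) auto
  also have "\<dots> = mg_degree M v"
    by (simp add: mg_degree_def size_multiset_overloaded_eq)
  finally have "mg_degree M v = card ?E" ..
  also have "\<dots> = card (c ` ?E)"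
  proof (rule card_image[symmetric], rule inj_onI)
    fix x y assume "x \<in> ?E" "y \<in> ?E" "c x = c y"
    moreover from this have "fst x \<inter> fst y \<noteq> {}" by auto
    ultimately show "x = y" using assms subsetD[OF sub] unfolding proper_edge_colouring_def by metis
  qed
  also have "\<dots> \<le> card {..<k}"
    using assms subsetD[OF sub] unfolding proper_edge_colouring_def by (intro card_mono) blast+
  finally show ?thesis by simp
qed

lemma chromatic_index_eq_max_degree:
  assumes fin: "finite V" "V \<noteq> {}" and M: "set_mset M \<subseteq> nsets V 2"
    and col: "colourable V (max_degree V M) (\<lambda>u v. count M {u, v})"
  shows "chromatic_index M = max_degree V M"
proof -
  have ex: "\<exists>c. proper_edge_colouring M (max_degree V M) c"
    by (rule proper_edge_colouring_of_colourable[OF fin(1) M col])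
  have "\<exists>c. proper_edge_colouring M (chromatic_index M) c"
    unfolding chromatic_index_def by (rule LeastI[of "\<lambda>k. \<exists>c. proper_edge_colouring M k c", OF ex])
  then obtain c where "proper_edge_colouring M (chromatic_index M) c" ..
  from mg_degree_le_colours[OF this] have "\<forall>v\<in>V. mg_degree M v \<le> chromatic_index M" by blast
  then have "max_degree V M \<le> chromatic_index M" unfolding max_degree_def using fin by simp
  moreover have "chromatic_index M \<le> max_degree V M"
    unfolding chromatic_index_def using ex by (rule Least_le)
  ultimately show ?thesis by simp
qed

lemma mg_degree_eq_sum:
  assumes "finite V" "v \<in> V" "set_mset M \<subseteq> nsets V 2"
  shows "mg_degree M v = (\<Sum>u\<in>V-{v}. count M {v, u})"
  using assms(3)
proof (induction M)
  case (add e M)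
  obtain a b where e: "e = {a, b}" "a \<in> V" "b \<in> V" "a \<noteq> b"
    using add.prems nsets2_E[of e V] by (metis insert_subset set_mset_add_mset_insert)
  have "(\<Sum>u\<in>V-{v}. of_bool ({v, u} = e)) = (of_bool (v \<in> e) :: nat)"
  proof (cases "v \<in> e")
    case True
    then obtain w where w: "e = {v, w}" "w \<in> V - {v}" using e by auto
    have "(\<Sum>u\<in>V-{v}. of_bool ({v, u} = e)) = (\<Sum>u\<in>V-{v}. of_bool (u = w) :: nat)"
      using w by (intro sum.cong) (auto simp: doubleton_eq_iff)
    then show ?thesis using True w assms(1) by (simp add: of_bool_def)
  next
    case False
    then have "{v, u} \<noteq> e" for u by auto
    then show ?thesis using False by simp
  qed
  moreover have "(\<Sum>u\<in>V-{v}. count (add_mset e M) {v, u})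
      = (\<Sum>u\<in>V-{v}. of_bool ({v, u} = e)) + (\<Sum>u\<in>V-{v}. count M {v, u})"
    unfolding sum.distrib[symmetric] by (intro sum.cong) auto
  ultimately show ?case using add by (auto simp: mg_degree_def)
qed (simp add: mg_degree_def)

lemma sum_mg_degree:
  assumes "finite V" "set_mset M \<subseteq> nsets V 2"
  shows "(\<Sum>v\<in>V. mg_degree M v) = 2 * size M"
  using assms(2)
proof (induction M)
  case (add e M)
  have e: "e \<subseteq> V" "card e = 2" using add.prems by (auto simp: nsets_def)
  have "(\<Sum>v\<in>V. mg_degree (add_mset e M) v) = (\<Sum>v\<in>V. of_bool (v \<in> e) + mg_degree M v)"
    by (intro sum.cong) (auto simp: mg_degree_def)
  also have "\<dots> = (\<Sum>v\<in>V. of_bool (v \<in> e)) + 2 * size M"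
    using add by (simp add: sum.distrib)
  also have "(\<Sum>v\<in>V. of_bool (v \<in> e)) = card e"
    using e assms(1) by (simp add: of_bool_def sum.If_cases Int_absorb1 Int_commute)
  finally show ?case using e by simp
qed (simp add: mg_degree_def)

lemma mg_degree_le_max_degree: "finite V \<Longrightarrow> v \<in> V \<Longrightarrow> mg_degree M v \<le> max_degree V M"
  by (simp add: max_degree_def)

text \<open>
  The induced subgraph on \<open>S\<close> has degree sum below \<open>2 * card S\<close>, hence a vertex of degree at most one.
  Its only neighbour \<open>z0\<close> may have degree \<open>\<Delta>\<close>, which is where the exceptional slack of the
  peeling lemma is used.
\<close>

lemma class_one_if_sparse:
  assumes fin: "finite V" "V \<noteq> {}" and M: "set_mset M \<subseteq> nsets V 2"
    and sparse: "\<And>S. S \<subseteq> V \<Longrightarrow> S \<noteq> {} \<Longrightarrow> size {#e \<in># M. e \<subseteq> S#} < card S"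
  shows "chromatic_index M = max_degree V M"
proof (rule chromatic_index_eq_max_degree[OF fin M], rule colourable_by_peeling[OF fin(1)])
  show "count M {u, v} = count M {v, u}" for u v by (simp add: insert_commute)
next
  fix S assume S: "S \<subseteq> V" "S \<noteq> {}"
  have finS: "finite S" using S fin finite_subset by blast
  define N where "N = {#e \<in># M. e \<subseteq> S#}"
  have N: "set_mset N \<subseteq> nsets S 2" using M by (auto simp: N_def nsets_def)
  have cnt: "count N {u, v} = count M {u, v}" if "u \<in> S" "v \<in> S" for u v using that by (simp add: N_def)
  have deg: "mg_degree N v = (\<Sum>u\<in>S-{v}. count M {v, u})" if "v \<in> S" for v
    using mg_degree_eq_sum[OF finS that N] cnt that by (auto intro!: sum.cong)
  have le: "(\<Sum>u\<in>S-{v}. count M {v, u}) \<le> max_degree V M" if "v \<in> S" for v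
  proof -
    have "(\<Sum>u\<in>S-{v}. count M {v, u}) \<le> (\<Sum>u\<in>V-{v}. count M {v, u})"
      using S fin by (intro sum_mono2) auto
    also have "\<dots> = mg_degree M v" using mg_degree_eq_sum[OF fin(1) _ M] that S by auto
    finally show ?thesis using mg_degree_le_max_degree[OF fin(1), of v M] that S by auto
  qed
  have "\<exists>x\<in>S. mg_degree N x < 2"
  proof (rule ccontr)
    assume "\<not> ?thesis"
    then have "(\<Sum>v\<in>S. 2) \<le> (\<Sum>v\<in>S. mg_degree N v)" by (intro sum_mono) auto
    then show False using sum_mg_degree[OF finS N] sparse[OF S] by (simp add: N_def)
  qed
  then obtain x where x: "x \<in> S" "(\<Sum>u\<in>S-{x}. count M {x, u}) \<le> 1" using deg by fastforce
  have one: "count M {x, z} = 1 \<and> (\<forall>y\<in>S-{x}-{z}. count M {x, y} = 0)"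
    if z: "z \<in> S - {x}" "count M {x, z} > 0" for z
  proof -
    have "(\<Sum>u\<in>S-{x}. count M {x, u}) = count M {x, z} + (\<Sum>u\<in>S-{x}-{z}. count M {x, u})"
      using z finS by (intro sum.remove) auto
    then have "count M {x, z} = 1" "(\<Sum>u\<in>S-{x}-{z}. count M {x, u}) = 0" using z x(2) by linarith+
    then show ?thesis using finS by auto
  qed
  obtain z0 where z0: "\<And>z. z \<in> S - {x} \<Longrightarrow> count M {x, z} > 0 \<Longrightarrow> z = z0"
  proof (cases "\<exists>z\<in>S-{x}. count M {x, z} > 0")
    case True
    then obtain z where z: "z \<in> S - {x}" "count M {x, z} > 0" by blast
    have "y = z" if "y \<in> S - {x}" "count M {x, y} > 0" for y
      using one[OF z] that by (metis Diff_iff gr_implies_not_zero singletonD)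
    then show ?thesis using that by blast
  qed (use that in blast)
  show "\<exists>x\<in>S. \<exists>z0. (\<Sum>z\<in>S-{x}. count M {x, z}) \<le> max_degree V M \<and>
       (\<forall>z\<in>S-{x}. count M {x, z} > 0 \<longrightarrow>
         (\<Sum>v\<in>S-{z}. count M {z, v}) + count M {x, z} \<le> max_degree V M + of_bool (z = z0))"
    using x(1) le one z0 by (intro bexI[of _ x] exI[of _ z0]) (auto simp del: One_nat_def)
qed

text \<open>
  After removal of \<open>T\<close> copies of the complete graph the multiplicities are at most \<open>s\<close>, and all degrees
  have dropped by the number of colours spent. In any induced subgraph, a vertex whose degree in
  \<open>M\<close> exceeds \<open>\<Delta> - s\<close> can be peeled off, since none of its neighbours has such a degree; if there is
  none, any vertex will do.
\<close>

lemma class_one_if_top_isolated: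
  fixes n :: nat and M :: "nat mgraph"
  assumes n: "even n" "n > 0" and M: "set_mset M \<subseteq> nsets {1..n} 2"
    and lower: "\<And>e. e \<in> nsets {1..n} 2 \<Longrightarrow> T \<le> count M e"
    and upper: "\<And>e. e \<in> nsets {1..n} 2 \<Longrightarrow> count M e \<le> T + s"
    and top: "\<And>u v. u \<in> {1..n} \<Longrightarrow> v \<in> {1..n} \<Longrightarrow> u \<noteq> v \<Longrightarrow> count M {u, v} > T \<Longrightarrow>
        mg_degree M u + s > max_degree {1..n} M \<Longrightarrow> mg_degree M v + s \<le> max_degree {1..n} M"
  shows "chromatic_index M = max_degree {1..n} M"
proof -
  let ?V = "{1..n}"
  define \<Delta> where "\<Delta> = max_degree ?V M"
  define k where "k = \<Delta> - T * (n - 1)"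
  define \<mu> where "\<mu> u v = count M {u, v} - T" for u v
  have pair: "{u, v} \<in> nsets ?V 2" if "u \<in> ?V" "v \<in> ?V" "u \<noteq> v" for u v
    using that by (simp add: nsets_def)
  have cnt: "count M {u, v} = T + \<mu> u v" if "u \<in> ?V" "v \<in> ?V" "u \<noteq> v" for u v
    using lower[OF pair[OF that]] by (simp add: \<mu>_def)
  have \<mu>s: "\<mu> u v \<le> s" if "u \<in> ?V" "v \<in> ?V" "u \<noteq> v" for u v
    using upper[OF pair[OF that]] by (simp add: \<mu>_def)
  have deg: "mg_degree M v = T * (n - 1) + (\<Sum>u\<in>?V-{v}. \<mu> v u)" if v: "v \<in> ?V" for v
  proof -
    have "mg_degree M v = (\<Sum>u\<in>?V-{v}. T + \<mu> v u)"
      using mg_degree_eq_sum[OF _ v M] cnt v by simp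
    then show ?thesis using v by (simp add: sum.distrib)
  qed
  have \<Delta>: "mg_degree M v \<le> \<Delta>" if "v \<in> ?V" for v
    unfolding \<Delta>_def using that by (intro mg_degree_le_max_degree) auto
  have "T * (n - 1) \<le> \<Delta>" using deg[of 1] \<Delta>[of 1] n by auto
  then have \<Delta>k: "T * (n - 1) + k = \<Delta>" by (simp add: k_def)
  have sum_le: "(\<Sum>u\<in>S-{v}. \<mu> v u) \<le> (\<Sum>u\<in>?V-{v}. \<mu> v u)" if "S \<subseteq> ?V" for S v
    using that by (intro sum_mono2) auto
  have "colourable ?V k \<mu>"
  proof (rule colourable_by_peeling)
    show "\<mu> u v = \<mu> v u" for u v by (simp add: \<mu>_def insert_commute)
    fix S assume S: "S \<subseteq> ?V" "S \<noteq> {}"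
    obtain x where x: "x \<in> S"
      "mg_degree M x + s > \<Delta> \<or> (\<forall>z\<in>S. mg_degree M z + s \<le> \<Delta>)"
      using S(2) by (metis all_not_in_conv leI)
    have "(\<Sum>z\<in>S-{x}. \<mu> x z) \<le> k"
      using sum_le[OF S(1), of x] deg[of x] \<Delta>[of x] \<Delta>k x(1) S(1) by auto
    moreover have "(\<Sum>v\<in>S-{z}. \<mu> z v) + \<mu> x z \<le> k" if z: "z \<in> S - {x}" "\<mu> x z > 0" for z
    proof -
      have xz: "x \<in> ?V" "z \<in> ?V" "x \<noteq> z" "z \<in> S" using x(1) z S(1) by auto
      have "count M {x, z} > T" using z(2) by (simp add: \<mu>_def)
      then have "mg_degree M z + s \<le> \<Delta>"
        using x(2) top[OF xz(1-3)] xz(4) unfolding \<Delta>_def by blast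
      then show ?thesis
        using sum_le[OF S(1), of z] deg[OF xz(2)] \<mu>s[OF xz(1-3)] \<Delta>k by linarith
    qed
    ultimately show "\<exists>x\<in>S. \<exists>z0. (\<Sum>z\<in>S-{x}. \<mu> x z) \<le> k \<and>
       (\<forall>z\<in>S-{x}. \<mu> x z > 0 \<longrightarrow> (\<Sum>v\<in>S-{z}. \<mu> z v) + \<mu> x z \<le> k + of_bool (z = z0))"
      using x(1) by (meson trans_le_add1)
  qed simp
  then have "colourable ?V (T * (n - 1) + k) (\<lambda>u v. T + \<mu> u v)"
    using n by (rule colourable_add_complete)
  then have "colourable ?V \<Delta> (\<lambda>u v. count M {u, v})"
    unfolding \<Delta>k by (rule colourable_cong) (simp add: cnt)
  then show ?thesis unfolding \<Delta>_def using n M by (intro chromatic_index_eq_max_degree) auto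
qed

section \<open>Uniform random multisets of independent draws\<close>

text \<open>
  The mean of \<open>\<phi>\<close> over the multiset of \<open>m\<close> independent uniform draws from the finite set \<open>E\<close>. The
  recursion over the draws turns the basic identities for it into inductions on \<open>m\<close>.
\<close>

primrec draw_mean :: "'b set \<Rightarrow> nat \<Rightarrow> ('b multiset \<Rightarrow> real) \<Rightarrow> real" where
  "draw_mean E 0 \<phi> = \<phi> {#}"
| "draw_mean E (Suc m) \<phi> = (\<Sum>x\<in>E. draw_mean E m (\<lambda>M. \<phi> (add_mset x M))) / card E"

lemma draw_mean_mono:
  assumes "\<And>M. set_mset M \<subseteq> E \<Longrightarrow> size M = m \<Longrightarrow> \<phi> M \<le> \<psi> M"
  shows "draw_mean E m \<phi> \<le> draw_mean E m \<psi>"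
  using assms
proof (induction m arbitrary: \<phi> \<psi>)
  case (Suc m)
  have "(\<Sum>x\<in>E. draw_mean E m (\<lambda>M. \<phi> (add_mset x M))) \<le> (\<Sum>x\<in>E. draw_mean E m (\<lambda>M. \<psi> (add_mset x M)))"
    by (intro sum_mono Suc.IH Suc.prems) auto
  then show ?case by (simp add: divide_right_mono)
qed simp

lemma draw_mean_cong:
  assumes "\<And>M. set_mset M \<subseteq> E \<Longrightarrow> size M = m \<Longrightarrow> \<phi> M = \<psi> M"
  shows "draw_mean E m \<phi> = draw_mean E m \<psi>"
  using draw_mean_mono[of E m \<phi> \<psi>] draw_mean_mono[of E m \<psi> \<phi>] assms by fastforce

lemma draw_mean_add: "draw_mean E m (\<lambda>M. \<phi> M + \<psi> M) = draw_mean E m \<phi> + draw_mean E m \<psi>"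
  by (induction m arbitrary: \<phi> \<psi>) (simp_all add: sum.distrib add_divide_distrib)

lemma draw_mean_cmult: "draw_mean E m (\<lambda>M. c * \<phi> M) = c * draw_mean E m \<phi>"
  by (induction m arbitrary: \<phi>) (simp_all add: sum_distrib_left[symmetric])

lemma draw_mean_zero: "draw_mean E m (\<lambda>M. 0) = 0"
  using draw_mean_cmult[of E m 0 "\<lambda>_. 0"] by simp

lemma draw_mean_sum: "finite A \<Longrightarrow> draw_mean E m (\<lambda>M. \<Sum>a\<in>A. \<phi> a M) = (\<Sum>a\<in>A. draw_mean E m (\<phi> a))"
  by (induction A rule: finite_induct) (simp_all add: draw_mean_zero draw_mean_add)

lemma draw_mean_const:
  assumes "finite E" "E \<noteq> {}"
  shows "draw_mean E m (\<lambda>M. c) = c"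
  using assms by (induction m) simp_all

definition draw_prob :: "'b set \<Rightarrow> nat \<Rightarrow> ('b multiset \<Rightarrow> bool) \<Rightarrow> real" where
  "draw_prob E m Q = draw_mean E m (\<lambda>M. of_bool (Q M))"

lemma draw_prob_mono:
  assumes "\<And>M. set_mset M \<subseteq> E \<Longrightarrow> size M = m \<Longrightarrow> Q M \<Longrightarrow> R M"
  shows "draw_prob E m Q \<le> draw_prob E m R"
  unfolding draw_prob_def using assms by (intro draw_mean_mono) auto

lemma draw_prob_cong:
  assumes "\<And>M. set_mset M \<subseteq> E \<Longrightarrow> size M = m \<Longrightarrow> Q M \<longleftrightarrow> R M"
  shows "draw_prob E m Q = draw_prob E m R"
  unfolding draw_prob_def using assms by (intro draw_mean_cong) auto

lemma draw_prob_nonneg: "draw_prob E m Q \<ge> 0"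
  unfolding draw_prob_def using draw_mean_mono[of E m "\<lambda>_. 0" "\<lambda>M. of_bool (Q M)"] by (simp add: draw_mean_zero)

lemma draw_prob_le_1: "finite E \<Longrightarrow> E \<noteq> {} \<Longrightarrow> draw_prob E m Q \<le> 1"
  unfolding draw_prob_def using draw_mean_mono[of E m "\<lambda>M. of_bool (Q M)" "\<lambda>_. 1"] by (simp add: draw_mean_const)

lemma draw_prob_disj_le: "draw_prob E m (\<lambda>M. Q M \<or> R M) \<le> draw_prob E m Q + draw_prob E m R"
  unfolding draw_prob_def draw_mean_add[symmetric] by (intro draw_mean_mono) auto

lemma draw_prob_not:
  assumes "finite E" "E \<noteq> {}"
  shows "draw_prob E m (\<lambda>M. \<not> Q M) = 1 - draw_prob E m Q"
proof -
  have "draw_prob E m (\<lambda>M. \<not> Q M) + draw_prob E m Q = draw_mean E m (\<lambda>M. 1)"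
    unfolding draw_prob_def draw_mean_add[symmetric] by (intro draw_mean_cong) auto
  then show ?thesis using draw_mean_const[OF assms, of m 1] by simp
qed

lemma draw_prob_ex_le:
  assumes "finite A"
  shows "draw_prob E m (\<lambda>M. \<exists>a\<in>A. Q a M) \<le> (\<Sum>a\<in>A. draw_prob E m (Q a))"
  unfolding draw_prob_def draw_mean_sum[OF assms, symmetric]
proof (rule draw_mean_mono)
  fix M
  show "of_bool (\<exists>a\<in>A. Q a M) \<le> (\<Sum>a\<in>A. of_bool (Q a M) :: real)"
  proof (cases "\<exists>a\<in>A. Q a M")
    case True
    then obtain a where a: "a \<in> A" "Q a M" by blast
    have "of_bool (Q a M) \<le> (\<Sum>a\<in>A. of_bool (Q a M) :: real)"
      using a assms by (intro member_le_sum) auto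
    then show ?thesis using a by auto
  qed (simp add: sum_nonneg)
qed

lemma expectation_random_multigraph:
  assumes n: "n \<ge> 2"
  shows "measure_pmf.expectation (random_multigraph n m) \<phi> = draw_mean (nsets {1..n} 2) m \<phi>"
proof -
  let ?E = "nsets {1..n} 2"
  have fin: "finite ?E" by (intro finite_imp_finite_nsets) simp
  have ne: "?E \<noteq> {}"
  proof -
    have "{1, 2} \<in> ?E" using n by (simp add: nsets_def)
    then show ?thesis by blast
  qed
  have finset: "finite (set_pmf (replicate_pmf m (pmf_of_set ?E)))" for m
    using fin ne by (induction m) (auto simp: set_pmf_of_set)
  have "measure_pmf.expectation (replicate_pmf m (pmf_of_set ?E)) (\<lambda>xs. \<phi> (mset xs)) = draw_mean ?E m \<phi>"
  proof (induction m arbitrary: \<phi>)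
    case (Suc m)
    have "measure_pmf.expectation (replicate_pmf (Suc m) (pmf_of_set ?E)) (\<lambda>xs. \<phi> (mset xs))
        = measure_pmf.expectation (pmf_of_set ?E \<bind> (\<lambda>x. map_pmf ((#) x) (replicate_pmf m (pmf_of_set ?E)))) (\<lambda>xs. \<phi> (mset xs))"
      by (simp add: map_pmf_def)
    also have "\<dots> = (\<Sum>x\<in>?E. measure_pmf.expectation (map_pmf ((#) x) (replicate_pmf m (pmf_of_set ?E))) (\<lambda>xs. \<phi> (mset xs)) /\<^sub>R real (card ?E))"
      using fin ne finset by (intro pmf_expectation_bind_pmf_of_set) auto
    also have "\<dots> = (\<Sum>x\<in>?E. draw_mean ?E m (\<lambda>M. \<phi> (add_mset x M)) / real (card ?E))"
      using Suc.IH[of "\<lambda>M. \<phi> (add_mset _ M)"] by (intro sum.cong) (simp_all add: divide_inverse mult.commute)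
    finally show ?case by (simp add: sum_divide_distrib)
  qed simp
  then show ?thesis by (simp add: random_multigraph_def)
qed

lemma prob_random_multigraph:
  assumes "n \<ge> 2"
  shows "measure_pmf.prob (random_multigraph n m) {M. Q M} = draw_prob (nsets {1..n} 2) m Q"
proof -
  have "measure_pmf.prob (random_multigraph n m) {M. Q M} =
        measure_pmf.expectation (random_multigraph n m) (indicator {M. Q M})" by simp
  also have "indicator {M. Q M} = (\<lambda>M. of_bool (Q M) :: real)" by (auto simp: indicator_def)
  finally show ?thesis using expectation_random_multigraph[OF assms] by (simp add: draw_prob_def)
qed

text \<open>
  Exchangeability: summing over the draws that satisfy \<open>P\<close>, each of the draws may be taken to be the
  first one. This is the analogue of the Mecke formula for Poisson processes.
\<close>

lemma mecke:
  assumes fin: "finite E" "E \<noteq> {}"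
  shows "draw_mean E (Suc m) (\<lambda>M. real (size (filter_mset P M)) * \<phi> M)
    = real (Suc m) * ((\<Sum>x\<in>{x\<in>E. P x}. draw_mean E m (\<lambda>M. \<phi> (add_mset x M))) / card E)"
proof (induction m arbitrary: \<phi>)
  case 0
  have "(\<Sum>x\<in>E. real (size (filter_mset P {#x#})) * \<phi> {#x#}) = (\<Sum>x\<in>E. if P x then \<phi> {#x#} else 0)"
    by (intro sum.cong) simp_all
  also have "\<dots> = (\<Sum>x\<in>{x\<in>E. P x}. \<phi> {#x#})"
    using fin by (intro sum.inter_filter[symmetric])
  finally have "(\<Sum>x\<in>E. real (size (filter_mset P {#x#})) * \<phi> {#x#}) = (\<Sum>x\<in>{x\<in>E. P x}. \<phi> {#x#})" .
  then show ?case by simp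
next
  case (Suc m)
  have alg: "a / c + (real (Suc m) * a) / c = real (Suc (Suc m)) * (a / c)" for a c :: real
    by (simp add: add_divide_distrib[symmetric] algebra_simps)
  have "draw_mean E (Suc (Suc m)) (\<lambda>M. real (size (filter_mset P M)) * \<phi> M)
      = (\<Sum>x\<in>E. draw_mean E (Suc m) (\<lambda>M. of_bool (P x) * \<phi> (add_mset x M)
            + real (size (filter_mset P M)) * \<phi> (add_mset x M))) / card E"
    unfolding draw_mean.simps(2)[of E "Suc m"]
    by (intro arg_cong2[where f = "(/)"] sum.cong draw_mean_cong refl) (auto simp: algebra_simps)
  also have "\<dots> = (\<Sum>x\<in>E. of_bool (P x) * draw_mean E (Suc m) (\<lambda>M. \<phi> (add_mset x M))) / card E
        + (\<Sum>x\<in>E. draw_mean E (Suc m) (\<lambda>M. real (size (filter_mset P M)) * \<phi> (add_mset x M))) / card E"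
    unfolding draw_mean_add draw_mean_cmult sum.distrib add_divide_distrib ..
  also have "(\<Sum>x\<in>E. of_bool (P x) * draw_mean E (Suc m) (\<lambda>M. \<phi> (add_mset x M)))
      = (\<Sum>x\<in>{x\<in>E. P x}. draw_mean E (Suc m) (\<lambda>M. \<phi> (add_mset x M)))"
    unfolding sum.inter_filter[OF fin(1)] by (intro sum.cong) auto
  also have "(\<Sum>x\<in>E. draw_mean E (Suc m) (\<lambda>M. real (size (filter_mset P M)) * \<phi> (add_mset x M)))
      = (\<Sum>x\<in>E. \<Sum>y\<in>{y\<in>E. P y}. real (Suc m) / card E * draw_mean E m (\<lambda>M. \<phi> (add_mset x (add_mset y M))))"
    by (intro sum.cong refl, subst Suc.IH) (simp add: sum_distrib_left sum_divide_distrib)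
  also have "\<dots> = (\<Sum>y\<in>{y\<in>E. P y}. \<Sum>x\<in>E. real (Suc m) / card E * draw_mean E m (\<lambda>M. \<phi> (add_mset y (add_mset x M))))"
    by (subst sum.swap) (simp add: add_mset_commute)
  also have "\<dots> = (\<Sum>y\<in>{y\<in>E. P y}. real (Suc m) * draw_mean E (Suc m) (\<lambda>M. \<phi> (add_mset y M)))"
    by (intro sum.cong refl) (simp add: sum_distrib_left sum_divide_distrib)
  also have "\<dots> = real (Suc m) * (\<Sum>y\<in>{y\<in>E. P y}. draw_mean E (Suc m) (\<lambda>M. \<phi> (add_mset y M)))"
    by (simp only: sum_distrib_left)
  finally show ?case unfolding alg .
qed

text \<open>
  Replacing one draw from \<open>P\<close> by one from \<open>Q\<close> turns \<open>G\<close> into \<open>G'\<close>. Counting such replacements from both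
  ends with the preceding formula compares the two events; this stands in for comparing
  neighbouring terms of binomial and multinomial distributions.
\<close>

lemma switching:
  assumes fin: "finite E" "E \<noteq> {}"
    and sw: "\<And>M x y. x \<in> E \<Longrightarrow> P x \<Longrightarrow> y \<in> E \<Longrightarrow> Q y \<Longrightarrow> G (add_mset x M) \<longleftrightarrow> G' (add_mset y M)"
  shows "real (card {y\<in>E. Q y}) * draw_mean E m (\<lambda>M. real (size (filter_mset P M)) * of_bool (G M))
       = real (card {x\<in>E. P x}) * draw_mean E m (\<lambda>M. real (size (filter_mset Q M)) * of_bool (G' M))"
proof (cases m)
  case (Suc l)
  have "real (card {y\<in>E. Q y}) * (\<Sum>x\<in>{x\<in>E. P x}. draw_mean E l (\<lambda>M. of_bool (G (add_mset x M))))
      = (\<Sum>x\<in>{x\<in>E. P x}. \<Sum>y\<in>{y\<in>E. Q y}. draw_mean E l (\<lambda>M. of_bool (G (add_mset x M))))"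
    by (simp add: sum_distrib_left)
  also have "\<dots> = (\<Sum>x\<in>{x\<in>E. P x}. \<Sum>y\<in>{y\<in>E. Q y}. draw_mean E l (\<lambda>M. of_bool (G' (add_mset y M))))"
    using sw by (intro sum.cong refl draw_mean_cong) auto
  also have "\<dots> = real (card {x\<in>E. P x}) * (\<Sum>y\<in>{y\<in>E. Q y}. draw_mean E l (\<lambda>M. of_bool (G' (add_mset y M))))"
    by simp
  finally show ?thesis unfolding Suc mecke[OF fin] by (simp add: field_simps)
qed simp

lemma switching_le:
  assumes fin: "finite E" "E \<noteq> {}"
    and sw: "\<And>M x y. x \<in> E \<Longrightarrow> P x \<Longrightarrow> y \<in> E \<Longrightarrow> Q y \<Longrightarrow> G (add_mset x M) \<longleftrightarrow> G' (add_mset y M)"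
    and lower: "\<And>M. set_mset M \<subseteq> E \<Longrightarrow> size M = m \<Longrightarrow> G M \<Longrightarrow> \<beta> \<le> real (size (filter_mset P M))"
    and upper: "\<And>M. set_mset M \<subseteq> E \<Longrightarrow> size M = m \<Longrightarrow> G' M \<Longrightarrow> real (size (filter_mset Q M)) \<le> \<nu>"
  shows "real (card {y\<in>E. Q y}) * \<beta> * draw_prob E m G \<le> real (card {x\<in>E. P x}) * \<nu> * draw_prob E m G'"
proof -
  have "\<beta> * draw_prob E m G \<le> draw_mean E m (\<lambda>M. real (size (filter_mset P M)) * of_bool (G M))"
    unfolding draw_prob_def draw_mean_cmult[symmetric] using lower by (intro draw_mean_mono) auto
  then have "real (card {y\<in>E. Q y}) * (\<beta> * draw_prob E m G)
      \<le> real (card {y\<in>E. Q y}) * draw_mean E m (\<lambda>M. real (size (filter_mset P M)) * of_bool (G M))"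
    by (intro mult_left_mono) auto
  also have "\<dots> = real (card {x\<in>E. P x}) * draw_mean E m (\<lambda>M. real (size (filter_mset Q M)) * of_bool (G' M))"
    using sw by (rule switching[OF fin])
  also have "\<dots> \<le> real (card {x\<in>E. P x}) * (\<nu> * draw_prob E m G')"
    unfolding draw_prob_def draw_mean_cmult[symmetric] using upper by (intro mult_left_mono draw_mean_mono) auto
  finally show ?thesis by (simp add: mult.assoc)
qed

definition proportion :: "'b set \<Rightarrow> ('b \<Rightarrow> bool) \<Rightarrow> real" where
  "proportion E P = card {x\<in>E. P x} / card E"

lemma draw_mean_count_Suc:
  assumes fin: "finite E" "E \<noteq> {}"
  shows "draw_mean E (Suc m) (\<lambda>M. g (size (filter_mset P M)))
    = proportion E P * draw_mean E m (\<lambda>M. g (Suc (size (filter_mset P M))))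
      + (1 - proportion E P) * draw_mean E m (\<lambda>M. g (size (filter_mset P M)))"
proof -
  let ?a = "draw_mean E m (\<lambda>M. g (Suc (size (filter_mset P M))))" and ?b = "draw_mean E m (\<lambda>M. g (size (filter_mset P M)))"
  have card: "card E = card {x\<in>E. P x} + card {x\<in>E. \<not> P x}"
    using fin by (subst card_Un_disjoint[symmetric]) (auto intro!: arg_cong[where f = card])
  have c: "real (card E) > 0" using fin by (simp add: card_gt_0_iff)
  have "(\<Sum>x\<in>E. draw_mean E m (\<lambda>M. g (size (filter_mset P (add_mset x M)))))
      = (\<Sum>x\<in>E. if P x then ?a else ?b)"
    by (intro sum.cong) auto
  also have "\<dots> = card {x\<in>E. P x} * ?a + card {x\<in>E. \<not> P x} * ?b"
    using fin by (simp add: sum.If_cases Int_def)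
  finally have "draw_mean E (Suc m) (\<lambda>M. g (size (filter_mset P M)))
      = (card {x\<in>E. P x} * ?a + card {x\<in>E. \<not> P x} * ?b) / card E" by simp
  moreover have "1 - proportion E P = card {x\<in>E. \<not> P x} / card E"
  proof -
    have "proportion E P + card {x\<in>E. \<not> P x} / card E = real (card E) / card E"
      unfolding proportion_def add_divide_distrib[symmetric] card by simp
    then show ?thesis using c by simp
  qed
  ultimately show ?thesis by (simp add: proportion_def add_divide_distrib)
qed

text \<open>
  The law of a count depends on the predicate only through its proportion, so all vertices have
  the same degree distribution.
\<close>

lemma draw_mean_count_eq:
  assumes "finite E" "E \<noteq> {}" "proportion E P = proportion E Q"
  shows "draw_mean E m (\<lambda>M. g (size (filter_mset P M))) = draw_mean E m (\<lambda>M. g (size (filter_mset Q M)))"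
proof (induction m arbitrary: g)
  case (Suc m)
  show ?case
    unfolding draw_mean_count_Suc[OF assms(1,2)] assms(3) Suc.IH[of g] Suc.IH[of "\<lambda>k. g (Suc k)"] ..
qed simp

lemma proportion_bounds:
  assumes "finite E"
  shows "0 \<le> proportion E P" "proportion E P \<le> 1"
proof -
  have "card {x\<in>E. P x} \<le> card E" using assms by (intro card_mono) auto
  then show "0 \<le> proportion E P" "proportion E P \<le> 1" by (auto simp: proportion_def divide_le_eq_1)
qed

lemma draw_mean_exp_count:
  fixes \<theta> :: real
  assumes "finite E" "E \<noteq> {}"
  shows "draw_mean E m (\<lambda>M. exp (\<theta> * real (size (filter_mset P M)))) = (1 + proportion E P * (exp \<theta> - 1)) ^ m"
proof (induction m)
  case (Suc m)
  have "(\<lambda>M. exp (\<theta> * real (Suc (size (filter_mset P M))))) = (\<lambda>M. exp \<theta> * exp (\<theta> * real (size (filter_mset P M))))"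
    by (auto simp: algebra_simps exp_add)
  then show ?case
    using draw_mean_count_Suc[OF assms, where g = "\<lambda>k. exp (\<theta> * real k)" and P = P and m = m] Suc
    by (simp only: draw_mean_cmult) (simp add: algebra_simps)
qed simp

lemma chernoff:
  assumes fin: "finite E" "E \<noteq> {}"
    and Q: "\<And>M. Q M \<Longrightarrow> \<theta> * t \<le> \<theta> * real (size (filter_mset P M))"
  shows "draw_prob E m Q \<le> exp (real m * proportion E P * (exp \<theta> - 1) - \<theta> * t)"
proof -
  let ?p = "proportion E P"
  have "draw_prob E m Q \<le> draw_mean E m (\<lambda>M. exp (- (\<theta> * t)) * exp (\<theta> * real (size (filter_mset P M))))"
    unfolding draw_prob_def using Q by (intro draw_mean_mono) (auto simp: exp_add[symmetric])
  also have "\<dots> = exp (- (\<theta> * t)) * (1 + ?p * (exp \<theta> - 1)) ^ m"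
    by (simp only: draw_mean_cmult draw_mean_exp_count[OF fin])
  also have "\<dots> \<le> exp (- (\<theta> * t)) * exp (?p * (exp \<theta> - 1)) ^ m"
  proof (intro mult_left_mono power_mono)
    have "0 \<le> ?p * exp \<theta>" "?p \<le> 1" using proportion_bounds[OF fin(1), of P] by simp_all
    then show "0 \<le> 1 + ?p * (exp \<theta> - 1)" by (simp add: algebra_simps)
  qed auto
  also have "exp (?p * (exp \<theta> - 1)) ^ m = exp (m * (?p * (exp \<theta> - 1)))" by (rule exp_of_nat_mult[symmetric])
  also have "exp (- (\<theta> * t)) * \<dots> = exp (m * (?p * (exp \<theta> - 1)) - \<theta> * t)"
    by (simp add: exp_add[symmetric])
  finally show ?thesis by (simp add: mult.assoc)
qed

text \<open>
  Negative correlation of the two indicators for a single draw passes to the upper tails of the two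
  counts. In the induction step the difference of the two sides factorises into
  \<open>P(P \<and> Q) - P(P) P(Q)\<close> times two increments of tails, which are both nonnegative.
\<close>

lemma negative_correlation:
  assumes fin: "finite E" "E \<noteq> {}"
    and neg: "proportion E (\<lambda>x. P x \<and> Q x) \<le> proportion E P * proportion E Q"
  shows "draw_prob E m (\<lambda>M. a \<le> size (filter_mset P M) \<and> b \<le> size (filter_mset Q M))
    \<le> draw_prob E m (\<lambda>M. a \<le> size (filter_mset P M)) * draw_prob E m (\<lambda>M. b \<le> size (filter_mset Q M))"
proof (induction m arbitrary: a b)
  case 0
  show ?case by (auto simp: draw_prob_def)
next
  case (Suc m)
  define F where "F a b = draw_prob E m (\<lambda>M. a \<le> size (filter_mset P M) \<and> b \<le> size (filter_mset Q M))" for a b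
  define G where "G a = draw_prob E m (\<lambda>M. a \<le> size (filter_mset P M))" for a
  define H where "H b = draw_prob E m (\<lambda>M. b \<le> size (filter_mset Q M))" for b
  define N where "N A B = real (card {x\<in>E. P x = A \<and> Q x = B}) / card E" for A B
  have le: "a - Suc 0 \<le> k \<longleftrightarrow> a \<le> Suc k" for a k :: nat by auto
  have IH: "F a b \<le> G a * H b" for a b unfolding F_def G_def H_def by (rule Suc.IH)
  have c: "real (card E) > 0" using fin by (simp add: card_gt_0_iff)
  have nonneg: "N A B \<ge> 0" for A B by (simp add: N_def)
  have two: "card {x\<in>E. R x} = card {x\<in>E. R x \<and> S x} + card {x\<in>E. R x \<and> \<not> S x}" for R S
    using fin by (subst card_Un_disjoint[symmetric]) (auto intro!: arg_cong[where f = card])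
  have p: "proportion E P = N True True + N True False"
    unfolding proportion_def N_def using two[of P Q] by (simp add: add_divide_distrib)
  have q: "proportion E Q = N True True + N False True"
    unfolding proportion_def N_def using two[of Q P] by (simp add: add_divide_distrib conj_commute)
  have pq: "proportion E (\<lambda>x. P x \<and> Q x) = N True True" by (simp add: proportion_def N_def)
  have one: "N True True + N True False + N False True + N False False = 1"
  proof -
    have "real (card E) = card {x\<in>E. P x \<and> Q x} + card {x\<in>E. P x \<and> \<not> Q x}
        + card {x\<in>E. \<not> P x \<and> Q x} + card {x\<in>E. \<not> P x \<and> \<not> Q x}"
      using two[of "\<lambda>_. True" P] two[of P Q] two[of "\<lambda>x. \<not> P x" Q] by simp
    then have "(card {x\<in>E. P x \<and> Q x} + card {x\<in>E. P x \<and> \<not> Q x}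
        + card {x\<in>E. \<not> P x \<and> Q x} + card {x\<in>E. \<not> P x \<and> \<not> Q x}) / real (card E) = 1" using c by simp
    then show ?thesis unfolding N_def by (simp add: add_divide_distrib)
  qed
  have "draw_prob E (Suc m) (\<lambda>M. a \<le> size (filter_mset P M) \<and> b \<le> size (filter_mset Q M))
     = (\<Sum>x\<in>E. F (if P x then a - 1 else a) (if Q x then b - 1 else b)) / card E"
    unfolding draw_prob_def draw_mean.simps F_def
    by (intro arg_cong2[where f = "(/)"] sum.cong draw_mean_cong refl) auto
  also have "(\<Sum>x\<in>E. F (if P x then a - 1 else a) (if Q x then b - 1 else b))
     = (\<Sum>x\<in>{x\<in>E. P x \<and> Q x}. F (a - 1) (b - 1)) + (\<Sum>x\<in>{x\<in>E. P x \<and> \<not> Q x}. F (a - 1) b)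
       + (\<Sum>x\<in>{x\<in>E. \<not> P x \<and> Q x}. F a (b - 1)) + (\<Sum>x\<in>{x\<in>E. \<not> P x \<and> \<not> Q x}. F a b)"
    using fin unfolding sum.inter_filter[OF fin(1)] sum.distrib[symmetric]
    by (intro sum.cong) auto
  finally have F: "draw_prob E (Suc m) (\<lambda>M. a \<le> size (filter_mset P M) \<and> b \<le> size (filter_mset Q M))
     = N True True * F (a - 1) (b - 1) + N True False * F (a - 1) b
       + N False True * F a (b - 1) + N False False * F a b"
    by (simp add: N_def add_divide_distrib)
  also have "\<dots> \<le> N True True * (G (a - 1) * H (b - 1)) + N True False * (G (a - 1) * H b)
       + N False True * (G a * H (b - 1)) + N False False * (G a * H b)"
    by (intro add_mono mult_left_mono IH nonneg)
  also have "\<dots> \<le> ((N True True + N True False) * G (a - 1) + (1 - (N True True + N True False)) * G a)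
     * ((N True True + N False True) * H (b - 1) + (1 - (N True True + N False True)) * H b)"
  proof -
    have mono: "G a \<le> G (a - 1)" "H b \<le> H (b - 1)"
      unfolding G_def H_def by (auto intro!: draw_prob_mono)
    have "(N True True - (N True True + N True False) * (N True True + N False True))
        * ((G (a - 1) - G a) * (H (b - 1) - H b)) \<le> 0"
      using neg p q pq mono by (intro mult_nonpos_nonneg) auto
    moreover have ff: "N False False = 1 - N True True - N True False - N False True" using one by simp
    ultimately show ?thesis unfolding ff by (simp add: algebra_simps)
  qed
  also have "(N True True + N True False) * G (a - 1) + (1 - (N True True + N True False)) * G a
      = draw_prob E (Suc m) (\<lambda>M. a \<le> size (filter_mset P M))"
    using draw_mean_count_Suc[OF fin, where g = "\<lambda>k. of_bool (a \<le> k)" and P = P and m = m]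
    by (simp add: draw_prob_def G_def p le del: draw_mean.simps)
  also have "(N True True + N False True) * H (b - 1) + (1 - (N True True + N False True)) * H b
      = draw_prob E (Suc m) (\<lambda>M. b \<le> size (filter_mset Q M))"
    using draw_mean_count_Suc[OF fin, where g = "\<lambda>k. of_bool (b \<le> k)" and P = Q and m = m]
    by (simp add: draw_prob_def H_def q le del: draw_mean.simps)
  finally show ?case .
qed

text \<open>
  Chebyshev's inequality for the number of events that occur: under pairwise negative correlation its
  variance is at most its mean.
\<close>

lemma second_moment:
  fixes p :: real
  assumes fin: "finite E" "E \<noteq> {}" and V: "finite V"
    and p: "\<And>v. v \<in> V \<Longrightarrow> draw_prob E m (A v) = p"
    and pair: "\<And>u v. u \<in> V \<Longrightarrow> v \<in> V \<Longrightarrow> u \<noteq> v \<Longrightarrow> draw_prob E m (\<lambda>M. A u M \<and> A v M) \<le> p * p"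
    and pos: "0 < card V * p"
  shows "draw_prob E m (\<lambda>M. \<forall>v\<in>V. \<not> A v M) \<le> 1 / (card V * p)"
proof -
  define X where "X M = (\<Sum>v\<in>V. of_bool (A v M) :: real)" for M
  define \<mu> where "\<mu> = card V * p"
  have EX: "draw_mean E m X = \<mu>"
    unfolding X_def draw_mean_sum[OF V] using p by (simp add: draw_prob_def \<mu>_def)
  have "draw_mean E m (\<lambda>M. X M * X M) = (\<Sum>u\<in>V. \<Sum>v\<in>V. draw_prob E m (\<lambda>M. A u M \<and> A v M))"
    unfolding X_def sum_product draw_mean_sum[OF V] draw_prob_def by (simp add: of_bool_conj)
  also have "\<dots> \<le> (\<Sum>u\<in>V. p + real (card V) * (p * p))"
  proof (intro sum_mono)
    fix u assume u: "u \<in> V"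
    have "(\<Sum>v\<in>V. draw_prob E m (\<lambda>M. A u M \<and> A v M))
        = draw_prob E m (A u) + (\<Sum>v\<in>V-{u}. draw_prob E m (\<lambda>M. A u M \<and> A v M))"
      using u V by (subst sum.remove[of V u]) auto
    also have "\<dots> \<le> p + (\<Sum>v\<in>V-{u}. p * p)"
      using u p pair by (intro add_mono sum_mono) auto
    also have "\<dots> \<le> p + (\<Sum>v\<in>V. p * p)"
      using V by (intro add_left_mono sum_mono2) auto
    finally show "(\<Sum>v\<in>V. draw_prob E m (\<lambda>M. A u M \<and> A v M)) \<le> p + real (card V) * (p * p)" by simp
  qed
  also have "\<dots> = \<mu> + \<mu> * \<mu>" by (simp add: \<mu>_def algebra_simps)
  finally have XX: "draw_mean E m (\<lambda>M. X M * X M) \<le> \<mu> + \<mu> * \<mu>" .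
  have "\<mu> * \<mu> * draw_prob E m (\<lambda>M. \<forall>v\<in>V. \<not> A v M) \<le> draw_mean E m (\<lambda>M. X M * X M + ((- 2 * \<mu>) * X M + \<mu> * \<mu>))"
    unfolding draw_prob_def draw_mean_cmult[symmetric]
  proof (rule draw_mean_mono)
    fix M
    have sq: "X M * X M + (- 2 * \<mu> * X M + \<mu> * \<mu>) = (X M - \<mu>)\<^sup>2" by (simp add: power2_eq_square algebra_simps)
    show "\<mu> * \<mu> * of_bool (\<forall>v\<in>V. \<not> A v M) \<le> X M * X M + (- 2 * \<mu> * X M + \<mu> * \<mu>)"
    proof (cases "\<forall>v\<in>V. \<not> A v M")
      case True
      then have "X M = 0" by (simp add: X_def)
      then show ?thesis using True by simp
    next
      case False
      then have none: "(of_bool (\<forall>v\<in>V. \<not> A v M) :: real) = 0" by auto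
      show ?thesis unfolding sq none by simp
    qed
  qed
  also have "\<dots> = draw_mean E m (\<lambda>M. X M * X M) - 2 * \<mu> * \<mu> + \<mu> * \<mu>"
    unfolding draw_mean_add draw_mean_cmult draw_mean_const[OF fin] EX by simp
  also have "\<dots> \<le> \<mu>" using XX by simp
  finally have "\<mu> * (\<mu> * draw_prob E m (\<lambda>M. \<forall>v\<in>V. \<not> A v M)) \<le> \<mu> * 1" by (simp add: mult.assoc)
  moreover have "\<mu> > 0" using pos by (simp add: \<mu>_def)
  ultimately have "\<mu> * draw_prob E m (\<lambda>M. \<forall>v\<in>V. \<not> A v M) \<le> 1" by (simp only: mult_le_cancel_left_pos)
  then show ?thesis using pos by (simp add: \<mu>_def field_simps)
qed

section \<open>Tails of counts and the degree distribution\<close>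

lemma filter_not_size: "size (filter_mset (\<lambda>x. \<not> P x) M) + size (filter_mset P M) = size M"
  by (induction M) auto

text \<open>
  The union bound over \<open>k\<close>-subsets of the draws, obtained here by drawing them one at a time.
\<close>

lemma tail_factorial_bound:
  assumes fin: "finite E" "E \<noteq> {}"
  shows "draw_prob E m (\<lambda>M. k \<le> size (filter_mset P M)) \<le> (real m * proportion E P) ^ k / fact k"
proof (induction k arbitrary: m)
  case 0
  then show ?case using draw_prob_le_1[OF fin] by simp
next
  case (Suc k)
  let ?p = "proportion E P"
  have p: "?p \<ge> 0" using proportion_bounds[OF fin(1)] by simp
  show ?case
  proof (cases m)
    case 0
    then show ?thesis by (simp add: draw_prob_def)
  next
    case (Suc l)
    have "real (Suc k) * draw_prob E m (\<lambda>M. Suc k \<le> size (filter_mset P M))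
       \<le> draw_mean E m (\<lambda>M. real (size (filter_mset P M)) * of_bool (Suc k \<le> size (filter_mset P M)))"
      unfolding draw_prob_def draw_mean_cmult[symmetric] by (intro draw_mean_mono) auto
    also have "\<dots> = real m * ((\<Sum>x\<in>{x\<in>E. P x}. draw_prob E l (\<lambda>M. k \<le> size (filter_mset P M))) / card E)"
      unfolding Suc mecke[OF fin] draw_prob_def by (intro arg_cong2[where f = "(*)"] refl arg_cong2[where f = "(/)"] sum.cong) auto
    also have "\<dots> = real m * ?p * draw_prob E l (\<lambda>M. k \<le> size (filter_mset P M))"
      by (simp add: proportion_def)
    also have "\<dots> \<le> real m * ?p * ((real l * ?p) ^ k / fact k)"
      using p by (intro mult_left_mono Suc.IH) auto
    also have "\<dots> \<le> real m * ?p * ((real m * ?p) ^ k / fact k)"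
      using p Suc by (intro mult_left_mono divide_right_mono power_mono mult_right_mono) auto
    also have "\<dots> = (real m * ?p) ^ Suc k / fact k" by simp
    finally have "draw_prob E m (\<lambda>M. Suc k \<le> size (filter_mset P M)) \<le> (real m * ?p) ^ Suc k / fact k / real (Suc k)"
      by (subst pos_le_divide_eq) (simp_all only: of_nat_0_less_iff zero_less_Suc mult.commute)
    then show ?thesis by (simp only: divide_divide_eq_left fact_Suc mult.commute)
  qed
qed

lemma exp_le_quadratic: "\<bar>\<theta>\<bar> \<le> 1 \<Longrightarrow> exp \<theta> \<le> 1 + \<theta> + \<theta>\<^sup>2" for \<theta> :: real
proof (cases "\<theta> \<ge> 0")
  case False
  assume a: "\<bar>\<theta>\<bar> \<le> 1"
  define x where "x = - \<theta>"
  have x: "0 < x" "x \<le> 1" using False a by (auto simp: x_def)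
  have "exp \<theta> = 1 / exp x" by (simp add: x_def exp_minus inverse_eq_divide)
  also have "\<dots> \<le> 1 / (1 + x)" using x by (intro divide_left_mono) (auto simp: exp_ge_add_one_self)
  also have "\<dots> \<le> 1 - x + x\<^sup>2"
  proof -
    have "(1 - x + x\<^sup>2) * (1 + x) = 1 + x ^ 3" by (simp add: power2_eq_square power3_eq_cube algebra_simps)
    then have "1 \<le> (1 - x + x\<^sup>2) * (1 + x)" using x by simp
    then show ?thesis using x by (simp add: divide_le_eq)
  qed
  finally show ?thesis by (simp add: x_def)
qed (use exp_bound in auto)

lemma chernoff_quadratic:
  assumes fin: "finite E" "E \<noteq> {}" and \<theta>: "0 \<le> \<theta>" "\<theta> \<le> 1"
  shows "draw_prob E m (\<lambda>M. real m * proportion E P + x \<le> real (size (filter_mset P M)))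
           \<le> exp (real m * proportion E P * \<theta>\<^sup>2 - \<theta> * x)" (is ?up)
    and "draw_prob E m (\<lambda>M. real (size (filter_mset P M)) \<le> real m * proportion E P - x)
           \<le> exp (real m * proportion E P * \<theta>\<^sup>2 - \<theta> * x)" (is ?low)
proof -
  let ?D = "real m * proportion E P"
  have D: "?D \<ge> 0" using proportion_bounds[OF fin(1)] by simp
  have "draw_prob E m (\<lambda>M. ?D + x \<le> real (size (filter_mset P M))) \<le> exp (?D * (exp \<theta> - 1) - \<theta> * (?D + x))"
    using \<theta> by (intro chernoff[OF fin] mult_left_mono) auto
  also have "\<dots> \<le> exp (?D * (\<theta> + \<theta>\<^sup>2) - \<theta> * (?D + x))"
    using exp_le_quadratic[of \<theta>] \<theta> D by (simp add: mult_left_mono)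
  finally show ?up by (simp add: algebra_simps)
  have "draw_prob E m (\<lambda>M. real (size (filter_mset P M)) \<le> ?D - x) \<le> exp (?D * (exp (- \<theta>) - 1) - (- \<theta>) * (?D - x))"
    using \<theta> by (intro chernoff[OF fin, where \<theta> = "- \<theta>"]) (simp add: mult_left_mono)
  also have "\<dots> \<le> exp (?D * (- \<theta> + \<theta>\<^sup>2) - (- \<theta>) * (?D - x))"
    using exp_le_quadratic[of "- \<theta>"] \<theta> D by (simp add: mult_left_mono)
  finally show ?low by (simp add: algebra_simps)
qed

text \<open>
  The ratio of consecutive binomial probabilities, at arguments below \<open>J\<close>, is at most \<open>R\<close>: move one
  draw from the complement of \<open>P\<close> into \<open>P\<close>.
\<close>

lemma tail_window_step:
  assumes fin: "finite E" "E \<noteq> {}"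
    and R: "(1 - proportion E P) * real J \<le> R * (proportion E P * (real m - real J))"
    and pos: "proportion E P * (real m - real J) > 0"
  shows "draw_prob E m (\<lambda>M. t \<le> size (filter_mset P M) \<and> size (filter_mset P M) < J)
    \<le> R * draw_prob E m (\<lambda>M. Suc t \<le> size (filter_mset P M) \<and> size (filter_mset P M) < Suc J)"
    (is "?A \<le> R * ?B")
proof -
  let ?p = "proportion E P"
  have c: "real (card E) > 0" using fin by (simp add: card_gt_0_iff)
  have "real (card {x\<in>E. P x}) * (real m - real J) * ?A \<le> real (card {x\<in>E. \<not> P x}) * real J * ?B"
  proof (rule switching_le[OF fin])
    fix M assume M: "set_mset M \<subseteq> E" "size M = m"
    show "real m - real J \<le> real (size {#x \<in># M. \<not> P x#})"
      if "t \<le> size (filter_mset P M) \<and> size (filter_mset P M) < J"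
      using that filter_not_size[of P M] M by linarith
    show "real (size (filter_mset P M)) \<le> real J"
      if "Suc t \<le> size (filter_mset P M) \<and> size (filter_mset P M) < Suc J"
      using that by simp
  qed auto
  moreover have "real (card {x\<in>E. P x}) = card E * ?p" using c by (simp add: proportion_def)
  moreover have "real (card {x\<in>E. \<not> P x}) = card E * (1 - ?p)"
  proof -
    have "card E = card {x\<in>E. P x} + card {x\<in>E. \<not> P x}"
      using fin by (subst card_Un_disjoint[symmetric]) (auto intro!: arg_cong[where f = card])
    then have "real (card {x\<in>E. \<not> P x}) = real (card E) - real (card {x\<in>E. P x})" by linarith
    then show ?thesis using c by (simp add: proportion_def right_diff_distrib)
  qed
  ultimately have "card E * (?p * (real m - real J) * ?A) \<le> card E * ((1 - ?p) * real J * ?B)"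
    by (simp only: mult.assoc)
  then have "?p * (real m - real J) * ?A \<le> (1 - ?p) * real J * ?B"
    using c by (simp only: mult_le_cancel_left_pos)
  also have "\<dots> \<le> R * (?p * (real m - real J)) * ?B"
    using R draw_prob_nonneg by (intro mult_right_mono) auto
  finally have "(?p * (real m - real J)) * ?A \<le> (?p * (real m - real J)) * (R * ?B)"
    by (simp add: mult_ac)
  then show ?thesis using pos by (simp only: mult_le_cancel_left_pos)
qed

text \<open>
  Raising the threshold by \<open>H\<close> costs a factor of at most \<open>R ^ H\<close>, as long as the count stays below
  \<open>J + H\<close>. Beyond that the ratio of consecutive probabilities gets out of control, and the tail
  itself serves as the error term.
\<close>

lemma tail_shift:
  assumes fin: "finite E" "E \<noteq> {}"
    and R: "(1 - proportion E P) * real (J + H) \<le> R * (proportion E P * (real m - real (J + H)))"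
    and pos: "proportion E P * (real m - real (J + H)) > 0" and R0: "R \<ge> 0"
  shows "draw_prob E m (\<lambda>M. t \<le> size (filter_mset P M))
    \<le> R ^ H * draw_prob E m (\<lambda>M. t + H \<le> size (filter_mset P M)) + draw_prob E m (\<lambda>M. J \<le> size (filter_mset P M))"
proof -
  let ?p = "proportion E P"
  let ?W = "\<lambda>a b. draw_prob E m (\<lambda>M. a \<le> size (filter_mset P M) \<and> size (filter_mset P M) < b)"
  have p: "0 \<le> ?p" "?p \<le> 1" using proportion_bounds[OF fin(1)] by auto
  have step: "?W (t + h) (J + h) \<le> R * ?W (Suc (t + h)) (Suc (J + h))" if "h \<le> H" for h
  proof (rule tail_window_step[OF fin])
    have le: "?p * (real m - real (J + H)) \<le> ?p * (real m - real (J + h))"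
      using that p by (intro mult_left_mono) auto
    show "?p * (real m - real (J + h)) > 0" using le pos by linarith
    have "(1 - ?p) * real (J + h) \<le> (1 - ?p) * real (J + H)"
      using that p by (intro mult_left_mono) auto
    also have "\<dots> \<le> R * (?p * (real m - real (J + H)))" by (rule R)
    also have "\<dots> \<le> R * (?p * (real m - real (J + h)))" using le R0 by (rule mult_left_mono)
    finally show "(1 - ?p) * real (J + h) \<le> R * (?p * (real m - real (J + h)))" .
  qed
  have iter: "?W t J \<le> R ^ h * ?W (t + h) (J + h)" if "h \<le> H" for h
    using that
  proof (induction h)
    case (Suc h)
    have "?W t J \<le> R ^ h * ?W (t + h) (J + h)" using Suc by simp
    also have "\<dots> \<le> R ^ h * (R * ?W (Suc (t + h)) (Suc (J + h)))"
      using step[of h] Suc.prems R0 by (intro mult_left_mono) auto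
    finally show ?case by (simp add: mult_ac)
  qed simp
  have "draw_prob E m (\<lambda>M. t \<le> size (filter_mset P M))
      \<le> draw_prob E m (\<lambda>M. (t \<le> size (filter_mset P M) \<and> size (filter_mset P M) < J) \<or> J \<le> size (filter_mset P M))"
    by (rule draw_prob_mono) auto
  also have "\<dots> \<le> ?W t J + draw_prob E m (\<lambda>M. J \<le> size (filter_mset P M))" by (rule draw_prob_disj_le)
  also have "?W t J \<le> R ^ H * ?W (t + H) (J + H)" by (rule iter) simp
  also have "?W (t + H) (J + H) \<le> draw_prob E m (\<lambda>M. t + H \<le> size (filter_mset P M))"
    by (rule draw_prob_mono) auto
  finally show ?thesis using R0 by (simp add: mult_left_mono)
qed

definition pairs :: "nat \<Rightarrow> nat set set" where
  "pairs n = nsets {1..n} 2"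

lemma pairsE:
  assumes "e \<in> pairs n"
  obtains a b where "e = {a, b}" "a \<in> {1..n}" "b \<in> {1..n}" "a \<noteq> b"
  using assms unfolding pairs_def by (rule nsets2_E)

lemma finite_pairs: "finite (pairs n)"
  unfolding pairs_def by (intro finite_imp_finite_nsets) simp

lemma pairs_nonempty: "n \<ge> 2 \<Longrightarrow> pairs n \<noteq> {}"
proof -
  assume "n \<ge> 2"
  then have "{1, 2} \<in> pairs n" by (simp add: pairs_def nsets_def)
  then show ?thesis by blast
qed

lemma doubleton_in_pairs: "u \<in> {1..n} \<Longrightarrow> v \<in> {1..n} \<Longrightarrow> u \<noteq> v \<Longrightarrow> {u, v} \<in> pairs n"
  by (simp add: pairs_def nsets_def)

lemma real_choose_2: "real (n choose 2) = real n * (real n - 1) / 2"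
  by (cases n) (auto simp: choose_two real_of_nat_div field_simps)

lemma card_pairs: "real (card (pairs n)) = real n * (real n - 1) / 2"
  by (simp add: pairs_def real_choose_2)

lemma card_pairs_containing_not:
  assumes "v \<in> {1..n}" "U \<subseteq> {1..n}" "v \<notin> U"
  shows "card {e \<in> pairs n. v \<in> e \<and> e \<inter> U = {}} = n - 1 - card U"
proof -
  have "{e \<in> pairs n. v \<in> e \<and> e \<inter> U = {}} = (\<lambda>w. {v, w}) ` ({1..n} - {v} - U)"
  proof (intro set_eqI iffI)
    fix e assume e: "e \<in> {e \<in> pairs n. v \<in> e \<and> e \<inter> U = {}}"
    then obtain a b where ab: "e = {a, b}" "a \<in> {1..n}" "b \<in> {1..n}" "a \<noteq> b"
      by (auto elim: pairsE)
    then show "e \<in> (\<lambda>w. {v, w}) ` ({1..n} - {v} - U)" using e by auto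
  qed (use assms in \<open>auto simp: pairs_def nsets_def\<close>)
  moreover have "inj_on (\<lambda>w. {v, w}) ({1..n} - {v} - U)" by (auto simp: inj_on_def doubleton_eq_iff)
  ultimately have "card {e \<in> pairs n. v \<in> e \<and> e \<inter> U = {}} = card ({1..n} - {v} - U)"
    by (simp add: card_image)
  also have "\<dots> = card ({1..n} - {v}) - card U"
    using assms by (intro card_Diff_subset) (auto intro: finite_subset)
  finally show ?thesis using assms by simp
qed

lemma proportion_vertex:
  assumes "v \<in> {1..n}" "n \<ge> 2"
  shows "proportion (pairs n) (\<lambda>e. v \<in> e) = 2 / n"
proof -
  have "card {e \<in> pairs n. v \<in> e} = n - 1" using card_pairs_containing_not[OF assms(1), of "{}"] by simp
  then show ?thesis using assms unfolding proportion_def card_pairs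
    by (simp add: of_nat_diff field_simps)
qed

lemma proportion_pair:
  assumes "e \<in> pairs n"
  shows "proportion (pairs n) (\<lambda>x. x = e) = 2 / (real n * (real n - 1))"
proof -
  have "{x \<in> pairs n. x = e} = {e}" using assms by auto
  then show ?thesis unfolding proportion_def card_pairs by simp
qed

lemma card_pairs_avoiding:
  assumes "u \<in> {1..n}" "v \<in> {1..n}" "u \<noteq> v"
  shows "real (card {e \<in> pairs n. u \<notin> e \<and> v \<notin> e}) = (real n - 2) * (real n - 3) / 2"
proof -
  have n: "n \<ge> 2" using assms by auto
  have "{e \<in> pairs n. u \<notin> e \<and> v \<notin> e} = nsets ({1..n} - {u, v}) 2" by (auto simp: pairs_def nsets_def)
  then have "card {e \<in> pairs n. u \<notin> e \<and> v \<notin> e} = (n - 2) choose 2" using assms by (simp add: card_Diff_subset numeral_2_eq_2)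
  then show ?thesis using n by (simp add: real_choose_2 of_nat_diff)
qed

definition degree_tail :: "nat \<Rightarrow> nat \<Rightarrow> nat \<Rightarrow> real" where
  "degree_tail n m t = draw_prob (pairs n) m (\<lambda>M. t \<le> mg_degree M 1)"

lemma draw_prob_degree:
  assumes "v \<in> {1..n}" "n \<ge> 2"
  shows "draw_prob (pairs n) m (\<lambda>M. t \<le> mg_degree M v) = degree_tail n m t"
  unfolding draw_prob_def degree_tail_def mg_degree_def
  using assms by (intro draw_mean_count_eq[where g = "\<lambda>k. of_bool (t \<le> k)"])
    (auto simp: finite_pairs pairs_nonempty proportion_vertex)

text \<open>
  An edge contains both \<open>u\<close> and \<open>v\<close> with probability \<open>2/(n(n-1))\<close>, which is at most \<open>(2/n)\<^sup>2\<close>.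
\<close>

lemma draw_prob_degree_pair:
  assumes uv: "u \<in> {1..n}" "v \<in> {1..n}" "u \<noteq> v"
  shows "draw_prob (pairs n) m (\<lambda>M. a \<le> mg_degree M u \<and> b \<le> mg_degree M v) \<le> degree_tail n m a * degree_tail n m b"
proof -
  have n: "n \<ge> 2" using uv by auto
  have "proportion (pairs n) (\<lambda>x. u \<in> x \<and> v \<in> x) = proportion (pairs n) (\<lambda>x. x = {u, v})"
  proof -
    have "{x \<in> pairs n. u \<in> x \<and> v \<in> x} = {x \<in> pairs n. x = {u, v}}"
      using uv(3) uv by (auto elim!: pairsE intro: doubleton_in_pairs)
    then show ?thesis by (simp add: proportion_def)
  qed
  also have "\<dots> = 2 / (real n * (real n - 1))" using uv by (intro proportion_pair doubleton_in_pairs)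
  also have "\<dots> \<le> (2 / real n) * (2 / real n)"
    using n by (simp add: field_simps)
  finally have "proportion (pairs n) (\<lambda>x. u \<in> x \<and> v \<in> x)
      \<le> proportion (pairs n) (\<lambda>x. u \<in> x) * proportion (pairs n) (\<lambda>x. v \<in> x)"
    using uv n by (simp add: proportion_vertex)
  from negative_correlation[OF finite_pairs pairs_nonempty[OF n] this, of m a b]
  show ?thesis using draw_prob_degree[OF uv(1) n] draw_prob_degree[OF uv(2) n] by (simp add: mg_degree_def)
qed

lemma degree_tail_nonneg: "degree_tail n m t \<ge> 0"
  by (simp add: degree_tail_def draw_prob_nonneg)

lemma degree_tail_antimono: "s \<le> t \<Longrightarrow> degree_tail n m t \<le> degree_tail n m s"
  unfolding degree_tail_def by (intro draw_prob_mono) auto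

lemma degree_tail_quantile:
  assumes "n \<ge> 2" "0 < q" "q \<le> 1"
  obtains t where "degree_tail n m t \<ge> q" "degree_tail n m (Suc t) < q"
proof -
  have 0: "degree_tail n m 0 = 1"
    using assms by (simp add: degree_tail_def draw_prob_def draw_mean_const finite_pairs pairs_nonempty)
  have "degree_tail n m (Suc m) = draw_prob (pairs n) m (\<lambda>M. False)"
    unfolding degree_tail_def
  proof (rule draw_prob_cong)
    fix M :: "nat set multiset" assume "size M = m"
    then have "mg_degree M 1 \<le> m" unfolding mg_degree_def by (metis size_filter_mset_lesseq)
    then show "Suc m \<le> mg_degree M 1 \<longleftrightarrow> False" by simp
  qed
  then have last: "degree_tail n m (Suc m) < q" using assms by (simp add: draw_prob_def draw_mean_zero)
  define t where "t = (LEAST t. degree_tail n m (Suc t) < q)"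
  have t: "degree_tail n m (Suc t) < q" unfolding t_def using last by (rule LeastI)
  have "degree_tail n m t \<ge> q"
  proof (cases t)
    case 0
    then show ?thesis using \<open>degree_tail n m 0 = 1\<close> assms by simp
  next
    case (Suc s)
    then have "\<not> degree_tail n m (Suc s) < q" using not_less_Least[of s "\<lambda>t. degree_tail n m (Suc t) < q"] by (simp add: t_def)
    then show ?thesis using Suc by simp
  qed
  then show ?thesis using t that by blast
qed

lemma max_degree_reaches_quantile:
  assumes n: "n \<ge> 2" and q: "0 < q" "degree_tail n m t \<ge> q"
  shows "draw_prob (pairs n) m (\<lambda>M. max_degree {1..n} M < t) \<le> 1 / (n * q)"
proof -
  let ?p = "degree_tail n m t"
  have "draw_prob (pairs n) m (\<lambda>M. max_degree {1..n} M < t)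
      = draw_prob (pairs n) m (\<lambda>M. \<forall>v\<in>{1..n}. \<not> t \<le> mg_degree M v)"
    using n by (intro draw_prob_cong) (auto simp: max_degree_def not_le)
  also have "\<dots> \<le> 1 / (card {1..n} * ?p)"
  proof (rule second_moment)
    show "draw_prob (pairs n) m (\<lambda>M. t \<le> mg_degree M v) = ?p" if "v \<in> {1..n}" for v
      using that n by (rule draw_prob_degree)
    show "draw_prob (pairs n) m (\<lambda>M. t \<le> mg_degree M u \<and> t \<le> mg_degree M v) \<le> ?p * ?p"
      if "u \<in> {1..n}" "v \<in> {1..n}" "u \<noteq> v" for u v using that by (rule draw_prob_degree_pair)
    show "0 < real (card {1..n}) * ?p" using n q by simp
  qed (use n in \<open>auto simp: finite_pairs pairs_nonempty\<close>)
  also have "\<dots> \<le> 1 / (n * q)"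
    using n q by (simp add: frac_le)
  finally show ?thesis .
qed

section \<open>Failure probabilities in terms of degree tails\<close>

lemma power_self_le_exp_fact: "real k ^ k \<le> exp (real k) * fact k"
proof -
  have "real k ^ k / fact k = (\<Sum>i\<in>{k}. real k ^ i /\<^sub>R fact i)" by (simp add: divide_inverse mult.commute)
  also have "\<dots> \<le> (\<Sum>i. real k ^ i /\<^sub>R fact i)"
    by (intro sum_le_suminf summable_exp_generic) auto
  also have "\<dots> = exp (real k)" by (simp add: exp_def)
  finally show ?thesis by (simp add: field_simps)
qed

lemma proportion_subset:
  assumes "S \<subseteq> {1..n}" "n \<ge> 2"
  shows "proportion (pairs n) (\<lambda>e. e \<subseteq> S) \<le> (real (card S) / real n)\<^sup>2"
proof -
  define k where "k = card S"
  have k: "k \<le> n" unfolding k_def using assms(1) by (metis card_atLeastAtMost card_mono diff_Suc_1 finite_atLeastAtMost)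
  have "{e \<in> pairs n. e \<subseteq> S} = nsets S 2" using assms(1) by (auto simp: pairs_def nsets_def)
  then have "real (card {e \<in> pairs n. e \<subseteq> S}) = real k * (real k - 1) / 2"
    by (simp add: real_choose_2 k_def)
  then have eq: "proportion (pairs n) (\<lambda>e. e \<subseteq> S) = (real k * (real k - 1)) / (real n * (real n - 1))"
    unfolding proportion_def card_pairs by simp
  have n: "real n > 1" using assms(2) by simp
  have "(real k - 1) / (real n - 1) \<le> real k / real n" using k n by (simp add: field_simps)
  then have "(real k / real n) * ((real k - 1) / (real n - 1)) \<le> (real k / real n) * (real k / real n)"
    by (intro mult_left_mono) auto
  then have "(real k * (real k - 1)) / (real n * (real n - 1)) \<le> (real k / real n)\<^sup>2"
    by (simp add: power2_eq_square)
  then show ?thesis unfolding eq by (simp add: k_def)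
qed

definition fails :: "nat mgraph \<Rightarrow> nat \<Rightarrow> bool" where
  "fails M n \<longleftrightarrow> chromatic_index M \<noteq> max_degree {1..n} M"

text \<open>
  A fixed set of \<open>k\<close> vertices spans at least \<open>k\<close> edges with probability at most
  \<open>(m k\<^sup>2/n\<^sup>2)^k / k!\<close>, and there are at most \<open>n^k / k!\<close> such sets. As \<open>k^k / k! \<le> 3^k\<close>, the sum over all
  sets is a geometric series in \<open>9 m/n\<close>.
\<close>

lemma fails_sparse:
  assumes n: "n \<ge> 2" and m: "18 * real m \<le> real n"
  shows "draw_prob (pairs n) m (\<lambda>M. fails M n) \<le> 18 * real m / real n"
proof -
  let ?V = "{1..n}"
  define r where "r = 9 * real m / real n"
  have r: "0 \<le> r" "r \<le> 1/2" using n m by (auto simp: r_def field_simps)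
  define B where "B S M = (card S \<le> size {#e \<in># M. e \<subseteq> S#})" for S :: "nat set" and M
  define C where "C k = {S. S \<subseteq> ?V \<and> card S = k}" for k
  have one: "draw_prob (pairs n) m (B S) \<le> (real m * (real k / real n)\<^sup>2) ^ k / fact k" if "S \<in> C k" for S k
  proof -
    have S: "S \<subseteq> ?V" "card S = k" using that by (auto simp: C_def)
    have "draw_prob (pairs n) m (B S) \<le> (real m * proportion (pairs n) (\<lambda>e. e \<subseteq> S)) ^ k / fact k"
      unfolding B_def S(2) by (intro tail_factorial_bound finite_pairs pairs_nonempty n)
    also have "\<dots> \<le> (real m * (real k / real n)\<^sup>2) ^ k / fact k"
      using proportion_subset[OF S(1) n] proportion_bounds[OF finite_pairs] S(2)
      by (intro divide_right_mono power_mono mult_left_mono) auto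
    finally show ?thesis .
  qed
  have level: "draw_prob (pairs n) m (\<lambda>M. \<exists>S\<in>C k. B S M) \<le> r ^ k" if k: "k \<le> n" for k
  proof -
    have fin: "finite (C k)" by (simp add: C_def)
    have card: "card (C k) = n choose k" using n_subsets[of ?V k] by (simp add: C_def)
    have "draw_prob (pairs n) m (\<lambda>M. \<exists>S\<in>C k. B S M) \<le> (\<Sum>S\<in>C k. draw_prob (pairs n) m (B S))"
      by (rule draw_prob_ex_le[OF fin])
    also have "\<dots> \<le> (\<Sum>S\<in>C k. (real m * (real k / real n)\<^sup>2) ^ k / fact k)"
      by (intro sum_mono one)
    also have "\<dots> = real (n choose k) * ((real m * (real k / real n)\<^sup>2) ^ k / fact k)"
      by (simp add: card)
    also have "\<dots> \<le> (real n ^ k / fact k) * ((real m * (real k / real n)\<^sup>2) ^ k / fact k)"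
    proof (intro mult_right_mono)
      have "real ((n choose k) * fact k) \<le> real (n ^ k)"
        using binomial_fact_pow[of n k] by (simp only: of_nat_le_iff)
      then show "real (n choose k) \<le> real n ^ k / fact k" by (simp add: field_simps)
    qed auto
    also have "\<dots> = (real m / real n) ^ k * (real k ^ k / fact k)\<^sup>2"
    proof -
      have "real n ^ k * (real m * (real k / real n)\<^sup>2) ^ k = (real n * (real m * (real k / real n)\<^sup>2)) ^ k"
        by (simp add: power_mult_distrib)
      also have "real n * (real m * (real k / real n)\<^sup>2) = (real m / real n) * (real k)\<^sup>2"
        using n by (simp add: power2_eq_square field_simps)
      also have "\<dots> ^ k = (real m / real n) ^ k * (real k ^ k)\<^sup>2"
        by (simp add: power_mult_distrib power_divide power_mult[symmetric] mult.commute)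
      finally show ?thesis by (simp add: power2_eq_square)
    qed
    also have "\<dots> \<le> (real m / real n) ^ k * (3 ^ k)\<^sup>2"
    proof (intro mult_left_mono power_mono)
      have "real k ^ k / fact k \<le> exp (real k)" using power_self_le_exp_fact[of k] by (simp add: field_simps)
      also have "\<dots> = exp 1 ^ k" by (simp add: exp_of_nat_mult[symmetric])
      also have "\<dots> \<le> 3 ^ k" by (intro power_mono exp_le) auto
      finally show "real k ^ k / fact k \<le> 3 ^ k" .
    qed auto
    also have "\<dots> = r ^ k"
    proof -
      have "((3 :: real) ^ k)\<^sup>2 = (3\<^sup>2) ^ k" by (simp only: power_mult[symmetric] mult.commute)
      moreover have "r = (real m / real n) * 3\<^sup>2" by (simp add: r_def)
      ultimately show ?thesis by (simp only: power_mult_distrib)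
    qed
    finally show ?thesis .
  qed
  have "draw_prob (pairs n) m (\<lambda>M. fails M n) \<le> draw_prob (pairs n) m (\<lambda>M. \<exists>k\<in>{1..n}. \<exists>S\<in>C k. B S M)"
  proof (rule draw_prob_mono, rule ccontr)
    fix M assume M: "set_mset M \<subseteq> pairs n" "fails M n" and no: "\<not> (\<exists>k\<in>{1..n}. \<exists>S\<in>C k. B S M)"
    have "chromatic_index M = max_degree ?V M"
    proof (rule class_one_if_sparse)
      show "set_mset M \<subseteq> nsets ?V 2" using M by (simp add: pairs_def)
      fix S assume S: "S \<subseteq> ?V" "S \<noteq> {}"
      have "finite S" using S(1) finite_subset by blast
      then have "card S \<ge> 1" using S(2) by (simp add: Suc_le_eq card_gt_0_iff)
      moreover have "card S \<le> n" using S(1) by (metis card_atLeastAtMost card_mono diff_Suc_1 finite_atLeastAtMost)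
      ultimately have "\<not> B S M" using no S(1) by (auto simp: C_def)
      then show "size {#e \<in># M. e \<subseteq> S#} < card S" by (simp add: B_def)
    qed (use n in auto)
    then show False using M(2) by (simp add: fails_def)
  qed
  also have "\<dots> \<le> (\<Sum>k\<in>{1..n}. draw_prob (pairs n) m (\<lambda>M. \<exists>S\<in>C k. B S M))"
    by (rule draw_prob_ex_le) simp
  also have "\<dots> \<le> (\<Sum>k\<in>{1..n}. r * (1/2) ^ (k - 1))"
  proof (intro sum_mono)
    fix k assume k: "k \<in> {1..n}"
    then have "r ^ k = r * r ^ (k - 1)" by (cases k) auto
    also have "\<dots> \<le> r * (1/2) ^ (k - 1)" using r by (intro mult_left_mono power_mono) auto
    finally show "draw_prob (pairs n) m (\<lambda>M. \<exists>S\<in>C k. B S M) \<le> r * (1/2) ^ (k - 1)"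
      using level[of k] k by simp
  qed
  also have "\<dots> = r * (\<Sum>k<n. (1/2) ^ k)"
    unfolding sum_distrib_left by (rule sum.reindex_bij_witness[where i = Suc and j = "\<lambda>k. k - 1"]) auto
  also have "\<dots> \<le> r * 2"
  proof (intro mult_left_mono r(1))
    have "(\<Sum>k<n. (1/2) ^ k) = (1 - (1/2 :: real) ^ n) / (1 - 1/2)" by (simp add: sum_gp_strict)
    then show "(\<Sum>k<n. (1/2 :: real) ^ k) \<le> 2" by simp
  qed
  finally show ?thesis by (simp add: r_def)
qed

lemma degree_tail_mono_m:
  assumes "n \<ge> 2"
  shows "degree_tail n m t \<le> degree_tail n (Suc m) t"
proof -
  let ?p = "proportion (pairs n) (\<lambda>e. 1 \<in> e)"
  have "degree_tail n (Suc m) t = ?p * draw_mean (pairs n) m (\<lambda>M. of_bool (t \<le> Suc (size {#e \<in># M. 1 \<in> e#})))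
      + (1 - ?p) * degree_tail n m t"
    unfolding degree_tail_def draw_prob_def mg_degree_def
    using draw_mean_count_Suc[OF finite_pairs pairs_nonempty[OF assms], where g = "\<lambda>k. of_bool (t \<le> k)"] .
  moreover have "degree_tail n m t \<le> draw_mean (pairs n) m (\<lambda>M. of_bool (t \<le> Suc (size {#e \<in># M. 1 \<in> e#})))"
    unfolding degree_tail_def draw_prob_def mg_degree_def by (intro draw_mean_mono) auto
  then have "?p * degree_tail n m t \<le> ?p * draw_mean (pairs n) m (\<lambda>M. of_bool (t \<le> Suc (size {#e \<in># M. 1 \<in> e#})))"
    using proportion_bounds[OF finite_pairs] by (intro mult_left_mono)
  ultimately show ?thesis by (simp add: algebra_simps)
qed

lemma count_eq_size_filter: "count M e = size {#x \<in># M. x = e#}"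
  by (induction M) auto

text \<open>
  Removing one copy of \<open>{u, v}\<close> decouples adjacency from the degrees, at the price of lowering the
  threshold by one.
\<close>

lemma adjacent_top_bound:
  assumes uv: "u \<in> {1..n}" "v \<in> {1..n}" "u \<noteq> v"
  shows "draw_prob (pairs n) m (\<lambda>M. count M {u, v} > 0 \<and> a \<le> mg_degree M u \<and> a \<le> mg_degree M v)
    \<le> real m * (2 / (real n * (real n - 1))) * (degree_tail n m (a - 1))\<^sup>2"
proof (cases m)
  case 0
  then show ?thesis by (simp add: draw_prob_def)
next
  case (Suc l)
  have n: "n \<ge> 2" using uv by auto
  let ?e = "{u, v}"
  have e: "?e \<in> pairs n" using uv by (rule doubleton_in_pairs)
  let ?T = "\<lambda>a M. a \<le> mg_degree M u \<and> a \<le> mg_degree M v"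
  have bound: "(\<Sum>x\<in>{?e}. draw_mean (pairs n) l (\<lambda>M. of_bool (?T a (add_mset x M)))) \<le> (degree_tail n m (a - 1))\<^sup>2"
  proof -
    have "(\<Sum>x\<in>{?e}. draw_mean (pairs n) l (\<lambda>M. of_bool (?T a (add_mset x M)))) \<le> draw_prob (pairs n) l (?T (a - 1))"
      unfolding draw_prob_def by simp (intro draw_mean_mono, auto simp: mg_degree_def)
    also have "\<dots> \<le> degree_tail n l (a - 1) * degree_tail n l (a - 1)" using uv by (rule draw_prob_degree_pair)
    also have "\<dots> \<le> degree_tail n m (a - 1) * degree_tail n m (a - 1)"
      using degree_tail_mono_m[OF n, of l "a - 1"] Suc by (intro mult_mono) (auto simp: degree_tail_nonneg)
    finally show ?thesis by (simp add: power2_eq_square)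
  qed
  have "draw_prob (pairs n) m (\<lambda>M. count M ?e > 0 \<and> ?T a M)
      \<le> draw_mean (pairs n) (Suc l) (\<lambda>M. real (size {#x \<in># M. x = ?e#}) * of_bool (?T a M))"
    unfolding draw_prob_def Suc by (intro draw_mean_mono) (auto simp flip: count_eq_size_filter)
  also have "\<dots> = real m * ((\<Sum>x\<in>{x\<in>pairs n. x = ?e}. draw_mean (pairs n) l (\<lambda>M. of_bool (?T a (add_mset x M)))) / card (pairs n))"
    unfolding mecke[OF finite_pairs pairs_nonempty[OF n]] Suc ..
  also have "{x\<in>pairs n. x = ?e} = {?e}" using e by auto
  also have "real m * ((\<Sum>x\<in>{?e}. draw_mean (pairs n) l (\<lambda>M. of_bool (?T a (add_mset x M)))) / card (pairs n))
      \<le> real m * ((degree_tail n m (a - 1))\<^sup>2 / card (pairs n))"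
    by (intro mult_left_mono divide_right_mono bound) auto
  finally show ?thesis unfolding card_pairs by (simp add: mult_ac)
qed

text \<open>
  The three terms bound the probabilities that the maximum degree misses \<open>t\<close>, that some multiplicity
  exceeds \<open>K\<close>, and that two adjacent vertices both have degree within \<open>K\<close> of \<open>t\<close>.
\<close>

lemma fails_middle:
  assumes n: "n \<ge> 2" "even n" and q: "0 < q" "degree_tail n m t \<ge> q"
  shows "draw_prob (pairs n) m (\<lambda>M. fails M n) \<le> 1 / (n * q)
     + real n ^ 2 * (real m * (2 / (real n * (real n - 1)))) ^ Suc K
     + real n ^ 2 * (real m * (2 / (real n * (real n - 1))) * (degree_tail n m (t - K - 1))\<^sup>2)"
proof -
  let ?V = "{1..n}" and ?l = "real m * (2 / (real n * (real n - 1)))"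
  let ?D = "{p \<in> ?V \<times> ?V. fst p \<noteq> snd p}"
  let ?A = "\<lambda>M. max_degree ?V M < t"
  let ?B = "\<lambda>M. \<exists>e\<in>pairs n. Suc K \<le> count M e"
  let ?C = "\<lambda>M. \<exists>p\<in>?D. count M {fst p, snd p} > 0 \<and> t - K \<le> mg_degree M (fst p) \<and> t - K \<le> mg_degree M (snd p)"
  have lam: "?l \<ge> 0" using n by simp
  have "draw_prob (pairs n) m (\<lambda>M. fails M n) \<le> draw_prob (pairs n) m (\<lambda>M. (?A M \<or> ?B M) \<or> ?C M)"
  proof (rule draw_prob_mono, rule ccontr)
    fix M assume M: "set_mset M \<subseteq> pairs n" "fails M n" and no: "\<not> ((?A M \<or> ?B M) \<or> ?C M)"
    have "chromatic_index M = max_degree ?V M"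
    proof (rule class_one_if_top_isolated[where T = 0 and s = K])
      show "set_mset M \<subseteq> nsets ?V 2" using M by (simp add: pairs_def)
      show "count M e \<le> 0 + K" if "e \<in> nsets ?V 2" for e
        using no that by (auto simp: pairs_def not_less_eq_eq)
      fix u v assume uv: "u \<in> ?V" "v \<in> ?V" "u \<noteq> v" "count M {u, v} > 0"
        "mg_degree M u + K > max_degree ?V M"
      show "mg_degree M v + K \<le> max_degree ?V M"
      proof (rule ccontr)
        assume "\<not> ?thesis"
        moreover have "t \<le> max_degree ?V M" using no by auto
        ultimately have "t - K \<le> mg_degree M u" "t - K \<le> mg_degree M v" using uv by auto
        then have "?C M" using uv by (intro bexI[of _ "(u, v)"]) auto
        then show False using no by blast
      qed
    qed (use n in auto)
    then show False using M(2) by (simp add: fails_def)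
  qed
  also have "\<dots> \<le> draw_prob (pairs n) m ?A + draw_prob (pairs n) m ?B + draw_prob (pairs n) m ?C"
    by (intro order.trans[OF draw_prob_disj_le] add_right_mono draw_prob_disj_le)
  also have "draw_prob (pairs n) m ?A \<le> 1 / (n * q)" by (rule max_degree_reaches_quantile[OF n(1) q])
  also have "draw_prob (pairs n) m ?B \<le> real n ^ 2 * ?l ^ Suc K"
  proof -
    have "draw_prob (pairs n) m ?B \<le> (\<Sum>e\<in>pairs n. draw_prob (pairs n) m (\<lambda>M. Suc K \<le> count M e))"
      by (rule draw_prob_ex_le[OF finite_pairs])
    also have "\<dots> \<le> (\<Sum>e\<in>pairs n. ?l ^ Suc K)"
    proof (rule sum_mono)
      fix e assume e: "e \<in> pairs n"
      have "draw_prob (pairs n) m (\<lambda>M. Suc K \<le> count M e) \<le> ?l ^ Suc K / fact (Suc K)"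
        unfolding count_eq_size_filter
        using tail_factorial_bound[OF finite_pairs pairs_nonempty[OF n(1)], where P = "\<lambda>x. x = e"]
        unfolding proportion_pair[OF e] .
      also have "\<dots> \<le> ?l ^ Suc K / 1" using lam by (intro divide_left_mono zero_le_power fact_ge_1) auto
      finally show "draw_prob (pairs n) m (\<lambda>M. Suc K \<le> count M e) \<le> ?l ^ Suc K" by simp
    qed
    also have "\<dots> = real (card (pairs n)) * ?l ^ Suc K" by simp
    also have "\<dots> \<le> real n ^ 2 * ?l ^ Suc K"
      using lam n unfolding card_pairs
      by (intro mult_right_mono zero_le_power) (auto simp: power2_eq_square field_simps)
    finally show ?thesis .
  qed
  also have "draw_prob (pairs n) m ?C \<le> real n ^ 2 * (?l * (degree_tail n m (t - K - 1))\<^sup>2)"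
  proof -
    have fin: "finite ?D" by simp
    have "draw_prob (pairs n) m ?C \<le> (\<Sum>p\<in>?D. ?l * (degree_tail n m (t - K - 1))\<^sup>2)"
      by (intro order.trans[OF draw_prob_ex_le[OF fin]] sum_mono adjacent_top_bound) auto
    also have "\<dots> = real (card ?D) * (?l * (degree_tail n m (t - K - 1))\<^sup>2)" by simp
    also have "\<dots> \<le> real n ^ 2 * (?l * (degree_tail n m (t - K - 1))\<^sup>2)"
    proof (intro mult_right_mono)
      have "card ?D \<le> card (?V \<times> ?V)" by (intro card_mono) auto
      then show "real (card ?D) \<le> real n ^ 2" by (simp add: power2_eq_square flip: of_nat_mult)
    qed (intro mult_nonneg_nonneg lam zero_le_power2)
    finally show ?thesis .
  qed
  finally show ?thesis by simp
qed

text \<open>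
  Above its mean the degree of \<open>v\<close> has a decreasing distribution, even when the edges at \<open>u\<close> are given.
  So each value of the difference of the two degrees is, among \<open>h + 1\<close> consecutive values, the
  least likely one up to lowering the threshold for \<open>v\<close> by at most \<open>h\<close>. The decrease is proved by
  switching an edge at \<open>v\<close> but not \<open>u\<close> to one that avoids both. This keeps the degree of \<open>u\<close> and
  the multiplicity of \<open>{u, v}\<close>; the bound \<open>y\<close> on the latter ensures that \<open>v\<close> has enough edges that
  can be switched.
\<close>

lemma close_degrees_bound:
  assumes uv: "u \<in> {1..n}" "v \<in> {1..n}" "u \<noteq> v" and n: "n \<ge> 4"
    and pos: "real h + y < real A"
    and cond: "(real n - 1) * (real h + y) + 2 * real m \<le> (real n + 1) * real A"
  shows "draw_prob (pairs n) m (\<lambda>M. A \<le> mg_degree M u \<and> A \<le> mg_degree M v \<and> real (count M {u, v}) \<le> y \<and>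
            \<bar>int (mg_degree M v) - int (mg_degree M u)\<bar> \<le> int s)
    \<le> (2 * real s + 1) / (real h + 1) * (degree_tail n m (A - h))\<^sup>2"
proof -
  let ?E = "pairs n"
  let ?P = "\<lambda>e. v \<in> e \<and> u \<notin> e" and ?Q = "\<lambda>e. u \<notin> e \<and> v \<notin> e"
  define G where "G w j M \<longleftrightarrow> A \<le> mg_degree M u \<and> real (count M {u, v}) \<le> y \<and>
      int (mg_degree M v) = int (mg_degree M u) + w - int j \<and> A \<le> mg_degree M v + j" for w j M
  have E: "finite ?E" "?E \<noteq> {}" using n finite_pairs pairs_nonempty by auto
  have both: "size {#e \<in># M. ?P e#} + count M {u, v} = mg_degree M v \<and>
     size {#e \<in># M. ?Q e#} + mg_degree M u + mg_degree M v = size M + count M {u, v}"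
    if "set_mset M \<subseteq> ?E" for M
    using that
  proof (induction M)
    case (add e M)
    have "v \<in> e \<and> u \<in> e \<longleftrightarrow> e = {u, v}"
      using add.prems uv(3) by (auto elim!: pairsE)
    then have "e = {u, v} \<longleftrightarrow> v \<in> e \<and> u \<in> e" by blast
    then show ?case using add by (auto simp: mg_degree_def)
  qed (simp add: mg_degree_def)
  have sizes: "size {#e \<in># M. ?P e#} + count M {u, v} = mg_degree M v"
     "size {#e \<in># M. ?Q e#} + mg_degree M u + mg_degree M v = size M + count M {u, v}"
    if "set_mset M \<subseteq> ?E" for M
    using both[OF that] by simp_all
  have step: "draw_prob ?E m (G w j) \<le> draw_prob ?E m (G w (Suc j))" if j: "Suc j \<le> h" for w j
  proof -
    define \<beta> where "\<beta> = real A - real h - y"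
    define \<nu> where "\<nu> = real m - 2 * real A + real h + y"
    have cP: "real (card {e\<in>?E. ?P e}) = real n - 2"
    proof -
      have "{e\<in>?E. ?P e} = {e\<in>?E. v \<in> e \<and> e \<inter> {u} = {}}" by auto
      then have "card {e\<in>?E. ?P e} = n - 1 - card {u}"
        using card_pairs_containing_not[of v n "{u}"] uv by simp
      then show ?thesis using n by (simp add: of_nat_diff)
    qed
    have cQ: "real (card {e\<in>?E. ?Q e}) = (real n - 2) * (real n - 3) / 2"
      using uv by (rule card_pairs_avoiding)
    have "real (card {e\<in>?E. ?Q e}) * \<beta> * draw_prob ?E m (G w j) \<le> real (card {e\<in>?E. ?P e}) * \<nu> * draw_prob ?E m (G w (Suc j))"
    proof (rule switching_le[OF E])
      fix M x y assume "x \<in> ?E" "?P x" "y \<in> ?E" "?Q y"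
      then show "G w j (add_mset x M) \<longleftrightarrow> G w (Suc j) (add_mset y M)"
        by (auto simp: G_def mg_degree_def)
    next
      fix M assume M: "set_mset M \<subseteq> ?E" "size M = m" "G w j M"
      then show "\<beta> \<le> real (size {#e \<in># M. ?P e#})"
        using sizes(1)[OF M(1)] j unfolding G_def \<beta>_def by linarith
    next
      fix M assume M: "set_mset M \<subseteq> ?E" "size M = m" "G w (Suc j) M"
      then show "real (size {#e \<in># M. ?Q e#}) \<le> \<nu>"
        using sizes(2)[OF M(1)] j unfolding G_def \<nu>_def by linarith
    qed
    also have "real (card {e\<in>?E. ?P e}) * \<nu> * draw_prob ?E m (G w (Suc j))
        \<le> real (card {e\<in>?E. ?Q e}) * \<beta> * draw_prob ?E m (G w (Suc j))"
    proof (intro mult_right_mono draw_prob_nonneg)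
      have "2 * \<nu> \<le> (real n - 3) * \<beta>" using cond unfolding \<beta>_def \<nu>_def by (simp add: algebra_simps)
      then have "(real n - 2) * (2 * \<nu>) \<le> (real n - 2) * ((real n - 3) * \<beta>)"
        using n by (intro mult_left_mono) auto
      then show "real (card {e\<in>?E. ?P e}) * \<nu> \<le> real (card {e\<in>?E. ?Q e}) * \<beta>"
        unfolding cP cQ by simp
    qed
    finally have "real (card {e\<in>?E. ?Q e}) * \<beta> * draw_prob ?E m (G w j)
        \<le> real (card {e\<in>?E. ?Q e}) * \<beta> * draw_prob ?E m (G w (Suc j))" .
    moreover have "real (card {e\<in>?E. ?Q e}) * \<beta> > 0"
      unfolding cQ \<beta>_def using n pos by (intro mult_pos_pos) auto
    ultimately show ?thesis by (simp only: mult_le_cancel_left_pos)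
  qed
  have chain: "draw_prob ?E m (G w 0) \<le> draw_prob ?E m (G w j)" if "j \<le> h" for w j
    using that by (induction j) (auto intro: order.trans step)
  \<comment> \<open>The events \<open>G w 0, \<dots>, G w h\<close> prescribe different degree differences, hence exclude each other.\<close>
  have one: "draw_prob ?E m (G w 0) \<le> (degree_tail n m (A - h))\<^sup>2 / (real h + 1)" for w
  proof -
    have "(real h + 1) * draw_prob ?E m (G w 0) = (\<Sum>j\<in>{..h}. draw_prob ?E m (G w 0))" by (simp add: algebra_simps)
    also have "\<dots> \<le> (\<Sum>j\<in>{..h}. draw_prob ?E m (G w j))" by (intro sum_mono chain) auto
    also have "\<dots> = draw_mean ?E m (\<lambda>M. \<Sum>j\<in>{..h}. of_bool (G w j M))"
      unfolding draw_prob_def by (subst draw_mean_sum) auto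
    also have "\<dots> \<le> draw_prob ?E m (\<lambda>M. A - h \<le> mg_degree M u \<and> A - h \<le> mg_degree M v)"
      unfolding draw_prob_def
    proof (rule draw_mean_mono)
      fix M :: "nat set multiset"
      have "card {j\<in>{..h}. G w j M} \<le> 1"
        by (rule card_le_Suc0_iff_eq[THEN iffD2, folded One_nat_def]) (auto simp: G_def)
      moreover have "(\<Sum>j\<in>{..h}. of_bool (G w j M) :: real) = card {j\<in>{..h}. G w j M}"
        by (simp add: of_bool_def sum.If_cases Int_def)
      moreover have "A - h \<le> mg_degree M u \<and> A - h \<le> mg_degree M v" if "j \<le> h" "G w j M" for j
        using that by (auto simp: G_def)
      then have "{j\<in>{..h}. G w j M} = {}" if "\<not> (A - h \<le> mg_degree M u \<and> A - h \<le> mg_degree M v)"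
        using that by auto
      ultimately show "(\<Sum>j\<in>{..h}. of_bool (G w j M) :: real)
          \<le> of_bool (A - h \<le> mg_degree M u \<and> A - h \<le> mg_degree M v)"
        by (cases "A - h \<le> mg_degree M u \<and> A - h \<le> mg_degree M v") (simp_all del: sum_of_bool_eq)
    qed
    also have "\<dots> \<le> (degree_tail n m (A - h))\<^sup>2" unfolding power2_eq_square using uv by (rule draw_prob_degree_pair)
    finally show ?thesis by (simp add: field_simps)
  qed
  have "draw_prob ?E m (\<lambda>M. A \<le> mg_degree M u \<and> A \<le> mg_degree M v \<and> real (count M {u, v}) \<le> y \<and>
            \<bar>int (mg_degree M v) - int (mg_degree M u)\<bar> \<le> int s)
      \<le> draw_prob ?E m (\<lambda>M. \<exists>w\<in>{- int s..int s}. G w 0 M)"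
  proof (rule draw_prob_mono)
    fix M
    assume "A \<le> mg_degree M u \<and> A \<le> mg_degree M v \<and> real (count M {u, v}) \<le> y \<and>
            \<bar>int (mg_degree M v) - int (mg_degree M u)\<bar> \<le> int s"
    then show "\<exists>w\<in>{- int s..int s}. G w 0 M"
      by (intro bexI[of _ "int (mg_degree M v) - int (mg_degree M u)"]) (auto simp: G_def)
  qed
  also have "\<dots> \<le> (\<Sum>w\<in>{- int s..int s}. (degree_tail n m (A - h))\<^sup>2 / (real h + 1))"
    by (intro order.trans[OF draw_prob_ex_le] sum_mono one) auto
  also have "\<dots> = (2 * real s + 1) / (real h + 1) * (degree_tail n m (A - h))\<^sup>2" by simp
  finally show ?thesis .
qed

section \<open>The dense range and explicit degree tails\<close>

text \<open>
  The spread of the multiplicities is at most \<open>s\<close> once they all lie within \<open>x\<close> of their mean. Then the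
  criterion can only fail if the maximum degree misses \<open>t\<close> or two degrees of at least
  \<open>A = t - s\<close> differ by at most \<open>s\<close>.
\<close>

lemma fails_dense:
  assumes n: "n \<ge> 4" "even n" and q: "0 < q" "degree_tail n m t \<ge> q"
    and lam: "lam = real m * (2 / (real n * (real n - 1)))"
    and \<theta>: "0 \<le> \<theta>" "\<theta> \<le> 1"
    and s: "s = nat \<lfloor>2 * x\<rfloor>" and A: "A = t - s"
    and pos: "real h + (lam + x) < real A"
    and cond: "(real n - 1) * (real h + (lam + x)) + 2 * real m \<le> (real n + 1) * real A"
  shows "draw_prob (pairs n) m (\<lambda>M. fails M n) \<le> 1 / (n * q)
     + real n ^ 2 * exp (lam * \<theta>\<^sup>2 - \<theta> * x)
     + real n ^ 2 * ((2 * real s + 1) / (real h + 1) * (degree_tail n m (A - h))\<^sup>2)"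
proof -
  let ?V = "{1..n}"
  let ?D = "{p \<in> ?V \<times> ?V. fst p \<noteq> snd p}"
  let ?A = "\<lambda>M. max_degree ?V M < t"
  let ?B = "\<lambda>M. \<exists>e\<in>pairs n. lam + x \<le> real (count M e) \<or> real (count M e) \<le> lam - x"
  let ?C = "\<lambda>M. \<exists>p\<in>?D. A \<le> mg_degree M (fst p) \<and> A \<le> mg_degree M (snd p) \<and>
      real (count M {fst p, snd p}) \<le> lam + x \<and> \<bar>int (mg_degree M (snd p)) - int (mg_degree M (fst p))\<bar> \<le> int s"
  have n2: "n \<ge> 2" using n by simp
  have "draw_prob (pairs n) m (\<lambda>M. fails M n) \<le> draw_prob (pairs n) m (\<lambda>M. (?A M \<or> ?B M) \<or> ?C M)"
  proof (rule draw_prob_mono, rule ccontr)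
    fix M assume M: "set_mset M \<subseteq> pairs n" "fails M n" and no: "\<not> ((?A M \<or> ?B M) \<or> ?C M)"
    define T where "T = nat \<lceil>lam - x\<rceil>"
    have T: "lam - x \<le> real T" unfolding T_def by linarith
    have cnt: "real (count M e) < lam + x" "lam - x < real (count M e)" if "e \<in> nsets ?V 2" for e
      using no that by (auto simp: pairs_def not_le)
    have "chromatic_index M = max_degree ?V M"
    proof (rule class_one_if_top_isolated[where T = T and s = s])
      show "set_mset M \<subseteq> nsets ?V 2" using M by (simp add: pairs_def)
      show "T \<le> count M e" if "e \<in> nsets ?V 2" for e
        using cnt(2)[OF that] unfolding T_def by linarith
      show "count M e \<le> T + s" if "e \<in> nsets ?V 2" for e
      proof -
        have "real (count M e) - real T < 2 * x" using cnt(1)[OF that] T by linarith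
        then show ?thesis unfolding s by linarith
      qed
      fix u v assume uv: "u \<in> ?V" "v \<in> ?V" "u \<noteq> v" "mg_degree M u + s > max_degree ?V M"
      show "mg_degree M v + s \<le> max_degree ?V M"
      proof (rule ccontr)
        assume v: "\<not> ?thesis"
        have "t \<le> max_degree ?V M" using no by auto
        then have "A \<le> mg_degree M u" "A \<le> mg_degree M v" using uv v unfolding A by auto
        moreover have "mg_degree M u \<le> max_degree ?V M" "mg_degree M v \<le> max_degree ?V M"
          using uv by (auto intro: mg_degree_le_max_degree)
        then have "\<bar>int (mg_degree M v) - int (mg_degree M u)\<bar> \<le> int s" using uv v by linarith
        moreover have "{u, v} \<in> nsets ?V 2" using uv by (simp add: nsets_def)
        then have "real (count M {u, v}) \<le> lam + x" using cnt(1)[of "{u, v}"] by simp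
        ultimately have "?C M" using uv by (intro bexI[of _ "(u, v)"]) auto
        then show False using no by blast
      qed
    qed (use n in auto)
    then show False using M(2) by (simp add: fails_def)
  qed
  also have "\<dots> \<le> draw_prob (pairs n) m ?A + draw_prob (pairs n) m ?B + draw_prob (pairs n) m ?C"
    by (intro order.trans[OF draw_prob_disj_le] add_right_mono draw_prob_disj_le)
  also have "draw_prob (pairs n) m ?A \<le> 1 / (n * q)" by (rule max_degree_reaches_quantile[OF n2 q])
  also have "draw_prob (pairs n) m ?B \<le> real n ^ 2 * exp (lam * \<theta>\<^sup>2 - \<theta> * x)"
  proof -
    have "draw_prob (pairs n) m ?B
        \<le> (\<Sum>e\<in>pairs n. draw_prob (pairs n) m (\<lambda>M. lam + x \<le> real (count M e) \<or> real (count M e) \<le> lam - x))"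
      by (rule draw_prob_ex_le[OF finite_pairs])
    also have "\<dots> \<le> (\<Sum>e\<in>pairs n. exp (lam * \<theta>\<^sup>2 - \<theta> * x) + exp (lam * \<theta>\<^sup>2 - \<theta> * x))"
    proof (rule sum_mono)
      fix e assume e: "e \<in> pairs n"
      have "draw_prob (pairs n) m (\<lambda>M. lam + x \<le> real (count M e)) \<le> exp (lam * \<theta>\<^sup>2 - \<theta> * x)"
        "draw_prob (pairs n) m (\<lambda>M. real (count M e) \<le> lam - x) \<le> exp (lam * \<theta>\<^sup>2 - \<theta> * x)"
        unfolding count_eq_size_filter lam proportion_pair[OF e, symmetric]
        by (intro chernoff_quadratic finite_pairs pairs_nonempty[OF n2] \<theta>)+
      then show "draw_prob (pairs n) m (\<lambda>M. lam + x \<le> real (count M e) \<or> real (count M e) \<le> lam - x)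
          \<le> exp (lam * \<theta>\<^sup>2 - \<theta> * x) + exp (lam * \<theta>\<^sup>2 - \<theta> * x)"
        by (intro order.trans[OF draw_prob_disj_le] add_mono)
    qed
    also have "\<dots> = (2 * real (card (pairs n))) * exp (lam * \<theta>\<^sup>2 - \<theta> * x)" by simp
    also have "\<dots> \<le> real n ^ 2 * exp (lam * \<theta>\<^sup>2 - \<theta> * x)"
      unfolding card_pairs by (intro mult_right_mono) (auto simp: power2_eq_square algebra_simps)
    finally show ?thesis .
  qed
  also have "draw_prob (pairs n) m ?C \<le> real n ^ 2 * ((2 * real s + 1) / (real h + 1) * (degree_tail n m (A - h))\<^sup>2)"
  proof -
    have fin: "finite ?D" by simp
    have "draw_prob (pairs n) m ?C \<le> (\<Sum>p\<in>?D. (2 * real s + 1) / (real h + 1) * (degree_tail n m (A - h))\<^sup>2)"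
      using n pos cond by (intro order.trans[OF draw_prob_ex_le[OF fin]] sum_mono close_degrees_bound) auto
    also have "\<dots> = real (card ?D) * ((2 * real s + 1) / (real h + 1) * (degree_tail n m (A - h))\<^sup>2)" by simp
    also have "\<dots> \<le> real n ^ 2 * ((2 * real s + 1) / (real h + 1) * (degree_tail n m (A - h))\<^sup>2)"
    proof (intro mult_right_mono)
      have "card ?D \<le> card (?V \<times> ?V)" by (intro card_mono) auto
      then show "real (card ?D) \<le> real n ^ 2" by (simp add: power2_eq_square flip: of_nat_mult)
    qed (intro mult_nonneg_nonneg divide_nonneg_nonneg zero_le_power2; simp)
    finally show ?thesis .
  qed
  finally show ?thesis by simp
qed

text \<open>
  The factor \<open>1 - p\<close> on the left is kept because \<open>d\<close> can be far larger than \<open>n\<^sup>2\<close>. The relative deviation of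
  \<open>J\<close> from \<open>d\<close>, of order \<open>\<surd>(ln n / d)\<close> in the application, is then smaller than \<open>p = 2/n\<close>, and a factor
  \<open>(1 + p) ^ H\<close> would be ruinous.
\<close>

lemma degree_tail_shift:
  assumes n: "n \<ge> 2" and d: "d = 2 * real m / real n" and p: "p = 2 / real n"
    and R: "(1 - p) * real (J + H) \<le> R * (d - p * real (J + H))"
    and pos: "d - p * real (J + H) > 0" and R0: "R \<ge> 0" and le: "t' \<le> t + H"
  shows "degree_tail n m t \<le> R ^ H * degree_tail n m t' + degree_tail n m J"
proof -
  have eq: "proportion (pairs n) (\<lambda>e. 1 \<in> e) = p" using n p by (simp add: proportion_vertex)
  have pm: "p * (real m - real (J + H)) = d - p * real (J + H)" by (simp add: d p right_diff_distrib)
  have "degree_tail n m t \<le> R ^ H * degree_tail n m (t + H) + degree_tail n m J"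
    unfolding degree_tail_def mg_degree_def
    by (rule tail_shift[OF finite_pairs pairs_nonempty[OF n]]) (use eq pm R pos R0 in simp_all)
  also have "\<dots> \<le> R ^ H * degree_tail n m t' + degree_tail n m J"
    using degree_tail_antimono[OF le] R0 by (intro add_right_mono mult_left_mono) auto
  finally show ?thesis .
qed

lemma degree_tail_upper_quadratic:
  assumes n: "n \<ge> 2" and d: "d = 2 * real m / real n" and \<theta>: "0 \<le> \<theta>" "\<theta> \<le> 1"
    and J: "d + x \<le> real J"
  shows "degree_tail n m J \<le> exp (d * \<theta>\<^sup>2 - \<theta> * x)"
proof -
  have eq: "real m * proportion (pairs n) (\<lambda>e. 1 \<in> e) = d" using n d by (simp add: proportion_vertex)
  have "degree_tail n m J \<le> draw_prob (pairs n) m (\<lambda>M. d + x \<le> real (size {#e \<in># M. 1 \<in> e#}))"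
    unfolding degree_tail_def mg_degree_def using J by (intro draw_prob_mono) auto
  also have "\<dots> \<le> exp (d * \<theta>\<^sup>2 - \<theta> * x)"
    using chernoff_quadratic(1)[OF finite_pairs pairs_nonempty[OF n] \<theta>, of m "\<lambda>e. 1 \<in> e" x] unfolding eq .
  finally show ?thesis .
qed

lemma degree_tail_lower_quadratic:
  assumes n: "n \<ge> 2" and d: "d = 2 * real m / real n" and \<theta>: "0 \<le> \<theta>" "\<theta> \<le> 1"
    and J: "real J \<le> d - x + 1"
  shows "1 - exp (d * \<theta>\<^sup>2 - \<theta> * x) \<le> degree_tail n m J"
proof -
  have eq: "real m * proportion (pairs n) (\<lambda>e. 1 \<in> e) = d" using n d by (simp add: proportion_vertex)
  have "1 - degree_tail n m J = draw_prob (pairs n) m (\<lambda>M. \<not> J \<le> size {#e \<in># M. 1 \<in> e#})"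
    unfolding degree_tail_def mg_degree_def using draw_prob_not[OF finite_pairs pairs_nonempty[OF n]] by metis
  also have "\<dots> \<le> draw_prob (pairs n) m (\<lambda>M. real (size {#e \<in># M. 1 \<in> e#}) \<le> d - x)"
    using J by (intro draw_prob_mono) linarith
  also have "\<dots> \<le> exp (d * \<theta>\<^sup>2 - \<theta> * x)"
    using chernoff_quadratic(2)[OF finite_pairs pairs_nonempty[OF n] \<theta>, of m "\<lambda>e. 1 \<in> e" x] unfolding eq .
  finally show ?thesis by linarith
qed

lemma degree_tail_upper_factorial:
  assumes n: "n \<ge> 2" and d: "d = 2 * real m / real n" and J: "9 * d \<le> real J"
  shows "degree_tail n m J \<le> exp (- real J)"
proof -
  have eq: "real m * proportion (pairs n) (\<lambda>e. 1 \<in> e) = d" using n d by (simp add: proportion_vertex)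
  have d0: "d \<ge> 0" by (simp add: d)
  have "degree_tail n m J \<le> d ^ J / fact J"
    using tail_factorial_bound[OF finite_pairs pairs_nonempty[OF n], of m J "\<lambda>e. 1 \<in> e"]
    unfolding eq degree_tail_def mg_degree_def .
  also have "\<dots> \<le> (real J / 9) ^ J / fact J"
    using J d0 by (intro divide_right_mono power_mono) auto
  also have "\<dots> = real J ^ J / fact J / 9 ^ J" by (simp add: power_divide)
  also have "\<dots> \<le> exp (real J) / 9 ^ J"
    using power_self_le_exp_fact[of J] by (intro divide_right_mono) (auto simp: field_simps)
  also have "\<dots> \<le> exp (real J) / exp (2 * real J)"
  proof (intro divide_left_mono)
    have "exp (2 * real J) = (exp 1 * exp 1) ^ J" by (simp add: exp_of_nat_mult[symmetric] exp_add[symmetric] mult.commute)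
    also have "\<dots> \<le> (3 * 3) ^ J" by (intro power_mono mult_mono exp_le) auto
    finally show "exp (2 * real J) \<le> 9 ^ J" by simp
  qed auto
  also have "\<dots> = exp (- real J)" by (simp add: exp_diff[symmetric])
  finally show ?thesis .
qed

section \<open>Bounds uniform in the number of edges\<close>

lemma powr_divide_self: "x > 0 \<Longrightarrow> x powr a / x = x powr (a - 1)" for x :: real
  by (simp add: powr_diff)

lemma powr_times_self: "x > 0 \<Longrightarrow> x * x powr a = x powr (1 + a)" for x :: real
  by (simp add: powr_add)

text \<open>
  A range of pairs \<open>(n, m)\<close> in which the failure probability is bounded by a null sequence in \<open>n\<close> alone.
\<close>

definition negligible :: "(nat \<Rightarrow> nat \<Rightarrow> bool) \<Rightarrow> bool" where
  "negligible R \<longleftrightarrow> (\<exists>\<epsilon>. \<epsilon> \<longlonglongrightarrow> 0 \<and> (\<forall>\<^sub>F n in sequentially. even n \<longrightarrow>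
      (\<forall>m. R n m \<longrightarrow> draw_prob (pairs n) m (\<lambda>M. fails M n) \<le> \<epsilon> n)))"

lemma negligible_low: "negligible (\<lambda>n m. real m \<le> real n powr 0.99)"
  unfolding negligible_def
proof (intro exI conjI)
  let ?\<epsilon> = "\<lambda>n :: nat. 18 * real n powr 0.99 / real n"
  show "?\<epsilon> \<longlonglongrightarrow> 0" by real_asymp
  have "\<forall>\<^sub>F n :: nat in sequentially. 18 * real n powr 0.99 \<le> real n" by real_asymp
  moreover have "\<forall>\<^sub>F n :: nat in sequentially. n \<ge> 2" by (rule eventually_ge_at_top)
  ultimately show "\<forall>\<^sub>F n in sequentially. even n \<longrightarrow>
      (\<forall>m. real m \<le> real n powr 0.99 \<longrightarrow> draw_prob (pairs n) m (\<lambda>M. fails M n) \<le> ?\<epsilon> n)"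
  proof eventually_elim
    case (elim n)
    show ?case
    proof (intro impI allI)
      fix m assume m: "real m \<le> real n powr 0.99"
      then have "18 * real m \<le> real n" using elim(1) by linarith
      then have "draw_prob (pairs n) m (\<lambda>M. fails M n) \<le> 18 * real m / real n"
        by (rule fails_sparse[OF elim(2)])
      also have "\<dots> \<le> ?\<epsilon> n" using m by (intro divide_right_mono) auto
      finally show "draw_prob (pairs n) m (\<lambda>M. fails M n) \<le> ?\<epsilon> n" .
    qed
  qed
qed

text \<open>
  The tail exponents balance as follows: two degrees near the quantile \<open>n powr -0.9\<close> and adjacency cost
  \<open>n\<^sup>2 (d/n) n powr -1.8 \<le> n powr -0.2\<close>. Shifting thresholds by a constant loses a power of
  \<open>\<rho> \<le> n powr (0.01 + o(1))\<close>, because the mean degree is at least \<open>n powr -0.01\<close>.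
\<close>

lemma negligible_middle:
  "negligible (\<lambda>n m. real n powr 0.99 \<le> real m \<and> 2 * real m / real n \<le> real n powr 0.6)"
  unfolding negligible_def
proof (intro exI conjI)
  define \<rho> where "\<rho> n = 18 + (4 * ln (real n) + 16) * real n powr 0.01" for n :: nat
  define \<tau> where "\<tau> n = \<rho> n ^ 7 * real n powr - 0.9 + real n powr - 2" for n :: nat
  let ?\<epsilon> = "\<lambda>n :: nat. real n powr - 0.1 + real n ^ 2 * (2 * real n powr - 0.4) ^ 6
      + real n ^ 2 * (2 * real n powr - 0.4 * (\<tau> n)\<^sup>2)"
  show "?\<epsilon> \<longlonglongrightarrow> 0" unfolding \<tau>_def \<rho>_def by real_asymp
  have "\<forall>\<^sub>F n :: nat in sequentially. n \<ge> 100" by (rule eventually_ge_at_top)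
  moreover have "\<forall>\<^sub>F n :: nat in sequentially. (4 * ln (real n) + 16) / real n \<le> real n powr - 0.01 / 4" by real_asymp
  ultimately show "\<forall>\<^sub>F n in sequentially. even n \<longrightarrow>
      (\<forall>m. real n powr 0.99 \<le> real m \<and> 2 * real m / real n \<le> real n powr 0.6 \<longrightarrow>
        draw_prob (pairs n) m (\<lambda>M. fails M n) \<le> ?\<epsilon> n)"
  proof eventually_elim
    case (elim n)
    show ?case
    proof (intro impI allI)
      fix m assume ev: "even n" and m: "real n powr 0.99 \<le> real m \<and> 2 * real m / real n \<le> real n powr 0.6"
      have n: "n \<ge> 2" "real n \<ge> 100" using elim(1) by auto
      define L where "L = ln (real n)"
      have L: "L \<ge> 0" using n by (simp add: L_def)
      define d where "d = 2 * real m / real n"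
      have d_le: "d \<le> real n powr 0.6" using m by (simp add: d_def)
      have "real n powr - 0.01 = real n powr 0.99 / real n" using n by (simp add: powr_divide_self)
      also have "\<dots> \<le> real m / real n" using m n by (intro divide_right_mono) auto
      also have "\<dots> \<le> d" using n by (simp add: d_def divide_right_mono)
      finally have d_ge: "real n powr - 0.01 \<le> d" .
      then have d0: "d > 0" using n by (smt (verit) powr_gt_zero)
      define q where "q = real n powr - 0.9"
      have "real n powr - 0.9 \<le> real n powr 0" using n by (intro powr_mono) auto
      then have q: "0 < q" "q \<le> 1" using n by (simp_all add: q_def)
      obtain t where t: "degree_tail n m t \<ge> q" "degree_tail n m (Suc t) < q"
        using degree_tail_quantile[OF n(1) q] by metis
      define J where "J = nat \<lceil>9 * d + 2 * L\<rceil>"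
      have J: "9 * d + 2 * L \<le> real J" "real J \<le> 9 * d + 2 * L + 1"
        unfolding J_def using d0 L by linarith+
      have \<rho>: "\<rho> n = 18 + (4 * L + 16) * real n powr 0.01" by (simp add: \<rho>_def L_def)
      have "2 / real n * real (J + 7) \<le> d / 2"
      proof -
        have "2 / real n * real (J + 7) \<le> 2 / real n * (9 * d + 2 * L + 8)"
          using J(2) by (intro mult_left_mono) auto
        also have "\<dots> = 18 / real n * d + (4 * L + 16) / real n" using n by (simp add: field_simps)
        also have "\<dots> \<le> 1 / 4 * d + d / 4"
        proof (intro add_mono mult_right_mono)
          show "(4 * L + 16) / real n \<le> d / 4" using elim(2) d_ge unfolding L_def[symmetric] by linarith
          show "18 / real n \<le> 1 / 4" using n by (simp add: field_simps)
        qed (use d0 in simp)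
        finally show ?thesis by simp
      qed
      then have half: "d / 2 \<le> d - 2 / real n * real (J + 7)" by simp
      have "1 \<le> d * real n powr 0.01"
      proof -
        have "1 = real n powr - 0.01 * real n powr 0.01" using n by (simp flip: powr_add)
        also have "\<dots> \<le> d * real n powr 0.01" using d_ge by (intro mult_right_mono) auto
        finally show ?thesis .
      qed
      then have "(2 * L + 8) * 1 \<le> (2 * L + 8) * (d * real n powr 0.01)"
        using L by (intro mult_left_mono) auto
      then have R1: "real (J + 7) \<le> \<rho> n * (d / 2)" using J(2) unfolding \<rho> by (simp add: algebra_simps)
      have \<rho>0: "\<rho> n \<ge> 0" unfolding \<rho> using L by simp
      have "degree_tail n m (t - 5 - 1) \<le> \<rho> n ^ 7 * degree_tail n m (Suc t) + degree_tail n m J"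
      proof (rule degree_tail_shift[OF n(1) d_def refl])
        show "(1 - 2 / real n) * real (J + 7) \<le> \<rho> n * (d - 2 / real n * real (J + 7))"
        proof -
          have "(1 - 2 / real n) * real (J + 7) \<le> 1 * real (J + 7)"
            using n by (intro mult_right_mono) auto
          also have "\<dots> \<le> \<rho> n * (d - 2 / real n * real (J + 7))"
            using order.trans[OF R1 mult_left_mono[OF half \<rho>0]] by simp
          finally show ?thesis .
        qed
        show "0 < d - 2 / real n * real (J + 7)" using half d0 by linarith
      qed (use \<rho>0 in auto)
      also have "degree_tail n m (Suc t) \<le> real n powr - 0.9" using t(2) by (simp add: q_def)
      also have "degree_tail n m J \<le> real n powr - 2"
      proof -
        have "degree_tail n m J \<le> exp (- real J)" using J(1) L by (intro degree_tail_upper_factorial[OF n(1) d_def]) auto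
        also have "\<dots> \<le> exp (- 2 * L)" using J(1) d0 by simp
        also have "\<dots> = real n powr - 2" using n by (simp add: L_def powr_def)
        finally show ?thesis .
      qed
      finally have tail: "degree_tail n m (t - 5 - 1) \<le> \<tau> n" using \<rho>0 by (simp add: \<tau>_def mult_left_mono)
      define lam where "lam = real m * (2 / (real n * (real n - 1)))"
      have lam: "0 \<le> lam" "lam \<le> 2 * real n powr - 0.4"
      proof -
        show "0 \<le> lam" using n by (simp add: lam_def)
        have "lam = d / (real n - 1)" by (simp add: lam_def d_def)
        also have "\<dots> \<le> d / (real n / 2)" using n d0 by (intro divide_left_mono) auto
        also have "\<dots> = 2 * (d / real n)" by simp
        also have "\<dots> \<le> 2 * (real n powr 0.6 / real n)" using d_le by (intro mult_left_mono divide_right_mono) auto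
        also have "real n powr 0.6 / real n = real n powr - 0.4" using n by (simp add: powr_divide_self)
        finally show "lam \<le> 2 * real n powr - 0.4" .
      qed
      have "draw_prob (pairs n) m (\<lambda>M. fails M n) \<le> 1 / (real n * q) + real n ^ 2 * lam ^ Suc 5
           + real n ^ 2 * (lam * (degree_tail n m (t - 5 - 1))\<^sup>2)"
        unfolding lam_def by (rule fails_middle[OF n(1) ev q(1) t(1)])
      also have "1 / (real n * q) = real n powr - 0.1"
      proof -
        have "real n * q = real n powr 0.1" using n unfolding q_def by (simp add: powr_times_self)
        then show ?thesis by (simp add: powr_minus_divide)
      qed
      also have "Suc 5 = 6" by simp
      also have "lam ^ 6 \<le> (2 * real n powr - 0.4) ^ 6" using lam(2,1) by (rule power_mono)
      also have "lam * (degree_tail n m (t - 5 - 1))\<^sup>2 \<le> 2 * real n powr - 0.4 * (\<tau> n)\<^sup>2"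
        using lam tail degree_tail_nonneg by (intro mult_mono power_mono) auto
      finally show "draw_prob (pairs n) m (\<lambda>M. fails M n) \<le> ?\<epsilon> n" by (simp add: mult_left_mono)
    qed
  qed
qed


text \<open>
  In the application \<open>L = ln n\<close>. Degrees exceed \<open>J = d + 4 \<surd>(d L)\<close> only with probability \<open>n powr -3\<close>, and up to there the
  ratio of consecutive probabilities is at most \<open>1 + 15 \<surd>(L/d)\<close>. Shifts by \<open>H\<close> of smaller order than
  \<open>\<surd>(d/L)\<close> are therefore almost free.
\<close>

lemma degree_tail_shift_dense:
  assumes n: "n \<ge> 100" and d: "d = 2 * real m / real n" and d1: "d \<ge> 1"
    and L: "25 \<le> L" "25 * L \<le> d" and H: "real H \<le> 4 * sqrt d" and le: "t' \<le> t + H"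
  shows "degree_tail n m t \<le> exp (15 * real H * sqrt (L / d)) * degree_tail n m t' + exp (- 3 * L)"
proof -
  define p where "p = 2 / real n"
  have p: "0 \<le> p" "p \<le> 1 / 10" using n by (auto simp: p_def field_simps)
  define w where "w = sqrt (d * L)"
  define z where "z = 5 * w"
  define R where "R = 1 + 15 * sqrt (L / d)"
  have w0: "w \<ge> 0" using d1 L by (simp add: w_def)
  have wd: "w = d * sqrt (L / d)"
  proof -
    have "d * sqrt (L / d) = sqrt (d * d) * sqrt (L / d)" using d1 by simp
    also have "\<dots> = sqrt (d * d * (L / d))" by (simp only: real_sqrt_mult)
    also have "d * d * (L / d) = d * L" using d1 by simp
    finally show ?thesis by (simp add: w_def)
  qed
  have sq5: "5 * sqrt d \<le> w"
  proof -
    have "5 * sqrt d = sqrt (d * 25)" by (simp add: real_sqrt_mult)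
    also have "\<dots> \<le> w" unfolding w_def using L d1 by (intro real_sqrt_le_mono mult_left_mono) auto
    finally show ?thesis .
  qed
  have zd: "z \<le> d"
  proof -
    have "w \<le> sqrt (d * (d / 25))" unfolding w_def using L d1 by (intro real_sqrt_le_mono mult_left_mono) auto
    also have "\<dots> = d / 5" using d1 by (simp add: real_sqrt_divide)
    finally show ?thesis by (simp add: z_def)
  qed
  have Rz: "R = 1 + 3 * z / d" using wd d1 by (simp add: R_def z_def)
  define J where "J = nat \<lceil>d + 4 * w\<rceil>"
  have J: "d + 4 * w \<le> real J" "real J \<le> d + 4 * w + 1"
    unfolding J_def using d1 w0 by linarith+
  have "sqrt d \<ge> 1" using d1 by simp
  then have JH: "real (J + H) \<le> d + z" using J(2) H sq5 unfolding z_def of_nat_add by linarith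
  have z0: "z \<ge> 0" using w0 by (simp add: z_def)
  have pz: "p * (d + z) \<le> 1 / 5 * d"
  proof -
    have "p * (d + z) \<le> 1 / 10 * (d + z)" using p d1 z0 by (intro mult_right_mono) auto
    then show ?thesis using zd by simp
  qed
  have low: "d - p * (d + z) \<le> d - p * real (J + H)" using JH p by (simp add: mult_left_mono)
  have R0: "R \<ge> 0" unfolding R_def using d1 L by simp
  have "degree_tail n m t \<le> R ^ H * degree_tail n m t' + degree_tail n m J"
  proof (rule degree_tail_shift[OF _ d p_def _ _ R0 le])
    show "n \<ge> 2" using n by simp
    show "0 < d - p * real (J + H)" using low pz d1 by linarith
    have "(1 - p) * real (J + H) \<le> (1 - p) * (d + z)" using JH p by (intro mult_left_mono) auto
    also have "\<dots> \<le> R * (d - p * (d + z))"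
    proof -
      have "3 * z / d * (p * (d + z)) \<le> 3 * z / d * (1 / 5 * d)"
        using pz z0 d1 by (intro mult_left_mono) auto
      also have "\<dots> = 3 / 5 * z" using d1 by simp
      finally have "3 * z / d * (p * (d + z)) \<le> 3 / 5 * z" .
      moreover have "R * (d - p * (d + z)) = d - p * (d + z) + 3 * z - 3 * z / d * (p * (d + z))"
        unfolding Rz using d1 by (simp add: algebra_simps)
      moreover have "(1 - p) * (d + z) = d + z - p * (d + z)" by (simp add: algebra_simps)
      ultimately show ?thesis using z0 by linarith
    qed
    also have "\<dots> \<le> R * (d - p * real (J + H))" using low R0 by (rule mult_left_mono)
    finally show "(1 - p) * real (J + H) \<le> R * (d - p * real (J + H))" .
  qed
  also have "R ^ H \<le> exp (15 * sqrt (L / d)) ^ H"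
    unfolding R_def using d1 L by (intro power_mono exp_ge_add_one_self) auto
  also have "\<dots> = exp (15 * real H * sqrt (L / d))" by (simp add: exp_of_nat_mult[symmetric] mult_ac)
  also have "degree_tail n m J \<le> exp (d * (sqrt (L / d))\<^sup>2 - sqrt (L / d) * (4 * w))"
  proof (rule degree_tail_upper_quadratic[OF _ d _ _ J(1)])
    show "sqrt (L / d) \<le> 1" using L d1 by simp
  qed (use n L d1 in auto)
  also have "d * (sqrt (L / d))\<^sup>2 - sqrt (L / d) * (4 * w) = - 3 * L"
  proof -
    have "sqrt (L / d) * w = d * (sqrt (L / d))\<^sup>2" unfolding wd by (simp only: power2_eq_square mult_ac)
    moreover have "(sqrt (L / d))\<^sup>2 = L / d" using L d1 by simp
    ultimately show ?thesis using d1 by simp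
  qed
  finally show ?thesis by (simp add: mult_right_mono degree_tail_nonneg)
qed

text \<open>
  The degree exceeds \<open>d - 2 \<surd>d\<close> with probability at least one half. Shifting that threshold to \<open>d + \<surd>d\<close> costs
  a factor \<open>exp (60 \<surd>(ln n))\<close>, which is less than any power of \<open>n\<close>. No normal approximation is
  involved.
\<close>

lemma quantile_above_mean:
  assumes n: "n \<ge> 100" and d: "d = 2 * real m / real n" and d1: "d \<ge> 100"
    and L: "25 \<le> L" "25 * L \<le> d"
    and q: "degree_tail n m (Suc t) < q" and small: "q \<le> exp (- 60 * sqrt L) / 4"
  shows "d + sqrt d \<le> real t"
proof -
  have sd: "sqrt d \<ge> 10" using d1 by (simp add: real_le_rsqrt)
  have sd2: "sqrt d * sqrt d = d" using d1 by simp
  define a where "a = nat \<lceil>d - 2 * sqrt d\<rceil>"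
  define b where "b = nat \<lceil>d + sqrt d\<rceil>"
  have "2 * sqrt d \<le> sqrt d * sqrt d" using sd d1 by (intro mult_right_mono) auto
  then have nn: "d - 2 * sqrt d \<ge> 0" using sd2 by simp
  have a: "d - 2 * sqrt d \<le> real a" "real a \<le> d - 2 * sqrt d + 1"
    unfolding a_def using nn by linarith+
  have b: "d + sqrt d \<le> real b" "real b \<le> d + sqrt d + 1"
    unfolding b_def using d1 sd by linarith+
  have ab: "a \<le> b" using a(2) b(1) sd by linarith
  have "1 - exp (d * (1 / sqrt d)\<^sup>2 - 1 / sqrt d * (2 * sqrt d)) \<le> degree_tail n m a"
  proof (rule degree_tail_lower_quadratic[OF _ d _ _ a(2)])
    show "0 \<le> 1 / sqrt d" using d1 by simp
    show "1 / sqrt d \<le> 1" using d1 by simp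
  qed (use n in simp)
  also have "d * (1 / sqrt d)\<^sup>2 - 1 / sqrt d * (2 * sqrt d) = - 1"
    using d1 by (simp add: power_divide)
  finally have "1 - exp (- 1) \<le> degree_tail n m a" by simp
  moreover have "exp (- 1 :: real) \<le> 1 / 2"
    using exp_ge_add_one_self[of "1 :: real"] by (simp add: exp_minus field_simps)
  ultimately have half: "1 / 2 \<le> degree_tail n m a" by linarith
  have H: "real (b - a) \<le> 4 * sqrt d" using a b ab sd by (simp add: of_nat_diff)
  have "degree_tail n m a \<le> exp (15 * real (b - a) * sqrt (L / d)) * degree_tail n m b + exp (- 3 * L)"
    using d1 by (intro degree_tail_shift_dense[OF n d _ L H]) auto
  also have "exp (15 * real (b - a) * sqrt (L / d)) \<le> exp (60 * sqrt L)"
  proof -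
    have "15 * real (b - a) * sqrt (L / d) \<le> 15 * (4 * sqrt d) * sqrt (L / d)"
      using H L d1 by (intro mult_right_mono mult_left_mono) auto
    also have "\<dots> = 60 * (sqrt d * sqrt (L / d))" by simp
    also have "sqrt d * sqrt (L / d) = sqrt L"
      using d1 by (simp add: real_sqrt_divide)
    finally show ?thesis by simp
  qed
  also have "exp (- 3 * L) \<le> 1 / 4"
  proof -
    have "4 \<le> 1 + 3 * L" using L by simp
    also have "\<dots> \<le> exp (3 * L)" by (rule exp_ge_add_one_self)
    finally show ?thesis by (simp add: exp_minus field_simps)
  qed
  finally have "1 / 4 \<le> exp (60 * sqrt L) * degree_tail n m b"
    using half degree_tail_nonneg by (simp add: mult_right_mono)
  then have "exp (- 60 * sqrt L) / 4 \<le> degree_tail n m b" by (simp add: exp_minus field_simps)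
  then have "q \<le> degree_tail n m b" using small by linarith
  then have "\<not> Suc t \<le> b" using q degree_tail_antimono[of "Suc t" b n m] by linarith
  then have "b \<le> t" by simp
  then show ?thesis using b(1) by linarith
qed


text \<open>
  The multiplicities lie within \<open>x = 4 (\<surd>(\<lambda> L) + L)\<close> of their mean. In units of \<open>\<sigma> = \<surd>d\<close> this is at most \<open>\<kappa>\<close>,
  which tends to zero like \<open>n powr -0.3\<close> up to logarithms. The window is \<open>h = \<sigma>/L\<close>, large compared
  with the spread but small enough for the shift by \<open>s + h\<close> to be almost free. The
  \<open>n powr 0.2\<close> pairs near the top thus coincide up to \<open>s\<close> with probability of order
  \<open>n powr -0.3\<close> each, up to logarithms.
\<close>

lemma negligible_high: "negligible (\<lambda>n m. real n powr 0.6 \<le> 2 * real m / real n)"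
  unfolding negligible_def
proof (intro exI conjI)
  define \<kappa> where "\<kappa> n = 4 * (sqrt (2 * ln (real n) / real n) + ln (real n) * real n powr - 0.3)" for n :: nat
  define \<eta> where "\<eta> n = sqrt (ln (real n)) * (2 * \<kappa> n + 1 / ln (real n) + real n powr - 0.3)" for n :: nat
  define \<tau> where "\<tau> n = exp (15 * \<eta> n) * real n powr - 0.9 + real n powr - 3" for n :: nat
  let ?\<epsilon> = "\<lambda>n :: nat. real n powr - 0.1 + 1 / real n
      + real n ^ 2 * (ln (real n) * (4 * \<kappa> n + real n powr - 0.3) * (\<tau> n)\<^sup>2)"
  show "?\<epsilon> \<longlonglongrightarrow> 0" unfolding \<tau>_def \<eta>_def \<kappa>_def by real_asymp
  have "\<forall>\<^sub>F n :: nat in sequentially. n \<ge> 100" by (rule eventually_ge_at_top)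
  moreover have "\<forall>\<^sub>F n :: nat in sequentially. 25 \<le> ln (real n)" by real_asymp
  moreover have "\<forall>\<^sub>F n :: nat in sequentially. 25 * ln (real n) \<le> real n powr 0.6" by real_asymp
  moreover have "\<forall>\<^sub>F n :: nat in sequentially. real n powr - 0.9 \<le> exp (- 60 * sqrt (ln (real n))) / 4" by real_asymp
  moreover have "\<forall>\<^sub>F n :: nat in sequentially. 3 * \<kappa> n + 1 / ln (real n) + real n powr - 0.3 \<le> 1"
    unfolding \<kappa>_def by real_asymp
  moreover have "\<forall>\<^sub>F n :: nat in sequentially. 100 \<le> real n powr 0.6" by real_asymp
  ultimately show "\<forall>\<^sub>F n in sequentially. even n \<longrightarrow>
      (\<forall>m. real n powr 0.6 \<le> 2 * real m / real n \<longrightarrow> draw_prob (pairs n) m (\<lambda>M. fails M n) \<le> ?\<epsilon> n)"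
  proof eventually_elim
    case (elim n)
    show ?case
    proof (intro impI allI)
      fix m assume ev: "even n" and m: "real n powr 0.6 \<le> 2 * real m / real n"
      have n: "n \<ge> 2" "n \<ge> 4" "real n \<ge> 100" using elim(1) by auto
      define L where "L = ln (real n)"
      note elim = elim[folded L_def]
      define d where "d = 2 * real m / real n"
      define \<sigma> where "\<sigma> = sqrt d"
      define \<delta> where "\<delta> = real n powr - 0.3"
      have L: "25 \<le> L" "25 * L \<le> d" "L > 0" using elim(2,3) m by (auto simp: d_def)
      have d1: "d \<ge> 100" using elim(6) m by (simp add: d_def)
      have \<sigma>0: "\<sigma> > 0" using d1 by (simp add: \<sigma>_def)
      have \<sigma>_ge: "1 \<le> \<sigma> * \<delta>"
      proof -
        have "(real n powr 0.3)\<^sup>2 \<le> d" using m n by (simp add: d_def powr_power)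
        then have "real n powr 0.3 \<le> \<sigma>" unfolding \<sigma>_def by (rule real_le_rsqrt)
        then have "real n powr 0.3 * \<delta> \<le> \<sigma> * \<delta>" unfolding \<delta>_def by (intro mult_right_mono) auto
        then show ?thesis using n by (simp add: \<delta>_def flip: powr_add)
      qed
      define lam where "lam = real m * (2 / (real n * (real n - 1)))"
      have lamd: "(real n - 1) * lam = d" using n by (simp add: lam_def d_def field_simps)
      have lam: "0 \<le> lam" "lam \<le> d" "lam * L \<le> d * (2 * L / real n)"
      proof -
        show l0: "0 \<le> lam" using n by (simp add: lam_def)
        show "lam \<le> d" using mult_right_mono[of 1 "real n - 1" lam] n l0 lamd by simp
        have "lam * (real n / 2) \<le> lam * (real n - 1)" using n l0 by (intro mult_left_mono) auto
        then have "lam \<le> d * (2 / real n)" using lamd n by (simp add: field_simps)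
        then have "lam * L \<le> d * (2 / real n) * L" using L by (intro mult_right_mono) auto
        then show "lam * L \<le> d * (2 * L / real n)" by simp
      qed
      define x where "x = 4 * (sqrt (lam * L) + L)"
      have x0: "x \<ge> 0" using lam L by (simp add: x_def)
      have x_le: "x \<le> \<kappa> n * \<sigma>"
      proof -
        have "sqrt (lam * L) \<le> sqrt (d * (2 * L / real n))" using lam(3) by (rule real_sqrt_le_mono)
        also have "\<dots> = \<sigma> * sqrt (2 * L / real n)" unfolding \<sigma>_def by (rule real_sqrt_mult)
        finally have 1: "sqrt (lam * L) \<le> \<sigma> * sqrt (2 * L / real n)" .
        have "L * 1 \<le> L * (\<sigma> * \<delta>)" using \<sigma>_ge L by (intro mult_left_mono) auto
        then have "sqrt (lam * L) + L \<le> \<sigma> * (sqrt (2 * L / real n) + L * \<delta>)"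
          using 1 by (simp add: algebra_simps)
        then have "4 * (sqrt (lam * L) + L) \<le> 4 * (\<sigma> * (sqrt (2 * L / real n) + L * \<delta>))" by simp
        then show ?thesis unfolding x_def \<kappa>_def L_def[symmetric] \<delta>_def[symmetric] by (simp only: mult_ac)
      qed
      \<comment> \<open>The Chernoff parameter is \<open>\<surd>(L/\<lambda>)\<close>, cut off at 1 for small mean multiplicity.\<close>
      obtain \<theta> where \<theta>: "0 \<le> \<theta>" "\<theta> \<le> 1" "lam * \<theta>\<^sup>2 - \<theta> * x \<le> - 3 * L"
      proof (cases "L \<le> lam")
        case True
        have "sqrt (L / lam) * sqrt (lam * L) = L"
          using True L by (simp flip: real_sqrt_mult)
        moreover have "lam * (sqrt (L / lam))\<^sup>2 = L" using True L by simp
        moreover have "sqrt (L / lam) * x = 4 * (sqrt (L / lam) * sqrt (lam * L)) + 4 * (sqrt (L / lam) * L)"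
          by (simp add: x_def algebra_simps)
        moreover have "0 \<le> sqrt (L / lam) * L" using True L by simp
        ultimately have "lam * (sqrt (L / lam))\<^sup>2 - sqrt (L / lam) * x \<le> - 3 * L" by linarith
        then show ?thesis using that[of "sqrt (L / lam)"] True L by simp
      next
        case False
        have "4 * L \<le> x" using lam L by (simp add: x_def)
        then have "lam - x \<le> - 3 * L" using False by linarith
        then show ?thesis using that[of 1] by simp
      qed
      define q where "q = real n powr - 0.9"
      have "real n powr - 0.9 \<le> real n powr 0" using n by (intro powr_mono) auto
      then have q: "0 < q" "q \<le> 1" using n by (simp_all add: q_def)
      obtain t where t: "degree_tail n m t \<ge> q" "degree_tail n m (Suc t) < q"
        using degree_tail_quantile[OF n(1) q] by metis
      have t_ge: "d + \<sigma> \<le> real t"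
        unfolding \<sigma>_def using elim(4) d1
        by (intro quantile_above_mean[OF elim(1) d_def _ L(1,2) t(2)]) (auto simp: q_def)
      define s where "s = nat \<lfloor>2 * x\<rfloor>"
      define h where "h = nat \<lfloor>\<sigma> / L\<rfloor>"
      define A where "A = t - s"
      have s: "real s \<le> 2 * x" unfolding s_def using x0 by linarith
      have "0 \<le> \<sigma> / L" using \<sigma>0 L by simp
      then have h: "real h \<le> \<sigma> / L" "\<sigma> / L \<le> real h + 1" unfolding h_def by linarith+
      have budget: "3 * x + real h + 1 \<le> \<sigma>"
      proof -
        have "3 * x + real h + 1 \<le> 3 * (\<kappa> n * \<sigma>) + \<sigma> / L + \<sigma> * \<delta>" using x_le h \<sigma>_ge by linarith
        also have "\<dots> = \<sigma> * (3 * \<kappa> n + 1 / L + \<delta>)" by (simp add: algebra_simps)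
        also have "\<dots> \<le> \<sigma> * 1" using elim(5) \<sigma>0 by (intro mult_left_mono) (auto simp: \<delta>_def)
        finally show ?thesis by simp
      qed
      have "real s \<le> real t" using t_ge s budget d1 x0 by linarith
      then have A: "real A = real t - real s" by (simp add: A_def of_nat_diff)
      have A_ge: "d + real h + x + 1 \<le> real A" unfolding A using t_ge s budget by linarith
      have tail: "degree_tail n m (A - h) \<le> \<tau> n"
      proof -
        define H where "H = s + h + 1"
        have H_le: "real H \<le> \<sigma> * (2 * \<kappa> n + 1 / L + \<delta>)"
        proof -
          have "real H \<le> 2 * (\<kappa> n * \<sigma>) + \<sigma> / L + \<sigma> * \<delta>" using s x_le h \<sigma>_ge by (simp add: H_def)
          then show ?thesis by (simp add: algebra_simps)
        qed
        have "real H \<le> 4 * sqrt d" using s budget x0 \<sigma>0 by (simp add: H_def \<sigma>_def)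
        then have "degree_tail n m (A - h) \<le> exp (15 * real H * sqrt (L / d)) * degree_tail n m (Suc t) + exp (- 3 * L)"
          using d1 by (intro degree_tail_shift_dense[OF elim(1) d_def _ L(1,2)]) (auto simp: H_def A_def)
        also have "exp (15 * real H * sqrt (L / d)) \<le> exp (15 * \<eta> n)"
        proof -
          have "real H * sqrt (L / d) \<le> \<sigma> * (2 * \<kappa> n + 1 / L + \<delta>) * sqrt (L / d)"
            using H_le L d1 by (intro mult_right_mono) auto
          also have "\<dots> = \<eta> n"
            using \<sigma>0 unfolding \<eta>_def L_def[symmetric] \<delta>_def[symmetric]
            by (simp add: real_sqrt_divide \<sigma>_def[symmetric])
          finally show ?thesis by simp
        qed
        also have "degree_tail n m (Suc t) \<le> real n powr - 0.9" using t(2) by (simp add: q_def)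
        also have "exp (- 3 * L) = real n powr - 3" using n by (simp add: L_def powr_def)
        finally show ?thesis by (simp add: \<tau>_def degree_tail_nonneg mult_right_mono)
      qed
      have ratio: "(2 * real s + 1) / (real h + 1) \<le> L * (4 * \<kappa> n + \<delta>)"
      proof -
        have "2 * real s + 1 \<le> 4 * (\<kappa> n * \<sigma>) + \<sigma> * \<delta>" using s x_le \<sigma>_ge by linarith
        then have "(2 * real s + 1) / (real h + 1) \<le> (4 * (\<kappa> n * \<sigma>) + \<sigma> * \<delta>) / (\<sigma> / L)"
          using h \<sigma>0 L by (intro frac_le) auto
        also have "\<dots> = L * (4 * \<kappa> n + \<delta>)" using \<sigma>0 L by (simp add: field_simps)
        finally show ?thesis .
      qed
      have "draw_prob (pairs n) m (\<lambda>M. fails M n) \<le> 1 / (real n * q)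
         + real n ^ 2 * exp (lam * \<theta>\<^sup>2 - \<theta> * x)
         + real n ^ 2 * ((2 * real s + 1) / (real h + 1) * (degree_tail n m (A - h))\<^sup>2)"
      proof (rule fails_dense[OF n(2) ev q(1) t(1) lam_def \<theta>(1,2) s_def A_def])
        show "real h + (lam + x) < real A" using A_ge lam by linarith
        have "2 * real m = real n * d" using n by (simp add: d_def)
        then have "(real n - 1) * (real h + (lam + x)) + 2 * real m
            = (real n - 1) * (real h + x) + ((real n - 1) * lam + real n * d)"
          by (simp add: algebra_simps)
        also have "\<dots> = (real n - 1) * (real h + x) + (real n + 1) * d"
          unfolding lamd by (simp add: algebra_simps)
        also have "\<dots> \<le> (real n + 1) * (real h + x) + (real n + 1) * d"
          using x0 n by (intro add_right_mono mult_right_mono) auto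
        also have "\<dots> = (real n + 1) * (real h + x + d)" by (simp add: algebra_simps)
        also have "\<dots> \<le> (real n + 1) * real A" using A_ge by (intro mult_left_mono) auto
        finally show "(real n - 1) * (real h + (lam + x)) + 2 * real m \<le> (real n + 1) * real A" .
      qed
      also have "1 / (real n * q) = real n powr - 0.1"
      proof -
        have "real n * q = real n powr 0.1" using n unfolding q_def by (simp add: powr_times_self)
        then show ?thesis by (simp add: powr_minus_divide)
      qed
      also have "real n ^ 2 * exp (lam * \<theta>\<^sup>2 - \<theta> * x) \<le> 1 / real n"
      proof -
        have "exp (lam * \<theta>\<^sup>2 - \<theta> * x) \<le> exp (- 3 * L)" using \<theta>(3) by simp
        also have "\<dots> = 1 / real n ^ 3"
        proof -
          have "exp (3 * L) = real n ^ 3" using n exp_of_nat_mult[of 3 L] by (simp add: L_def)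
          then show ?thesis by (simp add: exp_minus inverse_eq_divide)
        qed
        finally have "real n ^ 2 * exp (lam * \<theta>\<^sup>2 - \<theta> * x) \<le> real n ^ 2 * (1 / real n ^ 3)"
          by (intro mult_left_mono) auto
        also have "\<dots> = 1 / real n" using n by (simp add: power2_eq_square power3_eq_cube)
        finally show ?thesis .
      qed
      also have "(2 * real s + 1) / (real h + 1) * (degree_tail n m (A - h))\<^sup>2
          \<le> ln (real n) * (4 * \<kappa> n + real n powr - 0.3) * (\<tau> n)\<^sup>2"
      proof (intro mult_mono power_mono tail degree_tail_nonneg)
        show "(2 * real s + 1) / (real h + 1) \<le> ln (real n) * (4 * \<kappa> n + real n powr - 0.3)"
          using ratio unfolding L_def \<delta>_def .
        have "0 \<le> (2 * real s + 1) / (real h + 1)" by simp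
        then show "0 \<le> ln (real n) * (4 * \<kappa> n + real n powr - 0.3)"
          using ratio unfolding L_def \<delta>_def by linarith
      qed simp
      finally show "draw_prob (pairs n) m (\<lambda>M. fails M n) \<le> ?\<epsilon> n" by (simp add: mult_left_mono)
    qed
  qed
qed

theorem theorem1p5:
  fixes m :: "nat \<Rightarrow> nat"
  shows "((\<lambda>n. measure_pmf.prob (random_multigraph n (m n))
             {M. chromatic_index M = max_degree {1..n} M}) \<longlongrightarrow> 1)
           (inf at_top (principal {n. even n}))"
proof -
  obtain \<epsilon>1 where \<epsilon>1: "\<epsilon>1 \<longlonglongrightarrow> 0" "\<forall>\<^sub>F n in sequentially. even n \<longrightarrow>
      (\<forall>m. real m \<le> real n powr 0.99 \<longrightarrow> draw_prob (pairs n) m (\<lambda>M. fails M n) \<le> \<epsilon>1 n)"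
    using negligible_low unfolding negligible_def by blast
  obtain \<epsilon>2 where \<epsilon>2: "\<epsilon>2 \<longlonglongrightarrow> 0" "\<forall>\<^sub>F n in sequentially. even n \<longrightarrow>
      (\<forall>m. real n powr 0.99 \<le> real m \<and> 2 * real m / real n \<le> real n powr 0.6 \<longrightarrow>
        draw_prob (pairs n) m (\<lambda>M. fails M n) \<le> \<epsilon>2 n)"
    using negligible_middle unfolding negligible_def by blast
  obtain \<epsilon>3 where \<epsilon>3: "\<epsilon>3 \<longlonglongrightarrow> 0" "\<forall>\<^sub>F n in sequentially. even n \<longrightarrow>
      (\<forall>m. real n powr 0.6 \<le> 2 * real m / real n \<longrightarrow> draw_prob (pairs n) m (\<lambda>M. fails M n) \<le> \<epsilon>3 n)"
    using negligible_high unfolding negligible_def by blast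
  define \<epsilon> where "\<epsilon> n = \<bar>\<epsilon>1 n\<bar> + \<bar>\<epsilon>2 n\<bar> + \<bar>\<epsilon>3 n\<bar>" for n
  have "\<epsilon> \<longlonglongrightarrow> \<bar>0\<bar> + \<bar>0\<bar> + \<bar>0\<bar>"
    unfolding \<epsilon>_def using \<epsilon>1(1) \<epsilon>2(1) \<epsilon>3(1) by (intro tendsto_add tendsto_rabs)
  then have "(\<lambda>n. 1 - \<epsilon> n) \<longlonglongrightarrow> 1 - 0" by (intro tendsto_diff tendsto_const) simp
  then have "(\<lambda>n. 1 - \<epsilon> n) \<longlonglongrightarrow> 1" by simp
  then have lim: "((\<lambda>n. 1 - \<epsilon> n) \<longlongrightarrow> 1) (inf at_top (principal {n. even n}))"
    by (rule tendsto_mono[rotated]) simp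
  let ?F = "\<lambda>n. measure_pmf.prob (random_multigraph n (m n)) {M. chromatic_index M = max_degree {1..n} M}"
  have "\<forall>\<^sub>F n in sequentially. n \<in> {n. even n} \<longrightarrow> 1 - \<epsilon> n \<le> ?F n"
    using \<epsilon>1(2) \<epsilon>2(2) \<epsilon>3(2) eventually_ge_at_top[of 2]
  proof eventually_elim
    case (elim n)
    show ?case
    proof
      assume "n \<in> {n. even n}"
      then have ev: "even n" by simp
      consider "real (m n) \<le> real n powr 0.99"
        | "real n powr 0.99 \<le> real (m n) \<and> 2 * real (m n) / real n \<le> real n powr 0.6"
        | "real n powr 0.6 \<le> 2 * real (m n) / real n" by linarith
      then have "draw_prob (pairs n) (m n) (\<lambda>M. fails M n) \<le> \<epsilon> n"
      proof cases
        case 1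
        then have "draw_prob (pairs n) (m n) (\<lambda>M. fails M n) \<le> \<epsilon>1 n" using elim(1) ev by blast
        then show ?thesis unfolding \<epsilon>_def by linarith
      next
        case 2
        then have "draw_prob (pairs n) (m n) (\<lambda>M. fails M n) \<le> \<epsilon>2 n" using elim(2) ev by blast
        then show ?thesis unfolding \<epsilon>_def by linarith
      next
        case 3
        then have "draw_prob (pairs n) (m n) (\<lambda>M. fails M n) \<le> \<epsilon>3 n" using elim(3) ev by blast
        then show ?thesis unfolding \<epsilon>_def by linarith
      qed
      moreover have "?F n = 1 - draw_prob (pairs n) (m n) (\<lambda>M. fails M n)"
        unfolding prob_random_multigraph[OF elim(4)] pairs_def[symmetric]
          draw_prob_not[OF finite_pairs pairs_nonempty[OF elim(4)], symmetric] fails_def by simp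
      ultimately show "1 - \<epsilon> n \<le> ?F n" by simp
    qed
  qed
  then have ge: "\<forall>\<^sub>F n in inf at_top (principal {n. even n}). 1 - \<epsilon> n \<le> ?F n"
    by (simp add: eventually_inf_principal)
  show ?thesis
    by (rule tendsto_sandwich[OF ge _ lim tendsto_const]) simp
qed

end
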